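(* Let $E$ be a symmetric space on $I$ and let $x\in E$ with $x^*(\infty)=0$. Consider the conditions: (i) $x$ is an LKM point and an $H_g$ point of $E$. (ii) $x$ is an LKM point of $E$, and for every sequence $(x_n)\subset E$ such that $x_n^{**}\to x^{**}$ in measure and $\|x_n\|_E\to\|x\|_E$ we have $\|x_n^*-x^*\|_E\to0$. (iii) $x$ is an LLUKM point of $E$. Then (i) $\Rightarrow$ (ii) $\Rightarrow$ (iii). Moreover, if $x$ is an $H_g$ point of $E$, then (iii) $\Rightarrow$ (i).
   Context: Let $I=[0,\alpha)$ with $\alpha=1$ or $\alpha=\infty$, with Lebesgue measure $\mu$, and let $L^0$ be the set of (equivalence classes of) extended real valued measurable functions on $I$. A Banach function space $(E,\|\cdot\|_E)$ is a Banach lattice that is a sublattice of $L^0$ such that (1) $x\in L^0$, $y\in E$, $|x|\le|y|$ a.e. imply $x\in E$ and $\|x\|_E\le\|y\|_E$; (2) $E$ contains a strictly positive function. $E^+=\{x\in E:x\ge0\}$. For $x\in L^0$: $d_x(\lambda)=\mu\{s\in I:|x(s)|>\lambda\}$, $x^*(t)=\inf\{\lambda>0:d_x(\lambda)\le t\}$, $x^{**}(t)=\frac1t\int_0^t x^*(s)\,ds$; $x^*(\infty)=\lim_{t\to\infty}x^*(t)$ if $\alpha=\infty$ and $x^*(\infty)=0$ if $\alpha=1$. $E$ is symmetric if $x\in L^0$, $y\in E$, $d_x=d_y$ imply $x\in E$ and $\|x\|_E=\|y\|_E$. Standing assumption: $E$ has the Fatou property, i.e. if $(x_n)\subset E^+$,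 $\sup_n\|x_n\|_E<\infty$ and $x_n\uparrow x\in L^0$, then $x\in E$ and $\|x_n\|_E\uparrow\|x\|_E$. For $x,y\in L^1+L^\infty$, $x\prec y$ means $x^{**}(t)\le y^{**}(t)$ for all $t>0$. $x\in E$ is an LKM point (point of lower $K$-monotonicity) if for every $y\in E$ with $x^*\ne y^*$ and $y\prec x$ we have $\|y\|_E<\|x\|_E$. $x\in E$ is an LLUKM point (point of lower local uniform $K$-monotonicity) if for every $(x_n)\subset E$ with $x_n\prec x$ for all $n$ and $\|x_n\|_E\to\|x\|_E$ we have $\|x^*-x_n^*\|_E\to0$. $x\in E$ is an $H_g$ point if for every $(x_n)\subset E$ with $x_n\to x$ globally in measure and $\|x_n\|_E\to\|x\|_E$ we have $\|x_n-x\|_E\to0$. "In measure" and "globally in measure" mean $\mu\{|x_n-x|>\epsilon\}\to0$ for all $\epsilon>0$. *)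

theory Defs
  imports "HOL-Analysis.Analysis"
begin

definition I_measure :: "ereal \<Rightarrow> real measure" where
  "I_measure \<alpha> = lebesgue_on {t. 0 \<le> t \<and> ereal t < \<alpha>}"

text \<open>Equivalence classes modulo almost everywhere equality are represented by their members:
  a function space is a set of measurable functions, and the relations between its elements are
  imposed almost everywhere. The values of a function outside \<open>I\<close> are irrelevant.\<close>

definition L0 :: "ereal \<Rightarrow> (real \<Rightarrow> ereal) set" where
  "L0 \<alpha> = borel_measurable (I_measure \<alpha>)"

text \<open>The elements of a linear space of classes of extended real valued functions are finite
  almost everywhere, so the totalisation of \<open>\<infinity> - \<infinity>\<close> in type \<^typ>\<open>ereal\<close> does not matter below.
  The axiom \<open>ideal\<close> makes \<open>E\<close> and \<open>nrm\<close> invariant under almost everywhere equality, and it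
  contains the monotonicity of a lattice norm. Nothing is required of \<open>nrm\<close> outside \<open>E\<close>.\<close>

locale banach_function_space =
  fixes \<alpha> :: ereal
    and E :: "(real \<Rightarrow> ereal) set"
    and nrm :: "(real \<Rightarrow> ereal) \<Rightarrow> real"
  assumes alpha: "\<alpha> = 1 \<or> \<alpha> = \<infinity>"
    and subset_L0: "E \<subseteq> L0 \<alpha>"
    and finite_AE: "\<And>x. x \<in> E \<Longrightarrow> AE t in I_measure \<alpha>. \<bar>x t\<bar> \<noteq> \<infinity>"
    and add_closed: "\<And>x y. x \<in> E \<Longrightarrow> y \<in> E \<Longrightarrow> (\<lambda>t. x t + y t) \<in> E"
    and scale_closed: "\<And>c x. x \<in> E \<Longrightarrow> (\<lambda>t. ereal c * x t) \<in> E"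
    and sup_closed: "\<And>x y. x \<in> E \<Longrightarrow> y \<in> E \<Longrightarrow> (\<lambda>t. max (x t) (y t)) \<in> E"
    and inf_closed: "\<And>x y. x \<in> E \<Longrightarrow> y \<in> E \<Longrightarrow> (\<lambda>t. min (x t) (y t)) \<in> E"
    and nrm_nonneg: "\<And>x. x \<in> E \<Longrightarrow> 0 \<le> nrm x"
    and nrm_eq_0_iff: "\<And>x. x \<in> E \<Longrightarrow> nrm x = 0 \<longleftrightarrow> (AE t in I_measure \<alpha>. x t = 0)"
    and nrm_triangle: "\<And>x y. x \<in> E \<Longrightarrow> y \<in> E \<Longrightarrow> nrm (\<lambda>t. x t + y t) \<le> nrm x + nrm y"
    and nrm_scale: "\<And>c x. x \<in> E \<Longrightarrow> nrm (\<lambda>t. ereal c * x t) = \<bar>c\<bar> * nrm x"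
    and complete: "\<And>X :: nat \<Rightarrow> real \<Rightarrow> ereal.
        (\<And>n. X n \<in> E) \<Longrightarrow>
        (\<And>e::real. e > 0 \<Longrightarrow> \<exists>K. \<forall>m\<ge>K. \<forall>n\<ge>K. nrm (\<lambda>t. X m t - X n t) < e) \<Longrightarrow>
        \<exists>x\<in>E. (\<lambda>n. nrm (\<lambda>t. X n t - x t)) \<longlonglongrightarrow> 0"
    and ideal: "\<And>x y. x \<in> L0 \<alpha> \<Longrightarrow> y \<in> E \<Longrightarrow> (AE t in I_measure \<alpha>. \<bar>x t\<bar> \<le> \<bar>y t\<bar>) \<Longrightarrow>
        x \<in> E \<and> nrm x \<le> nrm y"
    and strictly_positive: "\<exists>w\<in>E. AE t in I_measure \<alpha>. 0 < w t"

definition distr_fun :: "ereal \<Rightarrow> (real \<Rightarrow> ereal) \<Rightarrow> real \<Rightarrow> ennreal" where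
  "distr_fun \<alpha> x l =
     emeasure (I_measure \<alpha>) {s \<in> space (I_measure \<alpha>). \<bar>x s\<bar> > ereal l}"

text \<open>The functions \<open>x\<^sup>*\<close> and \<open>x\<^sup>*\<^sup>*\<close> are meant for arguments \<open>t \<ge> 0\<close> and \<open>t > 0\<close>. Since
  \<open>ennreal t = 0\<close> for \<open>t < 0\<close>, \<open>x\<^sup>*(t) = x\<^sup>*(0)\<close> there, so equality of rearrangements as
  functions on the type \<^typ>\<open>real\<close> is equality on \<open>[0,\<infinity>)\<close>; by right continuity this is
  the same as equality almost everywhere.\<close>

definition rearrangement :: "ereal \<Rightarrow> (real \<Rightarrow> ereal) \<Rightarrow> real \<Rightarrow> ereal" where
  "rearrangement \<alpha> x t = Inf {ereal l | l. 0 < l \<and> distr_fun \<alpha> x l \<le> ennreal t}"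

definition maximal_fun :: "ereal \<Rightarrow> (real \<Rightarrow> ereal) \<Rightarrow> real \<Rightarrow> ereal" where
  "maximal_fun \<alpha> x t =
     enn2ereal (\<integral>\<^sup>+s\<in>{0..t}. e2ennreal (rearrangement \<alpha> x s) \<partial>lborel) / ereal t"

definition rearrangement_at_infinity :: "ereal \<Rightarrow> (real \<Rightarrow> ereal) \<Rightarrow> ereal" where
  "rearrangement_at_infinity \<alpha> x = (if \<alpha> = \<infinity> then Lim at_top (rearrangement \<alpha> x) else 0)"

locale symmetric_space = banach_function_space +
  assumes symmetric: "\<And>x y. x \<in> L0 \<alpha> \<Longrightarrow> y \<in> E \<Longrightarrow> distr_fun \<alpha> x = distr_fun \<alpha> y \<Longrightarrow>
        x \<in> E \<and> nrm x = nrm y"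

definition fatou_property ::
    "ereal \<Rightarrow> (real \<Rightarrow> ereal) set \<Rightarrow> ((real \<Rightarrow> ereal) \<Rightarrow> real) \<Rightarrow> bool" where
  "fatou_property \<alpha> E nrm \<longleftrightarrow>
     (\<forall>X x. (\<forall>n::nat. X n \<in> E \<and> (AE t in I_measure \<alpha>. 0 \<le> X n t)) \<longrightarrow>
        bdd_above (range (\<lambda>n. nrm (X n))) \<longrightarrow>
        x \<in> L0 \<alpha> \<longrightarrow>
        (AE t in I_measure \<alpha>. incseq (\<lambda>n. X n t) \<and> (\<lambda>n. X n t) \<longlonglongrightarrow> x t) \<longrightarrow>
        x \<in> E \<and> incseq (\<lambda>n. nrm (X n)) \<and> (\<lambda>n. nrm (X n)) \<longlonglongrightarrow> nrm x)"

text \<open>A symmetric space is contained in \<open>L\<^sup>1 + L\<^sup>\<infinity>\<close>, so for its elements the maximal functions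
  below are finite on \<open>(0,\<infinity>)\<close> and no such membership needs to be required.\<close>

definition submajorized :: "ereal \<Rightarrow> (real \<Rightarrow> ereal) \<Rightarrow> (real \<Rightarrow> ereal) \<Rightarrow> bool" where
  "submajorized \<alpha> x y \<longleftrightarrow> (\<forall>t>0. maximal_fun \<alpha> x t \<le> maximal_fun \<alpha> y t)"

definition tendsto_in_measure ::
    "ereal \<Rightarrow> (nat \<Rightarrow> real \<Rightarrow> ereal) \<Rightarrow> (real \<Rightarrow> ereal) \<Rightarrow> bool" where
  "tendsto_in_measure \<alpha> X x \<longleftrightarrow>
     (\<forall>e::real. e > 0 \<longrightarrow>
        (\<lambda>n. emeasure (I_measure \<alpha>)
           {t \<in> space (I_measure \<alpha>). \<bar>X n t - x t\<bar> > ereal e}) \<longlonglongrightarrow> 0)"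

definition LKM_point ::
    "ereal \<Rightarrow> (real \<Rightarrow> ereal) set \<Rightarrow> ((real \<Rightarrow> ereal) \<Rightarrow> real) \<Rightarrow> (real \<Rightarrow> ereal) \<Rightarrow> bool" where
  "LKM_point \<alpha> E nrm x \<longleftrightarrow> x \<in> E \<and>
     (\<forall>y\<in>E. rearrangement \<alpha> x \<noteq> rearrangement \<alpha> y \<longrightarrow> submajorized \<alpha> y x \<longrightarrow> nrm y < nrm x)"

definition LLUKM_point ::
    "ereal \<Rightarrow> (real \<Rightarrow> ereal) set \<Rightarrow> ((real \<Rightarrow> ereal) \<Rightarrow> real) \<Rightarrow> (real \<Rightarrow> ereal) \<Rightarrow> bool" where
  "LLUKM_point \<alpha> E nrm x \<longleftrightarrow> x \<in> E \<and>
     (\<forall>X. (\<forall>n::nat. X n \<in> E \<and> submajorized \<alpha> (X n) x) \<longrightarrow>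
        (\<lambda>n. nrm (X n)) \<longlonglongrightarrow> nrm x \<longrightarrow>
        (\<lambda>n. nrm (\<lambda>t. rearrangement \<alpha> x t - rearrangement \<alpha> (X n) t)) \<longlonglongrightarrow> 0)"

definition Hg_point ::
    "ereal \<Rightarrow> (real \<Rightarrow> ereal) set \<Rightarrow> ((real \<Rightarrow> ereal) \<Rightarrow> real) \<Rightarrow> (real \<Rightarrow> ereal) \<Rightarrow> bool" where
  "Hg_point \<alpha> E nrm x \<longleftrightarrow> x \<in> E \<and>
     (\<forall>X. (\<forall>n::nat. X n \<in> E) \<longrightarrow>
        tendsto_in_measure \<alpha> X x \<longrightarrow>
        (\<lambda>n. nrm (X n)) \<longlonglongrightarrow> nrm x \<longrightarrow>
        (\<lambda>n. nrm (\<lambda>t. X n t - x t)) \<longlonglongrightarrow> 0)"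

end

theory Submission
  imports Defs
begin

text \<open>Write \<open>\<Phi>\<^sub>x(t)\<close> for the integral of \<open>x\<^sup>*\<close> over \<open>[0,t]\<close>, a concave function of \<open>t\<close>.

  A symmetric space with the Fatou property has a norm that is monotone for submajorization:
  averaging a decreasing function over an interval does not increase its norm (it is a limit of
  averages of cyclic rotations), and a step function submajorized by \<open>y\<^sup>*\<close> is dominated by a function
  obtained from \<open>y\<^sup>*\<close> by finitely many such averagings.

  For (ii) \<open>\<Rightarrow>\<close> (iii), suppose that \<open>x\<^sub>n \<prec> x\<close> but \<open>\<Phi>\<close> of \<open>x\<^sub>n\<close> does not converge to \<open>\<Phi>\<^sub>x\<close> at
  some point. Then infinitely many \<open>x\<^sub>n\<close> satisfy \<open>x\<^sub>n \<prec> y \<prec> x\<close> with one fixed \<open>y\<close> such that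
  \<open>y\<^sup>* \<noteq> x\<^sup>*\<close>, and lower \<open>K\<close>-monotonicity keeps \<open>\<parallel>x\<^sub>n\<parallel> \<le> \<parallel>y\<parallel> < \<parallel>x\<parallel>\<close> away from \<open>\<parallel>x\<parallel>\<close>.

  For (i) \<open>\<Rightarrow>\<close> (ii), convergence in measure of the maximal functions forces
  \<open>x\<^sub>n\<^sup>* \<rightarrow> x\<^sup>*\<close> globally in measure, because \<open>\<Phi>\<close> is concave and \<open>x\<^sup>*(\<infinity>) = 0\<close>; a measure
  preserving \<open>\<sigma>\<close> with \<open>|x| = x\<^sup>* \<circ> \<sigma>\<close> carries this to a sequence converging to \<open>x\<close>, to which
  the \<open>H\<^sub>g\<close> property applies.\<close>

section \<open>Rearrangements\<close>

text \<open>Two difficulties shape the preliminaries: x* may be infinite at 0, and integrability of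
  x* near 0 has to be derived. Both are met by working strictly to the right of 0. Finiteness there
  follows because the elements of E are finite almost everywhere; the averaging inequality, first
  proved for integrals that omit an initial piece, bounds those integrals by the norm. The Fatou
  property carries the comparison of norms from step functions to all of E.

  The fixed y of (ii) implies (iii) comes from a line that separates \<Phi>_x from infinitely many
  \<Phi> of x_n: the minimum of \<Phi>_x and the line is again concave, and it is the largest
  candidate below both. On the half-line, x*(\<infinity>) = 0 makes \<Phi>_x sublinear, so that a
  line of positive slope overtakes it. The same condition controls the tails in measure and gives
  the sets {|x| > l} finite measure, which the construction of \<sigma> uses.

  From (iii) to the LKM property, constant sequences suffice: y submajorized by x with the same norm
  would give x* - y* norm 0.\<close>

definition ival :: "ereal \<Rightarrow> real set" where
  "ival \<alpha> = {t. 0 \<le> t \<and> ereal t < \<alpha>}"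

lemma ival_borel [measurable, simp]: "ival \<alpha> \<in> sets borel"
  unfolding ival_def by measurable

lemma ival_lebesgue [simp]: "ival \<alpha> \<in> sets lebesgue"
  by (intro sets_completionI_sets) simp

lemma I_measure_ival: "I_measure \<alpha> = lebesgue_on (ival \<alpha>)"
  by (simp add: I_measure_def ival_def)

lemma space_I [simp]: "space (I_measure \<alpha>) = ival \<alpha>"
  by (simp add: I_measure_ival)

lemma sets_I_iff: "A \<in> sets (I_measure \<alpha>) \<longleftrightarrow> A \<subseteq> ival \<alpha> \<and> A \<in> sets lebesgue"
  by (auto simp: I_measure_ival sets_restrict_space_iff)

lemma emeasure_I: "A \<subseteq> ival \<alpha> \<Longrightarrow> emeasure (I_measure \<alpha>) A = emeasure lebesgue A"
  by (simp add: I_measure_ival emeasure_restrict_space)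

lemma AE_I_iff: "(AE t in I_measure \<alpha>. P t) \<longleftrightarrow> (AE t in lebesgue. t \<in> ival \<alpha> \<longrightarrow> P t)"
  unfolding I_measure_ival by (subst AE_restrict_space_iff) simp_all

lemma measurable_I_borel: "f \<in> borel_measurable borel \<Longrightarrow> f \<in> borel_measurable (I_measure \<alpha>)"
  unfolding I_measure_ival
  by (intro measurable_restrict_space1 measurable_completion) simp

lemma ival_Int_lessThan: "0 \<le> s \<Longrightarrow> ereal s \<le> \<alpha> \<Longrightarrow> {t \<in> ival \<alpha>. t < s} = {0..<s}"
  by (auto simp: ival_def intro: less_le_trans[of "ereal _" "ereal s"])

lemma ival_mono: "t \<in> ival \<alpha> \<Longrightarrow> 0 \<le> s \<Longrightarrow> s \<le> t \<Longrightarrow> s \<in> ival \<alpha>"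
  by (auto simp: ival_def intro: le_less_trans[of "ereal s" "ereal t"])

lemma downset_borel:
  fixes S :: "real set"
  assumes down: "\<And>s t. t \<in> S \<Longrightarrow> s \<le> t \<Longrightarrow> s \<in> S"
  shows "S \<in> sets borel"
proof (cases "S = {} \<or> \<not> bdd_above S")
  case True
  then have "S = {} \<or> S = UNIV"
    using down unfolding bdd_above_def by (auto, meson linear)
  then show ?thesis by auto
next
  case False
  then have ne: "S \<noteq> {}" and bdd: "bdd_above S" by auto
  have 1: "x \<in> S" if "x < Sup S" for x
    using that ne bdd down by (meson less_cSup_iff less_imp_le)
  have 2: "x \<le> Sup S" if "x \<in> S" for x
    using that bdd by (rule cSup_upper)
  have "S = {..<Sup S} \<or> S = {..Sup S}"
  proof (cases "Sup S \<in> S")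
    case True
    then have "S = {..Sup S}" using 2 down by auto
    then show ?thesis ..
  next
    case False
    then have "S = {..<Sup S}" using 1 2 by (auto simp: less_le)
    then show ?thesis ..
  qed
  then show ?thesis by (elim disjE ssubst) simp_all
qed

lemma borel_measurable_antimono:
  fixes f :: "real \<Rightarrow> ereal"
  assumes "antimono f"
  shows "f \<in> borel_measurable borel"
proof (rule borel_measurableI_greater)
  fix y
  have "{x. y < f x} \<in> sets borel"
    using assms by (intro downset_borel) (auto simp: antimono_def intro: less_le_trans)
  then show "{x \<in> space borel. y < f x} \<in> sets borel" by simp
qed

lemma distr_set_I:
  "x \<in> L0 \<alpha> \<Longrightarrow> {s \<in> ival \<alpha>. \<bar>x s\<bar> > c} \<in> sets (I_measure \<alpha>)"
proof -
  assume "x \<in> L0 \<alpha>"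
  then have [measurable]: "x \<in> borel_measurable (I_measure \<alpha>)" by (simp add: L0_def)
  have "{s \<in> space (I_measure \<alpha>). \<bar>x s\<bar> > c} \<in> sets (I_measure \<alpha>)" by measurable
  then show ?thesis by simp
qed

lemma distr_fun_lebesgue: "distr_fun \<alpha> x l = emeasure lebesgue {s \<in> ival \<alpha>. \<bar>x s\<bar> > ereal l}"
  unfolding distr_fun_def by (subst emeasure_I) auto

lemma distr_fun_antimono:
  assumes "x \<in> L0 \<alpha>" "l \<le> l'"
  shows "distr_fun \<alpha> x l' \<le> distr_fun \<alpha> x l"
  unfolding distr_fun_def
  using distr_set_I[OF assms(1)] assms(2)
  by (intro emeasure_mono) (auto intro: le_less_trans[of "ereal l" "ereal l'"])

lemma distr_fun_le_ival: "distr_fun \<alpha> x l \<le> emeasure lebesgue (ival \<alpha>)"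
  unfolding distr_fun_lebesgue by (intro emeasure_mono) auto

text \<open>The superlevel sets at l + 1/(n+1) increase to the one at l, so continuity from below
  applies. For a decreasing function this one-sided openness is right continuity.\<close>

lemma distr_fun_right_cont:
  assumes x: "x \<in> L0 \<alpha>" and c: "c < distr_fun \<alpha> x l"
  obtains l' where "l < l'" "c < distr_fun \<alpha> x l'"
proof -
  let ?A = "\<lambda>n. {s \<in> ival \<alpha>. \<bar>x s\<bar> > ereal (l + 1 / real (Suc n))}"
  have inc: "incseq ?A"
  proof (rule monoI, safe)
    fix m n :: nat and s assume "m \<le> n" "ereal (l + 1 / real (Suc m)) < \<bar>x s\<bar>"
    moreover have "1 / real (Suc n) \<le> 1 / real (Suc m)"
      using \<open>m \<le> n\<close> by (intro divide_left_mono) auto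
    ultimately show "ereal (l + 1 / real (Suc n)) < \<bar>x s\<bar>"
      by (metis add_left_mono ereal_less_eq(3) le_less_trans)
  qed
  have U: "(\<Union>n. ?A n) = {s \<in> ival \<alpha>. \<bar>x s\<bar> > ereal l}"
  proof safe
    fix s n assume "ereal (l + 1 / real (Suc n)) < \<bar>x s\<bar>"
    moreover have "ereal l \<le> ereal (l + 1 / real (Suc n))" by simp
    ultimately show "ereal l < \<bar>x s\<bar>" by (rule le_less_trans[rotated])
  next
    fix s assume s: "s \<in> ival \<alpha>" "ereal l < \<bar>x s\<bar>"
    then obtain m where m: "ereal l < ereal m" "ereal m < \<bar>x s\<bar>"
      using ereal_dense2 by blast
    obtain n where "1 / real (Suc n) < m - l"
      using m(1) by (metis diff_gt_0_iff_gt ereal_less_eq(3) less_ereal.simps(1) nat_approx_posE)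
    then have "ereal (l + 1 / real (Suc n)) \<le> ereal m" by simp
    then have "s \<in> ?A n" using s(1) le_less_trans[OF _ m(2)] by simp
    then show "s \<in> (\<Union>n. ?A n)" by blast
  qed
  have "(SUP n. emeasure (I_measure \<alpha>) (?A n)) = emeasure (I_measure \<alpha>) (\<Union>n. ?A n)"
    using distr_set_I[OF x] inc by (intro SUP_emeasure_incseq) auto
  with c have "c < (SUP n. emeasure (I_measure \<alpha>) (?A n))"
    unfolding U distr_fun_def by simp
  then obtain n where "c < emeasure (I_measure \<alpha>) (?A n)"
    by (auto simp: less_SUP_iff)
  then have "c < distr_fun \<alpha> x (l + 1 / real (Suc n))"
    unfolding distr_fun_def by simp
  then show thesis by (intro that[of "l + 1 / real (Suc n)"]) auto
qed

text \<open>Right continuity of the distribution function makes it and x* exact generalized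
  inverses, with strict inequalities on both sides. Most facts about x* below are read off from this
  equivalence.\<close>

lemma rearrangement_greater_iff:
  assumes x: "x \<in> L0 \<alpha>" and l: "0 \<le> l"
  shows "ereal l < rearrangement \<alpha> x t \<longleftrightarrow> ennreal t < distr_fun \<alpha> x l"
proof
  assume R: "ereal l < rearrangement \<alpha> x t"
  show "ennreal t < distr_fun \<alpha> x l"
  proof (rule ccontr)
    assume "\<not> ?thesis"
    then have le: "distr_fun \<alpha> x l \<le> ennreal t" by simp
    obtain m where m: "ereal l < ereal m" "ereal m < rearrangement \<alpha> x t"
      using R ereal_dense2 by blast
    have "distr_fun \<alpha> x m \<le> ennreal t"
      using distr_fun_antimono[OF x, of l m] le m(1) by simp
    then have "rearrangement \<alpha> x t \<le> ereal m"
      unfolding rearrangement_def using m(1) l by (intro Inf_lower) auto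
    with m(2) show False by simp
  qed
next
  assume "ennreal t < distr_fun \<alpha> x l"
  then obtain l' where l': "l < l'" "ennreal t < distr_fun \<alpha> x l'"
    using distr_fun_right_cont[OF x] by blast
  have "ereal l' \<le> rearrangement \<alpha> x t"
    unfolding rearrangement_def
  proof (rule Inf_greatest, safe)
    fix k assume k: "distr_fun \<alpha> x k \<le> ennreal t"
    show "ereal l' \<le> ereal k"
    proof (rule ccontr)
      assume "\<not> ?thesis"
      then have "distr_fun \<alpha> x l' \<le> distr_fun \<alpha> x k" by (intro distr_fun_antimono[OF x]) simp
      with k l'(2) show False by simp
    qed
  qed
  then show "ereal l < rearrangement \<alpha> x t" using l'(1) by (metis less_ereal.simps(1) less_le_trans)
qed

lemma rearrangement_nonneg [simp]: "0 \<le> rearrangement \<alpha> x t"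
  unfolding rearrangement_def by (rule Inf_greatest) auto

lemma antimono_rearrangement: "antimono (rearrangement \<alpha> x)"
  unfolding rearrangement_def
  by (intro antimonoI Inf_superset_mono) (blast intro: order_trans ennreal_leI)

lemma rearrangement_antimono: "s \<le> t \<Longrightarrow> rearrangement \<alpha> x t \<le> rearrangement \<alpha> x s"
  using antimono_rearrangement by (rule antimonoD)

lemma rearrangement_neg: "t \<le> 0 \<Longrightarrow> rearrangement \<alpha> x t = rearrangement \<alpha> x 0"
  unfolding rearrangement_def by (simp add: ennreal_neg)

lemma rearrangement_borel [measurable]: "rearrangement \<alpha> x \<in> borel_measurable borel"
  using antimono_rearrangement by (rule borel_measurable_antimono)

lemma ereal_eqI_greater:
  fixes a b :: ereal
  assumes "0 \<le> a" "0 \<le> b" "\<And>l. 0 \<le> l \<Longrightarrow> ereal l < a \<longleftrightarrow> ereal l < b"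
  shows "a = b"
proof -
  have "a \<le> b" if "0 \<le> a" "0 \<le> b" "\<And>l. 0 \<le> l \<Longrightarrow> ereal l < a \<longleftrightarrow> ereal l < b" for a b :: ereal
  proof (rule ccontr)
    assume "\<not> a \<le> b"
    then obtain m where m: "b < ereal m" "ereal m < a" using ereal_dense2 by (metis not_le)
    then have "0 \<le> m" using that(2) le_less_trans[of 0 b "ereal m"] by simp
    with that(3)[of m] m show False by simp
  qed
  from this[of a b] this[of b a] show ?thesis using assms by (simp add: antisym)
qed

lemma rearrangement_right_cont:
  assumes x: "x \<in> L0 \<alpha>" and t: "0 \<le> t" and l: "ereal l < rearrangement \<alpha> x t" "0 \<le> l"
  obtains s where "t < s" "ereal l < rearrangement \<alpha> x s"
proof -
  have "ennreal t < distr_fun \<alpha> x l"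
    using rearrangement_greater_iff[OF x l(2)] l(1) by simp
  then obtain c where c: "ennreal t < c" "c < distr_fun \<alpha> x l" using dense by blast
  then have "c \<noteq> top" by auto
  then obtain s where s: "0 \<le> s" "c = ennreal s" by (cases c) auto
  have "t < s" using c(1) s t by (simp add: ennreal_less_iff)
  moreover have "ereal l < rearrangement \<alpha> x s"
    using rearrangement_greater_iff[OF x l(2)] c(2) s by simp
  ultimately show thesis by (rule that)
qed

lemma rearrangement_outside:
  assumes x: "x \<in> L0 \<alpha>" and t: "0 \<le> t" "t \<notin> ival \<alpha>"
  shows "rearrangement \<alpha> x t = 0"
proof (rule ereal_eqI_greater)
  fix l :: real assume "0 \<le> l"
  have "ival \<alpha> \<subseteq> {0..<t}"
  proof
    fix s assume "s \<in> ival \<alpha>"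
    then show "s \<in> {0..<t}"
      using t ival_mono[of s \<alpha> t] by (cases "t \<le> s") (auto simp: ival_def)
  qed
  then have "emeasure lebesgue (ival \<alpha>) \<le> emeasure lebesgue {0..<t}"
    by (intro emeasure_mono) auto
  then have "distr_fun \<alpha> x l \<le> ennreal t"
    using distr_fun_le_ival[of \<alpha> x l] t(1) by (simp add: order_trans)
  then show "ereal l < rearrangement \<alpha> x t \<longleftrightarrow> ereal l < 0"
    using rearrangement_greater_iff[OF x \<open>0 \<le> l\<close>, of t] \<open>0 \<le> l\<close> by auto
qed auto

text \<open>Meant for c = d_x(l), where the set is the superlevel set of x* at l. If c is finite and
  some s < c lay outside I, then I would be contained in [0, s) and have measure less than
  c.\<close>

lemma emeasure_below:
  assumes "c \<le> emeasure lebesgue (ival \<alpha>)"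
  shows "emeasure lebesgue {t \<in> ival \<alpha>. ennreal t < c} = c"
proof (cases c)
  case (real r)
  have "{t \<in> ival \<alpha>. ennreal t < c} = {0..<r}"
  proof (cases "\<exists>s\<ge>0. s < r \<and> s \<notin> ival \<alpha>")
    case True
    then obtain s where s: "0 \<le> s" "s < r" "s \<notin> ival \<alpha>" by auto
    have "ival \<alpha> \<subseteq> {0..<s}"
    proof
      fix u assume "u \<in> ival \<alpha>"
      then show "u \<in> {0..<s}"
        using s ival_mono[of u \<alpha> s] by (cases "s \<le> u") (auto simp: ival_def)
    qed
    then have "emeasure lebesgue (ival \<alpha>) \<le> emeasure lebesgue {0..<s}"
      by (intro emeasure_mono) auto
    with assms real s have "ennreal r \<le> ennreal s" by (simp add: order_trans)
    with s real have False by simp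
    then show ?thesis ..
  next
    case False
    have "t \<in> {t \<in> ival \<alpha>. ennreal t < c} \<longleftrightarrow> t \<in> {0..<r}" for t
    proof (cases "0 \<le> t")
      case True
      then show ?thesis using False real by (auto simp: ennreal_less_iff)
    qed (auto simp: ival_def)
    then show ?thesis by blast
  qed
  then show ?thesis using real by simp
next
  case top
  then show ?thesis using assms by (simp add: top_unique)
qed

lemma distr_fun_rearrangement:
  assumes x: "x \<in> L0 \<alpha>"
  shows "distr_fun \<alpha> (rearrangement \<alpha> x) = distr_fun \<alpha> x"
proof
  fix l
  show "distr_fun \<alpha> (rearrangement \<alpha> x) l = distr_fun \<alpha> x l"
  proof (cases "0 \<le> l")
    case True
    have "{s \<in> ival \<alpha>. \<bar>rearrangement \<alpha> x s\<bar> > ereal l} = {s \<in> ival \<alpha>. ennreal s < distr_fun \<alpha> x l}"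
      using rearrangement_greater_iff[OF x True] by (auto simp: abs_ereal_ge0)
    then show ?thesis
      using emeasure_below[OF distr_fun_le_ival[of \<alpha> x l]]
      by (subst distr_fun_lebesgue) (elim ssubst, rule refl)
  next
    \<comment> \<open>At a negative level both superlevel sets are the whole of I.\<close>
    case False
    have "ereal l < \<bar>y\<bar>" for y :: ereal
      using False less_le_trans[of "ereal l" 0 "\<bar>y\<bar>"] by simp
    then show ?thesis by (simp only: distr_fun_lebesgue)
  qed
qed

lemma rearrangement_L0: "rearrangement \<alpha> x \<in> L0 \<alpha>"
  unfolding L0_def by (intro measurable_I_borel) measurable

text \<open>Rearrangements are right continuous and vanish beyond I, so \<open>rc\<close> and
  \<open>out\<close> are what pointwise equality demands of a decreasing function. The purpose is to
  identify the rearrangement of a flattened function.\<close>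

lemma rearrangement_of_decreasing:
  assumes g: "g \<in> L0 \<alpha>" "\<And>s t. 0 \<le> s \<Longrightarrow> s \<le> t \<Longrightarrow> g t \<le> g s" "\<And>t. 0 \<le> t \<Longrightarrow> 0 \<le> g t"
    and rc: "\<And>t l. 0 \<le> t \<Longrightarrow> 0 \<le> l \<Longrightarrow> ereal l < g t \<Longrightarrow> \<exists>s>t. ereal l < g s"
    and out: "\<And>t. 0 \<le> t \<Longrightarrow> t \<notin> ival \<alpha> \<Longrightarrow> g t = 0"
    and t: "0 \<le> t"
  shows "rearrangement \<alpha> g t = g t"
proof (rule ereal_eqI_greater)
  fix l :: real assume l: "0 \<le> l"
  have absg: "\<bar>g s\<bar> = g s" if "s \<in> ival \<alpha>" for s
    using g(3)[of s] that by (simp add: ival_def abs_ereal_ge0)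
  have set: "{s \<in> ival \<alpha>. \<bar>g s\<bar> > ereal l} \<in> sets lebesgue"
    using distr_set_I[OF g(1)] sets_I_iff by blast
  have "ennreal t < distr_fun \<alpha> g l \<longleftrightarrow> ereal l < g t"
  proof
    assume less: "ereal l < g t"
    obtain s where s: "t < s" "ereal l < g s" using rc[OF t l less] by auto
    have "{0..<s} \<subseteq> {s \<in> ival \<alpha>. \<bar>g s\<bar> > ereal l}"
    proof safe
      fix u assume "u \<in> {0..<s}"
      then have u: "0 \<le> u" "u < s" by auto
      have "s \<in> ival \<alpha>" using out[of s] s l t by (cases "s \<in> ival \<alpha>") auto
      then show d: "u \<in> ival \<alpha>" using ival_mono u by auto
      show "ereal l < \<bar>g u\<bar>" using g(2)[of u s] u s d by (simp add: absg less_le_trans)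
    qed
    then have "emeasure lebesgue {0..<s} \<le> distr_fun \<alpha> g l"
      unfolding distr_fun_lebesgue using set by (intro emeasure_mono) auto
    then show "ennreal t < distr_fun \<alpha> g l"
      using s t less_le_trans[of "ennreal t" "ennreal s"] by (simp add: ennreal_lessI)
  next
    assume less: "ennreal t < distr_fun \<alpha> g l"
    show "ereal l < g t"
    proof (rule ccontr)
      assume n: "\<not> ?thesis"
      have "{s \<in> ival \<alpha>. \<bar>g s\<bar> > ereal l} \<subseteq> {0..<t}"
      proof safe
        fix u assume u: "u \<in> ival \<alpha>" "ereal l < \<bar>g u\<bar>"
        then have "\<not> g u \<le> g t" using n absg[of u] order_trans[of "g u" "g t" "ereal l"] by (simp add: not_less leD)
        then have "u < t" using g(2)[OF t, of u] by (cases "t \<le> u") auto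
        then show "u \<in> {0..<t}" using u by (simp add: ival_def)
      qed
      then have "distr_fun \<alpha> g l \<le> emeasure lebesgue {0..<t}"
        unfolding distr_fun_lebesgue by (intro emeasure_mono) auto
      with less t show False by simp
    qed
  qed
  then show "ereal l < rearrangement \<alpha> g t \<longleftrightarrow> ereal l < g t"
    using rearrangement_greater_iff[OF g(1) l] by simp
qed (use g(3) t in auto)

section \<open>Measure preserving maps\<close>

text \<open>The domain D may be smaller than I: in Ryff's construction, points preceded by infinite
  measure receive no value. Only preimages of [0, r) are measured here; they determine those of all
  Borel sets.\<close>

definition mp_map :: "ereal \<Rightarrow> real set \<Rightarrow> (real \<Rightarrow> real) \<Rightarrow> bool" where
  "mp_map \<alpha> D \<sigma> \<longleftrightarrow> D \<in> sets (I_measure \<alpha>) \<and> \<sigma> \<in> borel_measurable (I_measure \<alpha>) \<and>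
     (\<forall>t\<in>D. 0 \<le> \<sigma> t) \<and>
     (\<forall>r\<ge>0. ereal r \<le> \<alpha> \<longrightarrow> emeasure lebesgue {t \<in> D. \<sigma> t < r} = ennreal r)"

lemma mp_map_emeasure_lessThan:
  assumes \<alpha>: "\<alpha> = 1 \<or> \<alpha> = \<infinity>" and mp: "mp_map \<alpha> D \<sigma>"
  shows "emeasure lebesgue {t \<in> D. \<sigma> t < r} = emeasure lborel ({..<r} \<inter> ival \<alpha>)"
proof -
  have D: "D \<subseteq> ival \<alpha>" and Ds: "D \<in> sets (I_measure \<alpha>)"
    and \<sigma>[measurable]: "\<sigma> \<in> borel_measurable (I_measure \<alpha>)" and nn: "\<And>t. t \<in> D \<Longrightarrow> 0 \<le> \<sigma> t"
    and r: "\<And>r. 0 \<le> r \<Longrightarrow> ereal r \<le> \<alpha> \<Longrightarrow> emeasure lebesgue {t \<in> D. \<sigma> t < r} = ennreal r"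
    using mp by (auto simp: mp_map_def sets_I_iff)
  have set: "{t \<in> D. \<sigma> t < r} \<in> sets lebesgue" for r
  proof -
    have "{t \<in> space (I_measure \<alpha>). t \<in> D \<and> \<sigma> t < r} \<in> sets (I_measure \<alpha>)"
      using Ds by measurable
    moreover have "{t \<in> space (I_measure \<alpha>). t \<in> D \<and> \<sigma> t < r} = {t \<in> D. \<sigma> t < r}"
      using D by auto
    ultimately show ?thesis by (simp add: sets_I_iff)
  qed
  consider "r < 0" | "0 \<le> r" "ereal r \<le> \<alpha>" | "\<alpha> = 1" "1 < r"
    using \<alpha> by (cases "0 \<le> r"; cases "r \<le> 1") (auto simp: one_ereal_def)
  then show ?thesis
  proof cases
    case 1
    then have "{t \<in> D. \<sigma> t < r} = {}" "{..<r} \<inter> ival \<alpha> = {}"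
      using nn by (fastforce, auto simp: ival_def)
    then show ?thesis by (simp only: emeasure_empty)
  next
    case 2
    have "{..<r} \<inter> ival \<alpha> = {0..<r}" using ival_Int_lessThan[OF 2] by auto
    then show ?thesis using r[OF 2] 2 by simp
  next
    \<comment> \<open>Past the right end of I the preimage is squeezed between the preimage of [0,
      1) and I, both of measure 1.\<close>
    case 3
    have I: "{..<r} \<inter> ival \<alpha> = {0..<1}" "ival \<alpha> = {0..<1}" using 3 by (auto simp: ival_def one_ereal_def)
    have "emeasure lebesgue {t \<in> D. \<sigma> t < r} \<le> emeasure lebesgue {0..<1::real}"
      using D I by (intro emeasure_mono) auto
    moreover have "emeasure lebesgue {t \<in> D. \<sigma> t < 1} \<le> emeasure lebesgue {t \<in> D. \<sigma> t < r}"
      using set[of r] 3 by (intro emeasure_mono) auto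
    moreover have "emeasure lebesgue {t \<in> D. \<sigma> t < 1} = ennreal 1"
      using 3 by (intro r) (auto simp: one_ereal_def)
    moreover have "emeasure lebesgue {0..<1::real} = ennreal 1" by simp
    ultimately have "emeasure lebesgue {t \<in> D. \<sigma> t < r} = ennreal 1" by (simp only: antisym)
    then show ?thesis using I by simp
  qed
qed

text \<open>Half-lines are an intersection-stable generator of the Borel sets, so the image of
  Lebesgue measure on D under \<sigma> is determined by its values on them.\<close>

lemma mp_map_emeasure:
  assumes \<alpha>: "\<alpha> = 1 \<or> \<alpha> = \<infinity>" and mp: "mp_map \<alpha> D \<sigma>" and B: "B \<in> sets borel"
  shows "emeasure lebesgue {t \<in> D. \<sigma> t \<in> B} = emeasure lborel (B \<inter> ival \<alpha>)"
proof -
  define N where "N = distr (restrict_space (I_measure \<alpha>) D) borel \<sigma>"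
  define M where "M = distr (restrict_space lborel (ival \<alpha>)) borel (\<lambda>x. x)"
  have D: "D \<subseteq> ival \<alpha>" and Ds: "D \<in> sets (I_measure \<alpha>)"
    and \<sigma>: "\<sigma> \<in> borel_measurable (I_measure \<alpha>)"
    using mp by (auto simp: mp_map_def sets_I_iff)
  have sp: "space (restrict_space (I_measure \<alpha>) D) = D"
    using Ds by simp
  have N: "emeasure N B = emeasure lebesgue {t \<in> D. \<sigma> t \<in> B}" if "B \<in> sets borel" for B
  proof -
    have \<sigma>D: "\<sigma> \<in> borel_measurable (restrict_space (I_measure \<alpha>) D)"
      using \<sigma> by (rule measurable_restrict_space1)
    have "emeasure N B = emeasure (restrict_space (I_measure \<alpha>) D) (\<sigma> -` B \<inter> D)"
      unfolding N_def using emeasure_distr[OF \<sigma>D, of B] that by (simp add: sp)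
    also have "\<dots> = emeasure (I_measure \<alpha>) (\<sigma> -` B \<inter> D)"
      using Ds D by (intro emeasure_restrict_space) (auto simp: Int_absorb2)
    also have "\<dots> = emeasure lebesgue (\<sigma> -` B \<inter> D)" using D by (intro emeasure_I) auto
    also have "\<sigma> -` B \<inter> D = {t \<in> D. \<sigma> t \<in> B}" by auto
    finally show ?thesis .
  qed
  have M: "emeasure M B = emeasure lborel (B \<inter> ival \<alpha>)" if "B \<in> sets borel" for B
  proof -
    have id: "(\<lambda>x. x) \<in> borel_measurable (restrict_space lborel (ival \<alpha>))"
      by (intro measurable_restrict_space1) simp
    have "emeasure M B = emeasure (restrict_space lborel (ival \<alpha>)) (B \<inter> ival \<alpha>)"
      unfolding M_def using emeasure_distr[OF id, of B] that by (simp add: vimage_def space_restrict_space)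
    also have "\<dots> = emeasure lborel (B \<inter> ival \<alpha>)"
      by (intro emeasure_restrict_space) auto
    finally show ?thesis .
  qed
  have "M = N"
  proof (rule measure_eqI_generator_eq[where E = "range lessThan" and A = "\<lambda>n::nat. {..<real n}" and \<Omega> = UNIV])
    have "{..<a} \<inter> {..<b} = {..<min a b}" for a b :: real by auto
    then show "Int_stable (range lessThan :: real set set)"
      by (auto simp: Int_stable_def)
    have "sets (borel :: real measure) = sigma_sets UNIV (range lessThan)"
      by (subst borel_Iio) (simp add: sets_measure_of)
    then show "sets M = sigma_sets UNIV (range lessThan)" "sets N = sigma_sets UNIV (range lessThan)"
      by (simp_all add: M_def N_def)
    show "emeasure M X = emeasure N X" if "X \<in> range lessThan" for X
    proof -
      from that obtain r where "X = {..<r}" by auto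
      then show ?thesis
        using mp_map_emeasure_lessThan[OF \<alpha> mp, of r] by (simp add: M N)
    qed
    show "(\<Union>i. {..<real i}) = UNIV" by (auto intro: reals_Archimedean2)
    fix i
    have "emeasure lborel ({..<real i} \<inter> ival \<alpha>) \<le> emeasure lborel {0..<real i}"
      by (intro emeasure_mono) (auto simp: ival_def)
    then show "emeasure M {..<real i} \<noteq> \<infinity>" by (auto simp: M top_unique)
  qed auto
  then show ?thesis using N[OF B] M[OF B] by simp
qed

section \<open>Composition with a measure preserving map\<close>

definition pull :: "real set \<Rightarrow> (real \<Rightarrow> real) \<Rightarrow> (real \<Rightarrow> real) \<Rightarrow> real \<Rightarrow> real" where
  "pull D \<sigma> f t = (if t \<in> D then f (\<sigma> t) else 0)"

lemma pull_measurable: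
  assumes mp: "mp_map \<alpha> D \<sigma>" and [measurable]: "f \<in> borel_measurable borel"
  shows "pull D \<sigma> f \<in> borel_measurable (I_measure \<alpha>)"
proof -
  have [measurable]: "D \<in> sets (I_measure \<alpha>)" "\<sigma> \<in> borel_measurable (I_measure \<alpha>)"
    using mp by (auto simp: mp_map_def)
  show ?thesis unfolding pull_def by measurable
qed

lemma pull_L0:
  assumes "mp_map \<alpha> D \<sigma>" "f \<in> borel_measurable borel"
  shows "(\<lambda>t. ereal (pull D \<sigma> f t)) \<in> L0 \<alpha>"
  using pull_measurable[OF assms] unfolding L0_def by simp

text \<open>At levels l >= 0 the strict inequality excludes the points outside D, where
  \<open>pull\<close> is zero, and only a preimage under \<sigma> remains.\<close>

lemma distr_pull_pos:
  assumes \<alpha>: "\<alpha> = 1 \<or> \<alpha> = \<infinity>" and mp: "mp_map \<alpha> D \<sigma>" and [measurable]: "f \<in> borel_measurable borel"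
    and l: "0 \<le> l"
  shows "emeasure lebesgue {t \<in> ival \<alpha>. l < \<bar>pull D \<sigma> f t\<bar>} = emeasure lebesgue {t \<in> ival \<alpha>. l < \<bar>f t\<bar>}"
proof -
  have "{t \<in> ival \<alpha>. l < \<bar>pull D \<sigma> f t\<bar>} = {t \<in> D. \<sigma> t \<in> {t. l < \<bar>f t\<bar>}}"
    using l mp by (auto simp: pull_def mp_map_def sets_I_iff split: if_splits)
  moreover have "{t. l < \<bar>f t\<bar>} \<in> sets borel" by measurable
  moreover have "{t. l < \<bar>f t\<bar>} \<inter> ival \<alpha> = {t \<in> ival \<alpha>. l < \<bar>f t\<bar>}" by auto
  ultimately show ?thesis using mp_map_emeasure[OF \<alpha> mp, of "{t. l < \<bar>f t\<bar>}"] by simp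
qed

lemma distr_pull:
  assumes \<alpha>: "\<alpha> = 1 \<or> \<alpha> = \<infinity>" and mp: "mp_map \<alpha> D \<sigma>" and f: "f \<in> borel_measurable borel"
  shows "distr_fun \<alpha> (\<lambda>t. ereal (pull D \<sigma> f t)) = distr_fun \<alpha> (\<lambda>t. ereal (f t))"
proof
  fix l
  show "distr_fun \<alpha> (\<lambda>t. ereal (pull D \<sigma> f t)) l = distr_fun \<alpha> (\<lambda>t. ereal (f t)) l"
  proof (cases "0 \<le> l")
    case True
    then show ?thesis using distr_pull_pos[OF \<alpha> mp f True] by (simp add: distr_fun_lebesgue)
  next
    case False
    then have "l < \<bar>y\<bar>" for y :: real by linarith
    then show ?thesis by (simp add: distr_fun_lebesgue)
  qed
qed

section \<open>Cyclic rotations of an interval\<close>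

definition rot :: "real \<Rightarrow> real \<Rightarrow> real \<Rightarrow> real \<Rightarrow> real" where
  "rot a b s t = (if t < a \<or> b \<le> t then t else if t + s < b then t + s else t + s - (b - a))"

text \<open>For a < r <= b the preimage of [0, r) is an initial interval together with a piece that
  starts at b - s, where points wrap around to a. The two cases differ in whether r has reached a +
  s.\<close>

lemma mp_map_rot:
  assumes ab: "0 \<le> a" "a \<le> b" "ereal b \<le> \<alpha>" and s: "0 \<le> s" "s \<le> b - a"
  shows "mp_map \<alpha> (ival \<alpha>) (rot a b s)"
  unfolding mp_map_def
proof (intro conjI allI impI ballI)
  show "ival \<alpha> \<in> sets (I_measure \<alpha>)" by (simp add: sets_I_iff)
  show "rot a b s \<in> borel_measurable (I_measure \<alpha>)"
    unfolding rot_def by (intro measurable_I_borel) measurable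
  show "0 \<le> rot a b s t" if "t \<in> ival \<alpha>" for t
    using that ab s by (auto simp: rot_def ival_def)
  fix r assume r: "0 \<le> r" "ereal r \<le> \<alpha>"
  have sub: "{0..<b} \<subseteq> ival \<alpha>" "{0..<r} \<subseteq> ival \<alpha>"
    using ival_Int_lessThan[of b \<alpha>] ival_Int_lessThan[of r \<alpha>] ab r by auto
  consider "r \<le> a" | "a < r" "r < a + s" "r \<le> b" | "a < r" "a + s \<le> r" "r \<le> b" | "b < r" by linarith
  then show "emeasure lebesgue {t \<in> ival \<alpha>. rot a b s t < r} = ennreal r"
  proof cases
    case 1
    then have "{t \<in> ival \<alpha>. rot a b s t < r} = {0..<r}"
      using ab s sub by (auto simp: rot_def ival_def split: if_splits)
    then show ?thesis using r by simp
  next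
    case 2
    have "{t \<in> ival \<alpha>. rot a b s t < r} = {0..<a} \<union> {b - s..<r + (b - a) - s}"
    proof (rule set_eqI)
      fix t show "t \<in> {t \<in> ival \<alpha>. rot a b s t < r} \<longleftrightarrow> t \<in> {0..<a} \<union> {b - s..<r + (b - a) - s}"
        using 2 ab s subsetD[OF sub(1), of t] by (auto simp: rot_def ival_def split: if_splits)
    qed
    moreover have "emeasure lebesgue ({0..<a} \<union> {b - s..<r + (b - a) - s}) =
        emeasure lebesgue {0..<a} + emeasure lebesgue {b - s..<r + (b - a) - s}"
      using 2 s by (intro plus_emeasure[symmetric]) auto
    ultimately show ?thesis using 2 ab by (simp flip: ennreal_plus)
  next
    case 3
    have "{t \<in> ival \<alpha>. rot a b s t < r} = {0..<r - s} \<union> {b - s..<b}"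
    proof (rule set_eqI)
      fix t show "t \<in> {t \<in> ival \<alpha>. rot a b s t < r} \<longleftrightarrow> t \<in> {0..<r - s} \<union> {b - s..<b}"
        using 3 ab s subsetD[OF sub(1), of t] by (auto simp: rot_def ival_def split: if_splits)
    qed
    moreover have "emeasure lebesgue ({0..<r - s} \<union> {b - s..<b}) =
        emeasure lebesgue {0..<r - s} + emeasure lebesgue {b - s..<b}"
      using 3 s by (intro plus_emeasure[symmetric]) auto
    ultimately show ?thesis using 3 s ab by (simp flip: ennreal_plus)
  next
    case 4
    have "{t \<in> ival \<alpha>. rot a b s t < r} = {0..<r}"
    proof (rule set_eqI)
      fix t show "t \<in> {t \<in> ival \<alpha>. rot a b s t < r} \<longleftrightarrow> t \<in> {0..<r}"
        using 4 ab s subsetD[OF sub(2), of t] by (auto simp: rot_def ival_def split: if_splits)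
    qed
    then show ?thesis using r by simp
  qed
qed

text \<open>The measure of L below t is a 1-Lipschitz function of t, so it takes the value q at some
  u, and the part of L below u serves. If q is never reached, L itself has measure q. This cuts a
  level set of positive measure from left to right in \<open>ryff_map\<close>.\<close>

lemma initial_part:
  fixes L :: "real set"
  assumes L: "L \<in> sets lebesgue" "L \<subseteq> {0..}" and q: "0 \<le> q" "ennreal q \<le> emeasure lebesgue L"
  obtains P where "P \<subseteq> L" "P \<in> sets lebesgue" "emeasure lebesgue P = ennreal q"
    "\<And>t. t \<in> P \<Longrightarrow> emeasure lebesgue (L \<inter> {..<t}) \<le> ennreal q"
    "\<And>t. t \<in> L - P \<Longrightarrow> ennreal q \<le> emeasure lebesgue (L \<inter> {..<t})"
proof (cases "\<exists>t0. ennreal q \<le> emeasure lebesgue (L \<inter> {..<t0})")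
  case True
  then obtain t0 where t0: "ennreal q \<le> emeasure lebesgue (L \<inter> {..<t0})" by auto
  define \<phi> where "\<phi> t = measure lebesgue (L \<inter> {..<t})" for t
  have set: "L \<inter> {..<t} \<in> sets lebesgue" for t using L by auto
  have fin: "emeasure lebesgue (L \<inter> {..<t}) < top" for t
  proof -
    have "emeasure lebesgue (L \<inter> {..<t}) \<le> emeasure lebesgue {0..<t}"
      using L by (intro emeasure_mono) auto
    also have "\<dots> < top" by (cases "0 \<le> t") auto
    finally show ?thesis .
  qed
  have eq: "emeasure lebesgue (L \<inter> {..<t}) = ennreal (\<phi> t)" for t
    unfolding \<phi>_def using fin[of t] by (intro emeasure_eq_ennreal_measure) auto
  have nn: "0 \<le> \<phi> t" for t by (simp add: \<phi>_def)
  have mono: "\<phi> s \<le> \<phi> t \<and> \<phi> t \<le> \<phi> s + (t - s)" if st: "s \<le> t" for s t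
  proof
    have "ennreal (\<phi> s) \<le> ennreal (\<phi> t)"
      unfolding eq[symmetric] using set st by (intro emeasure_mono) auto
    then show "\<phi> s \<le> \<phi> t" using nn by simp
    have "L \<inter> {..<t} \<subseteq> (L \<inter> {..<s}) \<union> {s..<t}" by auto
    then have "emeasure lebesgue (L \<inter> {..<t}) \<le> emeasure lebesgue ((L \<inter> {..<s}) \<union> {s..<t})"
      using set by (intro emeasure_mono) auto
    also have "\<dots> \<le> emeasure lebesgue (L \<inter> {..<s}) + emeasure lebesgue {s..<t}"
      using set by (intro emeasure_subadditive) auto
    finally have "ennreal (\<phi> t) \<le> ennreal (\<phi> s + (t - s))"
      unfolding eq using st nn by simp
    then show "\<phi> t \<le> \<phi> s + (t - s)" using nn[of s] st by (subst (asm) ennreal_le_iff) auto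
  qed
  have "1-lipschitz_on UNIV \<phi>"
  proof (rule lipschitz_onI)
    fix s t show "dist (\<phi> s) (\<phi> t) \<le> 1 * dist s t"
      using mono[of s t] mono[of t s] by (cases "s \<le> t") (auto simp: dist_real_def)
  qed simp
  then have cont: "continuous_on {0..t} \<phi>" for t
    using lipschitz_on_continuous_on continuous_on_subset by blast
  have "L \<inter> {..<0} = {}" using L by auto
  then have \<phi>0: "\<phi> 0 = 0" by (simp only: \<phi>_def measure_empty)
  have qt: "q \<le> \<phi> t0" using t0 nn by (simp add: eq)
  have "0 \<le> max 0 t0" "q \<le> \<phi> (max 0 t0)"
    using qt mono[of t0 "max 0 t0"] by auto
  then obtain u where u: "\<phi> u = q"
    using IVT'[of \<phi> 0 q "max 0 t0"] cont \<phi>0 q by auto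
  show thesis
  proof (rule that[of "L \<inter> {..<u}"])
    show "emeasure lebesgue (L \<inter> {..<u}) = ennreal q" by (simp only: eq u)
    show "emeasure lebesgue (L \<inter> {..<t}) \<le> ennreal q" if "t \<in> L \<inter> {..<u}" for t
      unfolding eq using mono[of t u] that u by (simp add: ennreal_leI)
    show "ennreal q \<le> emeasure lebesgue (L \<inter> {..<t})" if "t \<in> L - L \<inter> {..<u}" for t
      unfolding eq using mono[of u t] that u by (auto simp: ennreal_leI)
  qed (use set in auto)
next
  case False
  have lt: "emeasure lebesgue (L \<inter> {..<t}) \<le> ennreal q" for t
    using False by (meson linear)
  have "(SUP n. emeasure lebesgue (L \<inter> {..<real n})) = emeasure lebesgue (\<Union>n. L \<inter> {..<real n})"
    using L by (intro SUP_emeasure_incseq) (auto simp: incseq_def intro: less_le_trans)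
  also have "(\<Union>n. L \<inter> {..<real n}) = L" by (auto intro: reals_Archimedean2)
  finally have "emeasure lebesgue L \<le> ennreal q"
    using SUP_least[of UNIV "\<lambda>n. emeasure lebesgue (L \<inter> {..<real n})" "ennreal q"] lt by (metis)
  with q have "emeasure lebesgue L = ennreal q" by simp
  then show thesis using lt L by (intro that[of L]) auto
qed

lemma sigma_finite_I: "sigma_finite_measure (I_measure \<alpha>)"
proof
  have "emeasure (I_measure \<alpha>) (ival \<alpha> \<inter> {..<real n}) \<noteq> \<infinity>" for n
  proof -
    have "emeasure (I_measure \<alpha>) (ival \<alpha> \<inter> {..<real n}) = emeasure lebesgue (ival \<alpha> \<inter> {..<real n})"
      by (intro emeasure_I) auto
    also have "\<dots> \<le> emeasure lebesgue {0..<real n}"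
      by (intro emeasure_mono) (auto simp: ival_def)
    also have "\<dots> < top" by simp
    finally show ?thesis by simp
  qed
  moreover have "(\<Union>n. ival \<alpha> \<inter> {..<real n}) = ival \<alpha>" by (auto intro: reals_Archimedean2)
  ultimately show "\<exists>A. countable A \<and> A \<subseteq> sets (I_measure \<alpha>) \<and> \<Union> A = space (I_measure \<alpha>) \<and>
      (\<forall>a\<in>A. emeasure (I_measure \<alpha>) a \<noteq> \<infinity>)"
    by (intro exI[of _ "range (\<lambda>n. ival \<alpha> \<inter> {..<real n})"]) (auto simp: sets_I_iff)
qed

text \<open>Ordering the points of the interval first by decreasing value of \<open>v\<close> and then from left to
  right, \<open>\<sigma> t\<close> is the measure of the set of predecessors of \<open>t\<close>; this is Ryff's map.\<close>

lemma ryff_map: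
  fixes v :: "real \<Rightarrow> real"
  assumes \<alpha>: "\<alpha> = 1 \<or> \<alpha> = \<infinity>" and v[measurable]: "v \<in> borel_measurable (I_measure \<alpha>)"
    and nn: "\<And>t. 0 \<le> v t"
    and fin: "\<And>l. 0 < l \<Longrightarrow> emeasure lebesgue {s \<in> ival \<alpha>. l < v s} < \<infinity>"
  obtains D \<sigma> where "mp_map \<alpha> D \<sigma>" "\<And>t. t \<in> ival \<alpha> - D \<Longrightarrow> v t = 0"
    "\<And>t. t \<in> D \<Longrightarrow> emeasure lebesgue {s \<in> ival \<alpha>. v t < v s} \<le> ennreal (\<sigma> t)"
proof -
  let ?I = "I_measure \<alpha>"
  define d where "d l = emeasure lebesgue {s \<in> ival \<alpha>. l < v s}" for l
  define pred where "pred t = {s \<in> ival \<alpha>. v t < v s \<or> (v s = v t \<and> s < t)}" for t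
  define m where "m t = emeasure lebesgue (pred t)" for t
  interpret sigma_finite_measure ?I
    by (rule sigma_finite_I)
  have id[measurable]: "(\<lambda>t. t) \<in> borel_measurable ?I" by (intro measurable_I_borel) simp
  have m: "m \<in> borel_measurable ?I"
  proof -
    \<comment> \<open>\<open>m t\<close> is the measure of the section of Q at t, hence measurable
      in t because the measure is sigma-finite.\<close>
    define Q where "Q = {p \<in> space (?I \<Otimes>\<^sub>M ?I). v (fst p) < v (snd p) \<or> (v (snd p) = v (fst p) \<and> (\<lambda>t. t) (snd p) < (\<lambda>t. t) (fst p))}"
    have [measurable]: "(\<lambda>p. fst p) \<in> borel_measurable (?I \<Otimes>\<^sub>M ?I)" "(\<lambda>p. snd p) \<in> borel_measurable (?I \<Otimes>\<^sub>M ?I)"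
      using measurable_compose[OF measurable_fst id] measurable_compose[OF measurable_snd id] by auto
    have "Q \<in> sets (?I \<Otimes>\<^sub>M ?I)" unfolding Q_def by measurable
    then have "(\<lambda>t. emeasure ?I (Pair t -` Q)) \<in> borel_measurable ?I"
      by (rule measurable_emeasure_Pair)
    moreover have "emeasure ?I (Pair t -` Q) = m t" if "t \<in> space ?I" for t
    proof -
      have "Pair t -` Q = pred t" using that by (auto simp: Q_def pred_def space_pair_measure)
      then show ?thesis unfolding m_def by (simp add: emeasure_I pred_def)
    qed
    ultimately show ?thesis
      using measurable_cong[of ?I "\<lambda>t. emeasure ?I (Pair t -` Q)" m] by blast
  qed
  have setI: "{s \<in> ival \<alpha>. Q s} \<in> sets lebesgue" if "Measurable.pred ?I Q" for Q
  proof -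
    have "{s \<in> space ?I. Q s} \<in> sets ?I" using that by measurable
    then show ?thesis by (simp add: sets_I_iff)
  qed
  have pred_set: "pred t \<in> sets lebesgue" for t
    unfolding pred_def by (rule setI) measurable
  have gr_set: "{s \<in> ival \<alpha>. l < v s} \<in> sets lebesgue" "{s \<in> ival \<alpha>. l \<le> v s} \<in> sets lebesgue"
    "{s \<in> ival \<alpha>. v s = l} \<in> sets lebesgue" for l
    by (rule setI; measurable)+
  have d_distr: "d l = distr_fun \<alpha> (\<lambda>t. ereal (v t)) l" for l
    unfolding d_def distr_fun_lebesgue using nn by simp
  have L0: "(\<lambda>t. ereal (v t)) \<in> L0 \<alpha>" unfolding L0_def by measurable
  \<comment> \<open>The measure of {m < r} is first only bracketed, with {m <= r} in the lower
    bound. Equality then follows by applying this at numbers s < r close to r.\<close>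
  have key: "emeasure lebesgue {t \<in> ival \<alpha>. m t < ennreal r} \<le> ennreal r \<and>
      ennreal r \<le> emeasure lebesgue {t \<in> ival \<alpha>. m t \<le> ennreal r}" if r: "0 < r" "ereal r \<le> \<alpha>" for r
  proof -
    define S where "S = {l. 0 \<le> l \<and> d l \<le> ennreal r}"
    have "\<exists>n. d (real (Suc n)) \<le> ennreal r"
    proof -
      have "(\<lambda>n. emeasure lebesgue {s \<in> ival \<alpha>. real (Suc n) < v s}) \<longlonglongrightarrow>
          emeasure lebesgue (\<Inter>n. {s \<in> ival \<alpha>. real (Suc n) < v s})"
      proof (rule Lim_emeasure_decseq)
        show "decseq (\<lambda>n. {s \<in> ival \<alpha>. real (Suc n) < v s})"
          by (auto simp: decseq_def intro: le_less_trans)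
        show "emeasure lebesgue {s \<in> ival \<alpha>. real (Suc n) < v s} \<noteq> \<infinity>" for n
          using fin[of "real (Suc n)"] by (simp add: less_top)
      qed (use gr_set in auto)
      moreover have "(\<Inter>n. {s \<in> ival \<alpha>. real (Suc n) < v s}) = {}"
      proof -
        have "\<exists>n. \<not> real (Suc n) < v s" for s
          using reals_Archimedean2[of "v s"] by (metis lessI less_trans not_less_iff_gr_or_eq of_nat_less_iff)
        then show ?thesis by blast
      qed
      ultimately have "(\<lambda>n. d (real (Suc n))) \<longlonglongrightarrow> 0" by (simp add: d_def)
      then have "eventually (\<lambda>n. d (real (Suc n)) < ennreal r) sequentially"
        using r by (intro order_tendstoD) auto
      then show ?thesis by (meson eventually_happens less_imp_le sequentially_bot)
    qed
    then obtain n where "real (Suc n) \<in> S" unfolding S_def using of_nat_0_le_iff by blast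
    then have S: "S \<noteq> {}" "bdd_below S" by (blast, auto simp: S_def bdd_below_def)
    \<comment> \<open>l is the rearrangement of v at r: the set {v > l} has measure at most r, and
      {v >= l} has measure at least r.\<close>
    define l where "l = Inf S"
    have l0: "0 \<le> l" unfolding l_def using S by (intro cInf_greatest) (auto simp: S_def)
    have dl: "d l \<le> ennreal r"
    proof (rule ccontr)
      assume "\<not> ?thesis"
      then obtain l' where l': "l < l'" "ennreal r < d l'"
        using distr_fun_right_cont[OF L0, of "ennreal r" l] unfolding d_distr not_le by blast
      have "l' \<le> Inf S"
      proof (rule cInf_greatest[OF S(1)])
        fix k assume "k \<in> S"
        then show "l' \<le> k"
          using distr_fun_antimono[OF L0, of k l'] l'(2) by (cases "k \<le> l'") (auto simp: S_def d_distr)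
      qed
      with l' show False by (simp add: l_def)
    qed
    have ge_l: "ennreal r \<le> emeasure lebesgue {s \<in> ival \<alpha>. l \<le> v s}"
    proof (cases "l = 0")
      case True
      have "{0..<r} \<subseteq> ival \<alpha>" using ival_Int_lessThan[of r \<alpha>] r by auto
      then have "emeasure lebesgue {0..<r} \<le> emeasure lebesgue (ival \<alpha>)" by (intro emeasure_mono) auto
      then show ?thesis using True nn r by simp
    next
      case False
      then have l: "0 < l" using l0 by simp
      \<comment> \<open>With n + 2 in the denominator these levels lie strictly between 0 and l;
        positivity lets \<open>fin\<close> supply the finiteness that continuity from above
        requires.\<close>
      define A where "A n = {s \<in> ival \<alpha>. l - l / real (n + 2) < v s}" for n
      have pos: "0 < l - l / real (n + 2)" "l - l / real (n + 2) < l" for n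
      proof -
        have "l * 1 < l * real (n + 2)" using l by (intro mult_strict_left_mono) auto
        then have "l / real (n + 2) < l" by (subst pos_divide_less_eq) auto
        then show "0 < l - l / real (n + 2)" by linarith
        show "l - l / real (n + 2) < l" using l by simp
      qed
      have i1: "(INF n. emeasure lebesgue (A n)) = emeasure lebesgue (\<Inter>n. A n)"
      proof (rule INF_emeasure_decseq)
        show "range A \<subseteq> sets lebesgue" unfolding A_def using gr_set(1) by blast
        show "decseq A"
        proof (rule decseq_SucI)
          fix n
          have "l / real (Suc n + 2) \<le> l / real (n + 2)" using l by (intro divide_left_mono) auto
          then show "A (Suc n) \<subseteq> A n" unfolding A_def by auto
        qed
        show "emeasure lebesgue (A n) \<noteq> \<infinity>" for n
          unfolding A_def using less_imp_neq[OF fin[OF pos(1)[of n]]] .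
      qed
      have i2: "ennreal r \<le> (INF n. emeasure lebesgue (A n))"
      proof (rule INF_greatest)
        fix n
        have "l - l / real (n + 2) \<notin> S"
          using pos(2)[of n] cInf_lower[OF _ S(2), of "l - l / real (n + 2)"] unfolding l_def[symmetric]
          by (meson not_le)
        then show "ennreal r \<le> emeasure lebesgue (A n)"
          using pos(1)[of n] unfolding S_def d_def A_def by (simp add: less_imp_le not_le)
      qed
      have i3: "(\<Inter>n. A n) = {s \<in> ival \<alpha>. l \<le> v s}"
      proof safe
        fix s assume s: "s \<in> (\<Inter>n. A n)"
        then show "s \<in> ival \<alpha>" by (auto simp: A_def)
        show "l \<le> v s"
        proof (rule ccontr)
          assume "\<not> ?thesis"
          then have "0 < (l - v s) / l" using l by simp
          then obtain n where n: "1 / real (Suc n) < (l - v s) / l" using nat_approx_posE by blast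
          have "l / real (n + 2) \<le> l * (1 / real (Suc n))" using l by (simp add: frac_le)
          also have "\<dots> < l * ((l - v s) / l)" using n l by (rule mult_strict_left_mono)
          also have "\<dots> = l - v s" using l by simp
          finally have "s \<notin> A n" by (auto simp: A_def)
          with s show False by auto
        qed
      next
        fix s n assume "s \<in> ival \<alpha>" "l \<le> v s"
        then show "s \<in> A n" using pos(2)[of n] by (auto simp: A_def)
      qed
      show ?thesis using i2 unfolding i1 i3 .
    qed
    define L where "L = {s \<in> ival \<alpha>. v s = l}"
    have Ls: "L \<in> sets lebesgue" "L \<subseteq> {0..}" unfolding L_def by (rule gr_set) (auto simp: ival_def)
    obtain dr where dr: "0 \<le> dr" "d l = ennreal dr"
      using dl by (cases "d l") (auto simp: top_unique)
    have drr: "dr \<le> r" using dl dr r by simp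
    have "{s \<in> ival \<alpha>. l \<le> v s} = {s \<in> ival \<alpha>. l < v s} \<union> L" by (auto simp: L_def)
    then have "emeasure lebesgue {s \<in> ival \<alpha>. l \<le> v s} = d l + emeasure lebesgue L"
    proof -
      have "{s \<in> ival \<alpha>. l < v s} \<inter> L = {}" by (auto simp: L_def)
      moreover assume "{s \<in> ival \<alpha>. l \<le> v s} = {s \<in> ival \<alpha>. l < v s} \<union> L"
      ultimately show ?thesis unfolding d_def by (simp only: plus_emeasure[OF gr_set(1) Ls(1)])
    qed
    then have "ennreal (dr + (r - dr)) \<le> ennreal dr + emeasure lebesgue L" using ge_l dr by simp
    then have q: "ennreal (r - dr) \<le> emeasure lebesgue L"
      using dr drr by (subst (asm) ennreal_plus) auto
    obtain P where P: "P \<subseteq> L" "P \<in> sets lebesgue" "emeasure lebesgue P = ennreal (r - dr)"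
      and P1: "\<And>t. t \<in> P \<Longrightarrow> emeasure lebesgue (L \<inter> {..<t}) \<le> ennreal (r - dr)"
      and P2: "\<And>t. t \<in> L - P \<Longrightarrow> ennreal (r - dr) \<le> emeasure lebesgue (L \<inter> {..<t})"
      using initial_part[OF Ls _ q] drr by auto
    \<comment> \<open>An initial segment of the ordering, of measure exactly r: all points above
      level l and then the left part of the level set. It lies between {m < r} and {m <= r}.\<close>
    let ?U = "{s \<in> ival \<alpha>. l < v s} \<union> P"
    have U: "emeasure lebesgue ?U = ennreal r"
    proof -
      have "emeasure lebesgue ?U = d l + emeasure lebesgue P"
      proof -
        have "{s \<in> ival \<alpha>. l < v s} \<inter> P = {}" using P(1) by (auto simp: L_def)
        then show ?thesis unfolding d_def by (intro plus_emeasure[symmetric] gr_set P)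
      qed
      then show ?thesis using dr drr P(3) by (simp flip: ennreal_plus)
    qed
    have mL: "m t = ennreal dr + emeasure lebesgue (L \<inter> {..<t})" if "t \<in> L" for t
    proof -
      have "pred t = {s \<in> ival \<alpha>. l < v s} \<union> (L \<inter> {..<t})" using that by (auto simp: pred_def L_def)
      then have "m t = emeasure lebesgue ({s \<in> ival \<alpha>. l < v s} \<union> (L \<inter> {..<t}))"
        unfolding m_def by (simp only:)
      also have "\<dots> = d l + emeasure lebesgue (L \<inter> {..<t})"
      proof -
        have "L \<inter> {..<t} \<in> sets lebesgue" using Ls(1) by (intro sets.Int) auto
        moreover have "{s \<in> ival \<alpha>. l < v s} \<inter> (L \<inter> {..<t}) = {}" by (auto simp: L_def)
        ultimately show ?thesis unfolding d_def by (intro plus_emeasure[symmetric] gr_set)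
      qed
      finally show ?thesis unfolding dr .
    qed
    have sum: "ennreal dr + ennreal (r - dr) = ennreal r" using dr drr by (simp flip: ennreal_plus)
    have m_set: "{t \<in> ival \<alpha>. m t \<le> ennreal r} \<in> sets lebesgue"
      using m by (intro setI) measurable
    have "{t \<in> ival \<alpha>. m t < ennreal r} \<subseteq> ?U"
    proof safe
      fix t assume t: "t \<in> ival \<alpha>" "m t < ennreal r" "t \<notin> P" 
      show "l < v t"
      proof (rule ccontr)
        assume "\<not> l < v t"
        then consider "v t < l" | "v t = l" by linarith
        then show False
        proof cases
          case 1
          then have "emeasure lebesgue {s \<in> ival \<alpha>. l \<le> v s} \<le> m t"
            unfolding m_def by (intro emeasure_mono pred_set) (auto simp: pred_def)
          with t ge_l show False by simp
        next
          case 2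
          then have "t \<in> L - P" using t by (auto simp: L_def)
          then have "ennreal r \<le> m t" using P2[of t] mL[of t] by (simp add: add_left_mono flip: sum)
          with t show False by simp
        qed
      qed
    qed
    then have 1: "emeasure lebesgue {t \<in> ival \<alpha>. m t < ennreal r} \<le> ennreal r"
      unfolding U[symmetric] by (intro emeasure_mono sets.Un P gr_set)
    have "?U \<subseteq> {t \<in> ival \<alpha>. m t \<le> ennreal r}"
    proof safe
      fix t assume t: "t \<in> ival \<alpha>" "l < v t"
      then have "m t \<le> d l" unfolding m_def d_def
        by (intro emeasure_mono gr_set) (auto simp: pred_def)
      then show "m t \<le> ennreal r" using dl by simp
    next
      fix t assume t: "t \<in> P"
      then show "t \<in> ival \<alpha>" using P(1) by (auto simp: L_def)
      show "m t \<le> ennreal r" using P1[OF t] mL[of t] t P(1) by (auto simp add: add_left_mono simp flip: sum)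
    qed
    then have "emeasure lebesgue ?U \<le> emeasure lebesgue {t \<in> ival \<alpha>. m t \<le> ennreal r}"
      using m_set by (rule emeasure_mono)
    then have "ennreal r \<le> emeasure lebesgue {t \<in> ival \<alpha>. m t \<le> ennreal r}"
      by (simp only: U)
    with 1 show ?thesis by blast
  qed
  have lt_set: "{t \<in> ival \<alpha>. m t < ennreal r} \<in> sets lebesgue" for r
    using m by (intro setI) measurable
  have eq: "emeasure lebesgue {t \<in> ival \<alpha>. m t < ennreal r} = ennreal r" if r: "0 \<le> r" "ereal r \<le> \<alpha>" for r
  proof (cases "r = 0")
    case False
    then have r0: "0 < r" using r by simp
    have "ennreal r \<le> emeasure lebesgue {t \<in> ival \<alpha>. m t < ennreal r}"
    proof (rule dense_le)
      fix c assume c: "c < ennreal r"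
      then obtain y where y: "c = ennreal y" "0 \<le> y" by (cases c) auto
      then have yr: "y < r" using c by (simp add: ennreal_less_iff)
      define s where "s = (y + r) / 2"
      have s: "0 < s" "s < r" "y \<le> s" using yr y r0 by (auto simp: s_def)
      then have "ereal s \<le> \<alpha>" using r(2) order_trans[of "ereal s" "ereal r" \<alpha>] by simp
      then have k: "ennreal s \<le> emeasure lebesgue {t \<in> ival \<alpha>. m t \<le> ennreal s}" using key s by simp
      have "c \<le> ennreal s" using y s by (simp add: ennreal_leI)
      also have "\<dots> \<le> emeasure lebesgue {t \<in> ival \<alpha>. m t \<le> ennreal s}" by (fact k)
      also have "\<dots> \<le> emeasure lebesgue {t \<in> ival \<alpha>. m t < ennreal r}"
        using lt_set s by (intro emeasure_mono) (auto intro: le_less_trans simp: ennreal_less_iff)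
      finally show "c \<le> emeasure lebesgue {t \<in> ival \<alpha>. m t < ennreal r}"
        .
    qed
    then show ?thesis by (rule antisym[OF conjunct1[OF key[OF r0 r(2)]]])
  qed simp
  define D where "D = {t \<in> ival \<alpha>. m t < top}"
  define \<sigma> where "\<sigma> t = enn2real (m t)" for t
  have m\<sigma>: "m t = ennreal (\<sigma> t)" if "t \<in> D" for t
    using that by (simp add: D_def \<sigma>_def)
  show thesis
  proof (rule that)
    show "mp_map \<alpha> D \<sigma>"
      unfolding mp_map_def
    proof (intro conjI allI impI ballI)
      have "{t \<in> ival \<alpha>. m t < top} \<in> sets lebesgue" using m by (intro setI) measurable
      then show "D \<in> sets (I_measure \<alpha>)" by (auto simp: sets_I_iff D_def)
      show "\<sigma> \<in> borel_measurable (I_measure \<alpha>)" unfolding \<sigma>_def using m by measurable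
      show "0 \<le> \<sigma> t" for t by (simp add: \<sigma>_def)
      fix r :: real assume r: "0 \<le> r" "ereal r \<le> \<alpha>"
      have "{t \<in> D. \<sigma> t < r} = {t \<in> ival \<alpha>. m t < ennreal r}"
      proof (rule set_eqI)
        fix t
        show "t \<in> {t \<in> D. \<sigma> t < r} \<longleftrightarrow> t \<in> {t \<in> ival \<alpha>. m t < ennreal r}"
        proof (cases "t \<in> D")
          case True
          then show ?thesis using m\<sigma>[of t] r by (auto simp: ennreal_less_iff D_def \<sigma>_def)
        next
          case False
          then have "t \<in> ival \<alpha> \<Longrightarrow> \<not> m t < ennreal r"
            using less_trans[OF _ ennreal_less_top, of "m t" r] by (auto simp: D_def)
          then show ?thesis using False by auto
        qed
      qed
      then show "emeasure lebesgue {t \<in> D. \<sigma> t < r} = ennreal r" using eq[OF r] by (simp only:)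
    qed
    show "v t = 0" if t: "t \<in> ival \<alpha> - D" for t
    proof (rule ccontr)
      assume "v t \<noteq> 0"
      then have "0 < v t" using nn[of t] by simp
      \<comment> \<open>Predecessors with the same value lie in [0, t), and those with a larger
        value have finite measure if v t > 0. So only zeros of v can have infinitely much before
        them.\<close>
      have "m t \<le> emeasure lebesgue ({s \<in> ival \<alpha>. v t < v s} \<union> {0..<t})"
        unfolding m_def by (intro emeasure_mono sets.Un gr_set) (auto simp: pred_def ival_def)
      also have "\<dots> \<le> emeasure lebesgue {s \<in> ival \<alpha>. v t < v s} + emeasure lebesgue {0..<t}"
        by (intro emeasure_subadditive gr_set) auto
      also have "\<dots> < top" using fin[OF \<open>0 < v t\<close>] t by (auto simp: ival_def)
      finally show False using t by (auto simp: D_def)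
    qed
    show "emeasure lebesgue {s \<in> ival \<alpha>. v t < v s} \<le> ennreal (\<sigma> t)" if "t \<in> D" for t
      unfolding m\<sigma>[OF that, symmetric] m_def by (intro emeasure_mono pred_set) (auto simp: pred_def)
  qed
qed

section \<open>Integrals of decreasing functions\<close>

lemma antimono_integrable:
  fixes f :: "real \<Rightarrow> real"
  assumes "\<And>s t. c \<le> s \<Longrightarrow> s \<le> t \<Longrightarrow> t \<le> d \<Longrightarrow> f t \<le> f s"
  shows "f integrable_on {c..d}"
proof -
  have "mono_on {c..d} (\<lambda>x. - f x)" using assms by (auto simp: mono_on_def)
  then have "(\<lambda>x. - f x) integrable_on {c..d}" by (rule integrable_on_mono_on)
  then show ?thesis by (subst (asm) integrable_neg_iff)
qed

text \<open>The bound is asked for only inside the interval, because the real version of x* is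
  uncontrolled at 0. Altering the integrand at two points does not change the integral.\<close>

lemma integral_lower_bound:
  fixes f :: "real \<Rightarrow> real"
  assumes f: "f integrable_on {c..d}" and cd: "c \<le> d"
    and lo: "\<And>t. c < t \<Longrightarrow> t < d \<Longrightarrow> lo \<le> f t"
  shows "(d - c) * lo \<le> integral {c..d} f"
proof -
  let ?g = "\<lambda>t. if t \<in> {c, d} then lo else f t"
  have g: "?g integrable_on {c..d}" by (rule integrable_spike[OF f, of "{c, d}"]) auto
  have eq: "integral {c..d} f = integral {c..d} ?g" by (rule integral_spike[of "{c, d}"]) auto
  have "integral {c..d} (\<lambda>_. lo) \<le> integral {c..d} ?g"
    using lo by (intro integral_le g) auto
  then show ?thesis using eq cd by simp
qed

lemma integral_upper_bound:
  fixes f :: "real \<Rightarrow> real"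
  assumes f: "f integrable_on {c..d}" and cd: "c \<le> d"
    and hi: "\<And>t. c < t \<Longrightarrow> t < d \<Longrightarrow> f t \<le> hi"
  shows "integral {c..d} f \<le> (d - c) * hi"
  using integral_lower_bound[of "\<lambda>t. - f t" c d "- hi"] assms by (simp add: integrable_neg_iff)

text \<open>On each cell a decreasing f is bounded by its value at the left end. The first cell is
  left out, since f is not controlled at a and may be unbounded near it.\<close>

lemma antimono_riemann_sum:
  fixes f :: "real \<Rightarrow> real"
  assumes u: "0 < u" and j: "a + real (Suc j) * u \<le> b"
    and anti: "\<And>s t. a < s \<Longrightarrow> s \<le> t \<Longrightarrow> t \<le> b \<Longrightarrow> f t \<le> f s"
  shows "integral {a + u..a + real (Suc j) * u} f \<le> u * (\<Sum>i<j. f (a + real (Suc i) * u))"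
  using j
proof (induction j)
  case 0
  then show ?case by simp
next
  case (Suc j)
  let ?p = "\<lambda>i. a + real (Suc i) * u"
  have le: "?p j \<le> ?p (Suc j)" "a < a + u" "a + u \<le> ?p j" using u by (auto simp: algebra_simps)
  then have pj: "?p j \<le> b" "a < ?p j" using Suc.prems by linarith+
  have int: "f integrable_on {a + u..?p (Suc j)}"
    using le Suc.prems by (intro antimono_integrable anti) linarith+
  have int2: "f integrable_on {?p j..?p (Suc j)}"
    using pj Suc.prems by (intro antimono_integrable anti) linarith+
  have "integral {a + u..?p (Suc j)} f = integral {a + u..?p j} f + integral {?p j..?p (Suc j)} f"
    using le int by (intro Henstock_Kurzweil_Integration.integral_combine[symmetric]) auto
  also have "integral {?p j..?p (Suc j)} f \<le> (?p (Suc j) - ?p j) * f (?p j)"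
  proof (rule integral_upper_bound[OF int2 le(1)])
    fix t assume "?p j < t" "t < ?p (Suc j)"
    then show "f t \<le> f (?p j)"
      using anti[of "?p j" t] pj Suc.prems by linarith
  qed
  also have "?p (Suc j) - ?p j = u" by (simp add: algebra_simps)
  also have "integral {a + u..?p j} f \<le> u * (\<Sum>i<j. f (?p i))"
    using pj by (intro Suc.IH)
  finally show ?case by (simp add: algebra_simps)
qed

text \<open>\<open>real_of_ereal\<close> sends \<infinity> to 0, so \<open>rr\<close> is 0 at 0 when
  x* is infinite there. This is why monotonicity is stated only for positive arguments.\<close>

definition rr :: "ereal \<Rightarrow> (real \<Rightarrow> ereal) \<Rightarrow> real \<Rightarrow> real" where
  "rr \<alpha> x t = real_of_ereal (rearrangement \<alpha> x t)"

definition Phi :: "ereal \<Rightarrow> (real \<Rightarrow> ereal) \<Rightarrow> real \<Rightarrow> real" where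
  "Phi \<alpha> x t = integral {0..t} (rr \<alpha> x)"

definition flatten :: "(real \<Rightarrow> real) \<Rightarrow> real \<Rightarrow> real \<Rightarrow> real \<Rightarrow> real \<Rightarrow> real" where
  "flatten f a b c t = (if a \<le> t \<and> t < b then c else f t)"

lemma flatten_borel: "f \<in> borel_measurable borel \<Longrightarrow> flatten f a b c \<in> borel_measurable borel"
proof -
  assume [measurable]: "f \<in> borel_measurable borel"
  have "(\<lambda>t. if a \<le> t \<and> t < b then c else f t) \<in> borel_measurable borel" by measurable
  then show ?thesis by (simp add: flatten_def[abs_def])
qed

lemma rr_nonneg [simp]: "0 \<le> rr \<alpha> x t"
  by (simp add: rr_def real_of_ereal_pos)

lemma rr_borel [measurable]: "rr \<alpha> x \<in> borel_measurable borel"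
  unfolding rr_def[abs_def] by measurable

lemma cyclic_sum:
  fixes \<phi> :: "nat \<Rightarrow> real"
  assumes "j < m"
  shows "(\<Sum>k<m. \<phi> (if j + k < m then j + k else j + k - m)) = (\<Sum>i<m. \<phi> i)"
  using assms
  by (intro sum.reindex_bij_witness[where i = "\<lambda>i. if j \<le> i then i - j else i + m - j"
        and j = "\<lambda>k. if j + k < m then j + k else j + k - m"]) auto

section \<open>Symmetric spaces\<close>

context symmetric_space
begin

text \<open>Elements of E are finite almost everywhere, so norm estimates are carried out with real
  functions, where sums and integrals meet no infinite values.\<close>

definition elem :: "(real \<Rightarrow> real) \<Rightarrow> bool" where
  "elem g \<longleftrightarrow> (\<lambda>t. ereal (g t)) \<in> E"

definition N :: "(real \<Rightarrow> real) \<Rightarrow> real" where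
  "N g = nrm (\<lambda>t. ereal (g t))"

lemma elem_ideal_AE:
  assumes "g \<in> borel_measurable (I_measure \<alpha>)" "elem h" "AE t in I_measure \<alpha>. \<bar>g t\<bar> \<le> \<bar>h t\<bar>"
  shows "elem g" "N g \<le> N h"
  using ideal[of "\<lambda>t. ereal (g t)" "\<lambda>t. ereal (h t)"] assms
  by (auto simp: elem_def N_def L0_def)

lemma elem_ideal:
  assumes "g \<in> borel_measurable (I_measure \<alpha>)" "elem h" "\<And>t. t \<in> ival \<alpha> \<Longrightarrow> \<bar>g t\<bar> \<le> \<bar>h t\<bar>"
  shows "elem g" "N g \<le> N h"
proof -
  have "AE t in I_measure \<alpha>. \<bar>g t\<bar> \<le> \<bar>h t\<bar>" using assms(3) by (intro AE_I2) simp
  then show "elem g" "N g \<le> N h" using elem_ideal_AE[OF assms(1,2)] by blast+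
qed

lemma elem_add:
  assumes "elem g" "elem h"
  shows "elem (\<lambda>t. g t + h t)" "N (\<lambda>t. g t + h t) \<le> N g + N h"
  using add_closed[of "\<lambda>t. ereal (g t)" "\<lambda>t. ereal (h t)"]
    nrm_triangle[of "\<lambda>t. ereal (g t)" "\<lambda>t. ereal (h t)"] assms
  by (auto simp: elem_def N_def)

lemma elem_scale:
  assumes "elem g"
  shows "elem (\<lambda>t. c * g t)" "N (\<lambda>t. c * g t) = \<bar>c\<bar> * N g"
  using scale_closed[of "\<lambda>t. ereal (g t)" c] nrm_scale[of "\<lambda>t. ereal (g t)" c] assms
  by (auto simp: elem_def N_def)

lemma elem_diff: "elem g \<Longrightarrow> elem h \<Longrightarrow> elem (\<lambda>t. g t - h t)"
  using elem_add(1)[OF _ elem_scale(1)[of h "-1"], of g] by simp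

lemma N_nonneg: "elem g \<Longrightarrow> 0 \<le> N g"
  using nrm_nonneg by (simp add: elem_def N_def)

lemma N_eq_0_iff: "elem g \<Longrightarrow> N g = 0 \<longleftrightarrow> (AE t in I_measure \<alpha>. g t = 0)"
  using nrm_eq_0_iff[of "\<lambda>t. ereal (g t)"] by (simp add: elem_def N_def)

lemma elem_zero: "elem (\<lambda>t. 0)" "N (\<lambda>t. 0) = 0"
proof -
  obtain w where "w \<in> E" using strictly_positive by auto
  then have "(\<lambda>t. ereal 0 * w t) \<in> E" by (rule scale_closed)
  moreover have "(\<lambda>t. ereal 0 * w t) = (\<lambda>t. ereal 0)" by (simp flip: zero_ereal_def)
  ultimately show "elem (\<lambda>t. 0)" by (simp only: elem_def)
  then show "N (\<lambda>t. 0) = 0" by (subst N_eq_0_iff) auto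
qed

lemma elem_sum:
  fixes m :: nat
  assumes "\<And>k. k < m \<Longrightarrow> elem (g k)"
  shows "elem (\<lambda>t. \<Sum>k<m. g k t) \<and> N (\<lambda>t. \<Sum>k<m. g k t) \<le> (\<Sum>k<m. N (g k))"
  using assms
proof (induction m)
  case 0
  then show ?case using elem_zero by simp
next
  case (Suc m)
  then have IH: "elem (\<lambda>t. \<Sum>k<m. g k t)" "N (\<lambda>t. \<Sum>k<m. g k t) \<le> (\<Sum>k<m. N (g k))"
    and m: "elem (g m)" by auto
  show ?case using elem_add[OF IH(1) m] IH(2) by auto
qed

lemma nrm_cong_AE:
  assumes "x \<in> E" "y \<in> L0 \<alpha>" "AE t in I_measure \<alpha>. \<bar>y t\<bar> = \<bar>x t\<bar>"
  shows "y \<in> E" "nrm y = nrm x"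
proof -
  have y: "y \<in> E \<and> nrm y \<le> nrm x" using assms by (intro ideal) auto
  then show "y \<in> E" ..
  have "x \<in> L0 \<alpha>" using assms subset_L0 by auto
  moreover have "AE t in I_measure \<alpha>. \<bar>x t\<bar> \<le> \<bar>y t\<bar>" using assms(3) by eventually_elim simp
  ultimately have "nrm x \<le> nrm y" using ideal[of x y] y by blast
  with y show "nrm y = nrm x" by simp
qed

lemma elem_pull:
  assumes "elem f" "f \<in> borel_measurable borel" "mp_map \<alpha> D \<sigma>"
  shows "elem (pull D \<sigma> f)" "N (pull D \<sigma> f) = N f"
  using symmetric[OF pull_L0[OF assms(3,2)] _ distr_pull[OF alpha assms(3,2)]] assms(1)
  by (auto simp: elem_def N_def)

text \<open>The average h of the m rotations of f by multiples of u = (b - a)/m has norm at most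
  \<open>N f\<close>, by symmetry and the triangle inequality. For almost every t in [a, b) the
  rotated points visit every cell once, so \<open>h t\<close> is at least the mean of the values at
  the right ends of the cells. That mean dominates the integral without the first cell, divided by b
  - a.\<close>

lemma flatten_step:
  assumes f: "elem f" "f \<in> borel_measurable borel" "\<And>t. 0 \<le> t \<Longrightarrow> 0 \<le> f t"
    and ab: "0 \<le> a" "a < b" "ereal b \<le> \<alpha>"
    and anti: "\<And>s t. a < s \<Longrightarrow> s \<le> t \<Longrightarrow> t \<le> b \<Longrightarrow> f t \<le> f s"
    and m: "0 < m" and c: "0 \<le> c" "c * (b - a) \<le> integral {a + (b - a) / real m..b} f"
  shows "elem (flatten f a b c)" "N (flatten f a b c) \<le> N f"
proof -
  define u where "u = (b - a) / real m"
  have u: "0 < u" "b = a + real m * u" using ab m by (auto simp: u_def)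
  define g where "g k = pull (ival \<alpha>) (rot a b (real k * u)) f" for k
  define h where "h t = (1 / real m) * (\<Sum>k<m. g k t)" for t
  have g: "elem (g k) \<and> N (g k) = N f" if "k < m" for k
  proof -
    have "mp_map \<alpha> (ival \<alpha>) (rot a b (real k * u))"
      using that ab u by (intro mp_map_rot) auto
    then show ?thesis using elem_pull[OF f(1,2)] by (simp add: g_def)
  qed
  have G: "elem (\<lambda>t. \<Sum>k<m. g k t)" "N (\<lambda>t. \<Sum>k<m. g k t) \<le> (\<Sum>k<m. N (g k))"
    using elem_sum[of m g] g by auto
  have "(\<Sum>k<m. N (g k)) = real m * N f" using g by simp
  then have "(1 / real m) * N (\<lambda>t. \<Sum>k<m. g k t) \<le> (1 / real m) * (real m * N f)"
    using G(2) by (intro mult_left_mono) auto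
  then have h: "elem h" "N h \<le> N f"
    using elem_scale[OF G(1), of "1 / real m"] m unfolding h_def[abs_def] by auto
  \<comment> \<open>At a grid point the rotated point could be a itself, about which
    \<open>anti\<close> says nothing. The grid is a null set.\<close>
  define S where "S = (\<lambda>i. a + real i * u) ` {..m}"
  have "AE t in lborel. t \<notin> S"
    using finite_imp_null_set_lborel[of S] by (intro AE_not_in) (auto simp: S_def)
  then have "AE t in lebesgue. t \<notin> S" by (rule AE_completion)
  then have S: "AE t in I_measure \<alpha>. t \<notin> S" unfolding AE_I_iff by auto
  have le: "\<bar>flatten f a b c t\<bar> \<le> \<bar>h t\<bar>" if t: "t \<in> ival \<alpha>" "t \<notin> S" for t
  proof (cases "a \<le> t \<and> t < b")
    case False
    then have "g k t = f t" for k using t by (auto simp: g_def pull_def rot_def)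
    then have "h t = f t" using m by (simp add: h_def)
    then show ?thesis using False by (auto simp: flatten_def)
  next
    case True
    define j where "j = nat \<lfloor>(t - a) / u\<rfloor>"
    have q0: "0 \<le> (t - a) / u" using True u by simp
    have "real j \<le> (t - a) / u" "(t - a) / u < real j + 1" using q0 unfolding j_def by linarith+
    then have j1: "a + real j * u \<le> t" "t < a + (real j + 1) * u"
      using u by (auto simp: field_simps)
    then have "real j * u < real m * u" using True u by linarith
    then have jm: "j < m" using u by simp
    have j2: "a + real j * u < t" using j1(1) t(2) jm by (auto simp: S_def less_le)
    have j1': "t < a + real j * u + u" using j1(2) by (simp add: algebra_simps)
    \<comment> \<open>Rotation by k u moves cell j onto cell j + k modulo m, where f is at least its
      value at the right end of the cell.\<close>
    have gk: "f (a + real (Suc (if j + k < m then j + k else j + k - m)) * u) \<le> g k t" if k: "k < m" for k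
    proof (cases "j + k < m")
      case lt: True
      then have "real (Suc (j + k)) * u \<le> real m * u" using u by (intro mult_right_mono) auto
      moreover have e: "real (Suc (j + k)) * u = real j * u + real k * u + u" by (simp add: algebra_simps)
      moreover have "0 \<le> real j * u" "0 \<le> real k * u" using u by simp_all
      ultimately have "t + real k * u < b" "a + real (Suc (j + k)) * u \<le> b"
        "t + real k * u < a + real (Suc (j + k)) * u" "a < t + real k * u"
        using j1' j2 u(2) by linarith+
      then show ?thesis
        using lt True t anti[of "t + real k * u" "a + real (Suc (j + k)) * u"]
        by (simp add: g_def pull_def rot_def)
    next
      case ge: False
      define i where "i = j + k - m"
      have i: "real j + real k = real i + real m" "i < m" using ge jm k by (auto simp: i_def)
      have e: "real j * u + real k * u = real i * u + real m * u"
        using i(1) by (metis distrib_right)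
      have "real (Suc i) * u \<le> real m * u" using u i by (intro mult_right_mono) auto
      moreover have "real (Suc i) * u = real i * u + u" by (simp add: algebra_simps)
      moreover have "0 \<le> real i * u" using u by simp
      ultimately have *: "\<not> t + real k * u < b" "a + real (Suc i) * u \<le> b"
        "t + real k * u - (b - a) < a + real (Suc i) * u" "a < t + real k * u - (b - a)"
        using j1' j2 u(2) e by linarith+
      then show ?thesis
        using ge True t anti[of "t + real k * u - (b - a)" "a + real (Suc i) * u"]
        by (simp add: g_def pull_def rot_def i_def[symmetric])
    qed
    \<comment> \<open>The m - 1 cells after the first bound the integral by m - 1 terms. The
      nonnegative term f b is added to complete the cycle of m cells.\<close>
    obtain m' where m': "m = Suc m'" using m by (cases m) auto
    have be: "a + real (Suc m') * u = b" using u(2) unfolding m' by (rule sym)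
    have "c * (b - a) \<le> integral {a + u..a + real (Suc m') * u} f"
      unfolding be using c(2) by (simp only: u_def)
    also have "\<dots> \<le> u * (\<Sum>i<m'. f (a + real (Suc i) * u))"
      using u(1) eq_refl[OF be] anti by (rule antimono_riemann_sum)
    also have "\<dots> \<le> u * (\<Sum>i<m. f (a + real (Suc i) * u))"
    proof -
      have "0 \<le> u * f (a + real (Suc m') * u)" using f(3)[of b] ab u(1) by (simp only: be) simp
      then show ?thesis unfolding m' by (simp add: distrib_left)
    qed
    also have "(\<Sum>i<m. f (a + real (Suc i) * u)) = (\<Sum>k<m. f (a + real (Suc (if j + k < m then j + k else j + k - m)) * u))"
      using cyclic_sum[OF jm, of "\<lambda>i. f (a + real (Suc i) * u)"] by simp
    also have "u * \<dots> \<le> u * (\<Sum>k<m. g k t)"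
      using gk u by (intro mult_left_mono sum_mono) auto
    finally have "c * (b - a) \<le> u * (\<Sum>k<m. g k t)" .
    moreover have "b - a = real m * u" using u(2) by simp
    ultimately have "c * (real m * u) \<le> u * (\<Sum>k<m. g k t)" by (simp only:)
    then have "c \<le> h t" using u(1) m by (simp add: h_def field_simps)
    then show ?thesis using c(1) True by (simp add: flatten_def)
  qed
  have meas: "flatten f a b c \<in> borel_measurable (I_measure \<alpha>)"
    by (intro measurable_I_borel flatten_borel f)
  have AE: "AE t in I_measure \<alpha>. \<bar>flatten f a b c t\<bar> \<le> \<bar>h t\<bar>"
    using S AE_space by eventually_elim (auto intro: le)
  show "elem (flatten f a b c)" "N (flatten f a b c) \<le> N f"
    using elem_ideal_AE[OF meas h(1) AE] h(2) by auto
qed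

text \<open>Averaging a decreasing function over an interval is a limit of averages of cyclic rotations,
  so it does not increase the norm.\<close>

lemma flatten_norm:
  assumes f: "elem f" "f \<in> borel_measurable borel" "\<And>t. 0 \<le> t \<Longrightarrow> 0 \<le> f t"
    and ab: "0 \<le> a" "a < b" "ereal b \<le> \<alpha>"
    and anti: "\<And>s t. a < s \<Longrightarrow> s \<le> t \<Longrightarrow> t \<le> b \<Longrightarrow> f t \<le> f s"
    and int: "f integrable_on {a..b}" and q: "0 \<le> q" "q * (b - a) \<le> integral {a..b} f"
  shows "elem (flatten f a b q)" "N (flatten f a b q) \<le> N f"
proof -
  have meas: "flatten f a b c \<in> borel_measurable (I_measure \<alpha>)" for c
    by (intro measurable_I_borel flatten_borel f)
  \<comment> \<open>The first cell missing in \<open>flatten_step\<close> is paid for by a factor r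
    < 1: as m grows, the truncated integral tends to the full one and eventually exceeds r q (b -
    a). Letting r tend to 1 gives the claim.\<close>
  have scaled: "elem (\<lambda>t. r * flatten f a b q t) \<and> N (\<lambda>t. r * flatten f a b q t) \<le> N f"
    if r: "0 < r" "r < 1" for r
  proof -
    have "\<exists>m>0. (r * q) * (b - a) \<le> integral {a + (b - a) / real m..b} f"
    proof (cases "q = 0")
      case True
      then show ?thesis by (intro exI[of _ 1]) auto
    next
      case False
      then have "(r * q) * (b - a) < q * (b - a)" using q ab r by simp
      then have lt: "(r * q) * (b - a) < integral {a..b} f" using q by linarith
      have "continuous_on {a..b} (\<lambda>x. integral {x..b} f)"
        using int by (rule indefinite_integral_continuous_1')
      moreover have "(\<lambda>n. a + (b - a) / real (Suc n)) \<longlonglongrightarrow> a + 0"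
        by (intro tendsto_add tendsto_const LIMSEQ_Suc[OF lim_const_over_n])
      moreover have "a + (b - a) / real (Suc n) \<in> {a..b}" for n
      proof -
        have "(b - a) / real (Suc n) \<le> (b - a) / 1" using ab by (intro divide_left_mono) auto
        moreover have "0 \<le> (b - a) / real (Suc n)" using ab by simp
        ultimately show ?thesis by simp
      qed
      ultimately have "(\<lambda>n. integral {a + (b - a) / real (Suc n)..b} f) \<longlonglongrightarrow> integral {a..b} f"
        using ab by (intro continuous_on_tendsto_compose[of "{a..b}" "\<lambda>x. integral {x..b} f"]) auto
      then have "eventually (\<lambda>n. (r * q) * (b - a) < integral {a + (b - a) / real (Suc n)..b} f) sequentially"
        using lt by (rule order_tendstoD)
      then obtain n where "(r * q) * (b - a) < integral {a + (b - a) / real (Suc n)..b} f"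
        using eventually_happens sequentially_bot by blast
      then show ?thesis by (intro exI[of _ "Suc n"]) auto
    qed
    then obtain m where m: "0 < m" "(r * q) * (b - a) \<le> integral {a + (b - a) / real m..b} f" by auto
    have F: "elem (flatten f a b (r * q))" "N (flatten f a b (r * q)) \<le> N f"
      using flatten_step[OF f ab anti m(1) _ m(2)] q r by auto
    have "\<bar>r * flatten f a b q t\<bar> \<le> \<bar>flatten f a b (r * q) t\<bar>" if "t \<in> ival \<alpha>" for t
      using f(3)[of t] that r by (auto simp: flatten_def ival_def abs_mult intro: mult_left_le_one_le)
    moreover have "(\<lambda>t. r * flatten f a b q t) \<in> borel_measurable (I_measure \<alpha>)"
      by (intro borel_measurable_times borel_measurable_const meas)
    ultimately show ?thesis using elem_ideal[OF _ F(1)] F(2) by (meson order_trans)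
  qed
  have "elem (\<lambda>t. (1/2) * flatten f a b q t)" using scaled[of "1/2"] by simp
  from elem_scale(1)[OF this, of 2] show el: "elem (flatten f a b q)" by simp
  show "N (flatten f a b q) \<le> N f"
  proof (rule field_le_mult_one_interval)
    fix r :: real assume "0 < r" "r < 1"
    then show "r * N (flatten f a b q) \<le> N f" using scaled[of r] elem_scale(2)[OF el, of r] by simp
  qed
qed

section \<open>Finiteness and integrability of rearrangements\<close>

lemma in_L0: "x \<in> E \<Longrightarrow> x \<in> L0 \<alpha>"
  using subset_L0 by auto

lemma rearrangement_in_E:
  assumes "x \<in> E"
  shows "rearrangement \<alpha> x \<in> E" "nrm (rearrangement \<alpha> x) = nrm x"
  using symmetric[OF rearrangement_L0 assms distr_fun_rearrangement[OF in_L0[OF assms]]] by auto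

lemma rearrangement_finite:
  assumes x: "x \<in> E" and t: "0 < t"
  shows "\<bar>rearrangement \<alpha> x t\<bar> \<noteq> \<infinity>"
proof
  assume inf: "\<bar>rearrangement \<alpha> x t\<bar> = \<infinity>"
  then have "t \<in> ival \<alpha>" using rearrangement_outside[OF in_L0[OF x], of t] t by (cases "t \<in> ival \<alpha>") auto
  have "AE s in lebesgue. s \<in> ival \<alpha> \<longrightarrow> \<bar>rearrangement \<alpha> x s\<bar> \<noteq> \<infinity>"
    using finite_AE[OF rearrangement_in_E(1)[OF x]] by (simp only: AE_I_iff)
  moreover have "\<bar>rearrangement \<alpha> x s\<bar> = \<infinity>" if "s \<le> t" for s
    using rearrangement_antimono[OF that, of \<alpha> x] inf by (cases "rearrangement \<alpha> x s"; cases "rearrangement \<alpha> x t") auto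
  ultimately have "AE s in lebesgue. s \<notin> {0..<t}"
    by (elim eventually_mono) (use ival_mono[OF \<open>t \<in> ival \<alpha>\<close>] in auto)
  then have "emeasure lebesgue {0..<t} = 0"
    by (subst (asm) AE_iff_measurable[where N = "{0..<t}"]) auto
  with t show False by simp
qed

lemma ereal_rr: "x \<in> E \<Longrightarrow> 0 < t \<Longrightarrow> ereal (rr \<alpha> x t) = rearrangement \<alpha> x t"
  using rearrangement_finite by (simp add: rr_def ereal_real)

lemma AE_I_pos: "AE t in I_measure \<alpha>. 0 < t"
proof -
  have "AE t in lborel. t \<noteq> (0::real)" by (rule AE_lborel_singleton)
  then have "AE t in lebesgue. t \<noteq> (0::real)" by (rule AE_completion)
  then show ?thesis unfolding AE_I_iff by eventually_elim (auto simp: ival_def)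
qed

lemma AE_rr: "x \<in> E \<Longrightarrow> AE t in I_measure \<alpha>. ereal (rr \<alpha> x t) = rearrangement \<alpha> x t"
  using AE_I_pos by eventually_elim (rule ereal_rr)

lemma elem_rr:
  assumes x: "x \<in> E"
  shows "elem (rr \<alpha> x)" "N (rr \<alpha> x) = nrm x"
proof -
  have "(\<lambda>t. ereal (rr \<alpha> x t)) \<in> L0 \<alpha>"
    unfolding L0_def by (intro measurable_I_borel) measurable
  moreover have "AE t in I_measure \<alpha>. \<bar>ereal (rr \<alpha> x t)\<bar> = \<bar>rearrangement \<alpha> x t\<bar>"
    using AE_rr[OF x] by eventually_elim simp
  ultimately show "elem (rr \<alpha> x)" "N (rr \<alpha> x) = nrm x"
    using nrm_cong_AE[OF rearrangement_in_E(1)[OF x]] rearrangement_in_E(2)[OF x]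
    by (auto simp: elem_def N_def)
qed

lemma rr_antimono: "x \<in> E \<Longrightarrow> 0 < s \<Longrightarrow> s \<le> t \<Longrightarrow> rr \<alpha> x t \<le> rr \<alpha> x s"
  using rearrangement_antimono[of s t \<alpha> x] ereal_rr[of x s] ereal_rr[of x t]
  by (metis ereal_less_eq(3) less_le_trans)

lemma rr_outside: "x \<in> E \<Longrightarrow> 0 \<le> t \<Longrightarrow> t \<notin> ival \<alpha> \<Longrightarrow> rr \<alpha> x t = 0"
  using rearrangement_outside[OF in_L0] by (simp add: rr_def)

lemma rr_right_cont:
  assumes x: "x \<in> E" and t: "0 < t" and l: "l < rr \<alpha> x t" "0 \<le> l"
  obtains s where "t < s" "l < rr \<alpha> x s"
proof -
  have "ereal l < rearrangement \<alpha> x t" using l ereal_rr[OF x t] by (metis less_ereal.simps(1))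
  then obtain s where s: "t < s" "ereal l < rearrangement \<alpha> x s"
    using rearrangement_right_cont[OF in_L0[OF x] less_imp_le[OF t]] l(2) by blast
  then have "l < rr \<alpha> x s" using ereal_rr[OF x, of s] t by (metis less_ereal.simps(1) less_trans)
  with s(1) show thesis by (rule that)
qed

lemma rr_integrable_pos: "x \<in> E \<Longrightarrow> 0 < s \<Longrightarrow> rr \<alpha> x integrable_on {s..t}"
  by (rule antimono_integrable) (auto intro: rr_antimono)

text \<open>\<open>flatten_step\<close> with m = n + 1 uses only the integral away from 0. It shows
  that the truncated mean c_n times the norm of the indicator of [0, b) is at most the norm of x,
  and that indicator has positive norm.\<close>

lemma rr_integrals_bounded:
  assumes x: "x \<in> E" and b: "0 < b" "ereal b \<le> \<alpha>"
  shows "\<exists>C. \<forall>n. integral {b / real (Suc n)..b} (rr \<alpha> x) \<le> C"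
proof -
  define c where "c n = integral {b / real (Suc n)..b} (rr \<alpha> x) / b" for n
  let ?\<chi> = "indicator {0..<b} :: real \<Rightarrow> real"
  have c0: "0 \<le> c n" for n
    unfolding c_def using b by (intro divide_nonneg_nonneg integral_nonneg rr_integrable_pos[OF x]) auto
  have F: "elem (\<lambda>t. c n * ?\<chi> t) \<and> N (\<lambda>t. c n * ?\<chi> t) \<le> nrm x" for n
  proof -
    have F: "elem (flatten (rr \<alpha> x) 0 b (c n))" "N (flatten (rr \<alpha> x) 0 b (c n)) \<le> N (rr \<alpha> x)"
      using flatten_step[OF elem_rr(1)[OF x], of 0 b "Suc n" "c n"] b rr_antimono[OF x] c0[of n]
      by (auto simp: c_def)
    have le: "\<bar>c n * ?\<chi> t\<bar> \<le> \<bar>flatten (rr \<alpha> x) 0 b (c n) t\<bar>" for t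
      by (auto simp: flatten_def indicator_def)
    have "(\<lambda>t. c n * ?\<chi> t) \<in> borel_measurable (I_measure \<alpha>)"
      by (intro measurable_I_borel) measurable
    from elem_ideal[OF this F(1) le] F(2) elem_rr(2)[OF x] show ?thesis by auto
  qed
  show ?thesis
  proof (cases "\<exists>n. 0 < c n")
    \<comment> \<open>If no c_n is positive, the integrals are bounded by 0; otherwise a positive
      one shows that the indicator belongs to E.\<close>
    case False
    then have "c n \<le> 0" for n by (auto simp: not_less)
    then have "integral {b / real (Suc n)..b} (rr \<alpha> x) \<le> 0" for n
      using b by (simp add: c_def divide_le_0_iff)
    then show ?thesis by blast
  next
    case True
    then obtain k where k: "0 < c k" by auto
    have \<chi>: "elem ?\<chi>" using elem_scale(1)[OF conjunct1[OF F[of k]], of "1 / c k"] k by simp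
    have "N ?\<chi> \<noteq> 0"
    proof
      assume "N ?\<chi> = 0"
      then have "AE t in lebesgue. t \<in> ival \<alpha> \<longrightarrow> ?\<chi> t = 0"
        using N_eq_0_iff[OF \<chi>] by (simp add: AE_I_iff)
      moreover have "{0..<b} \<subseteq> ival \<alpha>" using ival_Int_lessThan[of b \<alpha>] b by auto
      ultimately have "AE t in lebesgue. t \<notin> {0..<b}" by (auto elim!: eventually_mono simp: indicator_def)
      then have "emeasure lebesgue {0..<b} = 0"
        by (subst (asm) AE_iff_measurable[where N = "{0..<b}"]) auto
      with b show False by simp
    qed
    then have pos: "0 < N ?\<chi>" using N_nonneg[OF \<chi>] by simp
    have "integral {b / real (Suc n)..b} (rr \<alpha> x) \<le> b * (nrm x / N ?\<chi>)" for n
    proof -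
      have "c n * N ?\<chi> \<le> nrm x" using F[of n] elem_scale(2)[OF \<chi>, of "c n"] c0[of n] by simp
      then have "c n \<le> nrm x / N ?\<chi>" using pos by (simp add: pos_le_divide_eq)
      then have "b * c n \<le> b * (nrm x / N ?\<chi>)" using b by (intro mult_left_mono) auto
      then show ?thesis using b by (simp add: c_def)
    qed
    then show ?thesis by blast
  qed
qed

lemma rr_integrable_short:
  assumes x: "x \<in> E" and b: "0 < b" "ereal b \<le> \<alpha>"
  shows "rr \<alpha> x integrable_on {0..b}"
proof -
  obtain C where C: "\<And>n. integral {b / real (Suc n)..b} (rr \<alpha> x) \<le> C"
    using rr_integrals_bounded[OF assms] by auto
  define f where "f n t = (if t \<in> {b / real (Suc n)..b} then rr \<alpha> x t else 0)" for n t
  \<comment> \<open>Every truncation vanishes at 0, hence so does the limit; \<open>rr\<close> can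
    differ from it only at that point.\<close>
  define g where "g t = (if t = 0 then 0 else rr \<alpha> x t)" for t
  have sub: "{b / real (Suc n)..b} \<inter> {0..b} = {b / real (Suc n)..b}" for n using b by auto
  have int: "f n integrable_on {0..b}" for n
    unfolding f_def integrable_restrict_Int sub using b by (intro rr_integrable_pos[OF x]) simp
  have eq: "integral {0..b} (f n) = integral {b / real (Suc n)..b} (rr \<alpha> x)" for n
    unfolding f_def by (simp only: integral_restrict_Int sub)
  have "g integrable_on {0..b} \<and> (\<lambda>k. integral {0..b} (f k)) \<longlonglongrightarrow> integral {0..b} g"
  proof (rule monotone_convergence_increasing[OF int])
    fix k t
    have "b / real (Suc (Suc k)) \<le> b / real (Suc k)" using b by (intro divide_left_mono) auto
    then show "f k t \<le> f (Suc k) t" by (auto simp: f_def)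
  next
    fix t assume t: "t \<in> {0..b}"
    show "(\<lambda>k. f k t) \<longlonglongrightarrow> g t"
    proof (cases "t = 0")
      case True
      have "0 < b / real (Suc k)" for k using b by simp
      then have "0 \<notin> {b / real (Suc k)..b}" for k by (meson atLeastAtMost_iff not_le)
      then have "f k t = 0" for k unfolding f_def True by (rule if_not_P)
      then show ?thesis using True by (simp add: g_def)
    next
      case False
      have "(\<lambda>n. b / real (Suc n)) \<longlonglongrightarrow> 0" by (rule LIMSEQ_Suc[OF lim_const_over_n])
      then have "eventually (\<lambda>n. b / real (Suc n) < t) sequentially"
        using False t by (intro order_tendstoD) auto
      then have "eventually (\<lambda>n. f n t = g t) sequentially"
        by eventually_elim (use t False in \<open>auto simp: f_def g_def\<close>)
      then show ?thesis by (rule tendsto_eventually)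
    qed
  next
    have "0 \<le> integral {0..b} (f n)" for n
      by (intro integral_nonneg int) (auto simp: f_def)
    then show "bounded (range (\<lambda>k. integral {0..b} (f k)))"
      using C unfolding bounded_iff eq by (intro exI[of _ C]) auto
  qed
  then have "g integrable_on {0..b}" ..
  then show ?thesis
    by (rule integrable_spike[where S = "{0}"]) (auto simp: g_def)
qed

lemma rr_integrable:
  assumes x: "x \<in> E"
  shows "rr \<alpha> x integrable_on {0..t}"
proof -
  consider "t \<le> 0" | "0 < t" "ereal t \<le> \<alpha>" | "1 < t" "\<alpha> = 1"
    using alpha by (cases "t \<le> 0"; cases "t \<le> 1") (auto simp: one_ereal_def)
  then show ?thesis
  proof cases
    case 1
    then show ?thesis using integrable_on_refl[of "rr \<alpha> x" 0] by (cases "t = 0") auto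
  next
    case 2
    then show ?thesis by (rule rr_integrable_short[OF x])
  next
    case 3
    have "rr \<alpha> x integrable_on {0..1}" using 3 by (intro rr_integrable_short[OF x]) (auto simp: one_ereal_def)
    moreover have "rr \<alpha> x integrable_on {1..t}" by (rule rr_integrable_pos[OF x]) simp
    ultimately show ?thesis using 3 by (intro Henstock_Kurzweil_Integration.integrable_combine[of 0 1 t]) auto
  qed
qed

lemma rr_integrable_Icc: "x \<in> E \<Longrightarrow> 0 \<le> s \<Longrightarrow> rr \<alpha> x integrable_on {s..t}"
  by (rule integrable_subinterval_real[OF rr_integrable[of x t]]) auto

section \<open>The primitive of the rearrangement and its concavity\<close>

lemma Phi_diff: "x \<in> E \<Longrightarrow> 0 \<le> s \<Longrightarrow> s \<le> t \<Longrightarrow> Phi \<alpha> x t - Phi \<alpha> x s = integral {s..t} (rr \<alpha> x)"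
  unfolding Phi_def using Henstock_Kurzweil_Integration.integral_combine[OF _ _ rr_integrable[of x t], of s] by auto

lemma Phi_lower:
  assumes x: "x \<in> E" and st: "0 \<le> s" "s \<le> t"
  shows "(t - s) * rr \<alpha> x t \<le> Phi \<alpha> x t - Phi \<alpha> x s"
proof -
  have "(t - s) * rr \<alpha> x t \<le> integral {s..t} (rr \<alpha> x)"
    using st by (intro integral_lower_bound rr_integrable_Icc x rr_antimono[OF x]) auto
  then show ?thesis using Phi_diff[OF x, of s t] st by simp
qed

lemma Phi_upper:
  assumes x: "x \<in> E" and st: "0 < s" "s \<le> t"
  shows "Phi \<alpha> x t - Phi \<alpha> x s \<le> (t - s) * rr \<alpha> x s"
proof -
  have "integral {s..t} (rr \<alpha> x) \<le> (t - s) * rr \<alpha> x s"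
    using st by (intro integral_upper_bound rr_integrable_Icc x rr_antimono[OF x]) auto
  then show ?thesis using Phi_diff[OF x, of s t] st by simp
qed

lemma Phi_0 [simp]: "Phi \<alpha> x 0 = 0"
  by (simp add: Phi_def)

lemma Phi_mono:
  assumes "x \<in> E" "0 \<le> s" "s \<le> t"
  shows "Phi \<alpha> x s \<le> Phi \<alpha> x t"
proof -
  have "0 \<le> (t - s) * rr \<alpha> x t" using assms by (intro mult_nonneg_nonneg) auto
  then show ?thesis using Phi_lower[OF assms] by linarith
qed

lemma Phi_nonneg: "x \<in> E \<Longrightarrow> 0 \<le> t \<Longrightarrow> 0 \<le> Phi \<alpha> x t"
  using Phi_mono[of x 0 t] by simp

lemma Phi_continuous: "x \<in> E \<Longrightarrow> continuous_on {0..t} (Phi \<alpha> x)"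
  unfolding Phi_def[abs_def] by (intro indefinite_integral_continuous_1 rr_integrable)

lemma maximal_fun_Phi:
  assumes x: "x \<in> E" and t: "0 < t"
  shows "maximal_fun \<alpha> x t = ereal (Phi \<alpha> x t / t)"
proof -
  have "(\<integral>\<^sup>+s\<in>{0..t}. e2ennreal (rearrangement \<alpha> x s) \<partial>lborel) = (\<integral>\<^sup>+s. ennreal (rr \<alpha> x s) * indicator {0..t} s \<partial>lborel)"
  proof (rule nn_integral_cong_AE)
    have "AE s in lborel. s \<noteq> (0::real)" by (rule AE_lborel_singleton)
    then show "AE s in lborel. e2ennreal (rearrangement \<alpha> x s) * indicator {0..t} s = ennreal (rr \<alpha> x s) * indicator {0..t} s"
    proof eventually_elim
      case (elim s)
      show ?case
      proof (cases "0 < s")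
        case True
        then show ?thesis by (simp add: ereal_rr[OF x True, symmetric] e2ennreal_ereal)
      next
        case False
        then show ?thesis using elim by (simp add: indicator_def)
      qed
    qed
  qed
  also have "\<dots> = ennreal (Phi \<alpha> x t)"
    unfolding Phi_def using rr_integrable[OF x, of t]
    by (intro nn_integral_has_integral_lebesgue') (auto simp: has_integral_integral)
  finally show ?thesis
    using t Phi_nonneg[OF x, of t] by (simp add: maximal_fun_def)
qed

lemma submajorized_Phi:
  assumes "y \<in> E" "x \<in> E"
  shows "submajorized \<alpha> y x \<longleftrightarrow> (\<forall>t>0. Phi \<alpha> y t \<le> Phi \<alpha> x t)"
proof -
  have "ereal (Phi \<alpha> y t / t) \<le> ereal (Phi \<alpha> x t / t) \<longleftrightarrow> Phi \<alpha> y t \<le> Phi \<alpha> x t" if "0 < t" for t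
    using that by (simp add: divide_le_cancel)
  then show ?thesis
    unfolding submajorized_def using maximal_fun_Phi assms by auto
qed

end

section \<open>Monotonicity of the norm for submajorization, after Hardy, Littlewood and
  Polya\<close>

lemma flatten_has_integral_mid:
  assumes "a \<le> c" "c \<le> d" "d \<le> b"
  shows "(flatten f a b q has_integral q * (d - c)) {c..d}"
proof (rule has_integral_spike_finite[of "{b}"])
  show "((\<lambda>_. q) has_integral q * (d - c)) {c..d}"
    using has_integral_const_real[of q c d] assms by (simp add: mult.commute)
qed (use assms in \<open>auto simp: flatten_def\<close>)

lemma flatten_has_integral_right:
  assumes "b \<le> c" "f integrable_on {c..d}"
  shows "(flatten f a b q has_integral integral {c..d} f) {c..d}"
  by (rule has_integral_eq[OF _ integrable_integral[OF assms(2)]]) (use assms in \<open>auto simp: flatten_def\<close>)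

lemma flatten_has_integral_left:
  assumes "d \<le> a" "f integrable_on {c..d}"
  shows "(flatten f a b q has_integral integral {c..d} f) {c..d}"
  by (rule has_integral_spike_finite[OF _ _ integrable_integral[OF assms(2)], of "{a}"])
     (use assms in \<open>auto simp: flatten_def\<close>)

lemma flatten_has_integral_mid_right:
  assumes "a \<le> c" "c \<le> b" "b \<le> d" "f integrable_on {b..d}"
  shows "(flatten f a b q has_integral q * (b - c) + integral {b..d} f) {c..d}"
  using has_integral_combine[OF assms(2,3) flatten_has_integral_mid[OF assms(1,2)]
      flatten_has_integral_right[OF _ assms(4)]] by simp

lemma sum_h_upper:
  fixes Z :: "nat \<Rightarrow> real"
  assumes Z: "\<And>i. j \<le> i \<Longrightarrow> Z i \<le> z" and jm: "j \<le> m" and h: "0 \<le> h"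
  shows "h * (\<Sum>i=j..<m. Z i) \<le> z * (real m * h - real j * h)"
proof -
  have "(\<Sum>i=j..<m. Z i) \<le> of_nat (card {j..<m}) * z"
    using Z by (intro sum_bounded_above) auto
  then have "h * (\<Sum>i=j..<m. Z i) \<le> h * ((real m - real j) * z)"
    using h jm by (intro mult_left_mono) auto
  then show ?thesis by (simp add: algebra_simps)
qed

context symmetric_space
begin

text \<open>The state after \<open>j\<close> steps of transforming a decreasing function on \<open>[0, n h)\<close> into one that
  dominates the step function with values \<open>Z 0, Z 1, \<dots>\<close> on intervals of length \<open>h\<close>.\<close>

definition hlp_state :: "(nat \<Rightarrow> real) \<Rightarrow> real \<Rightarrow> nat \<Rightarrow> nat \<Rightarrow> (real \<Rightarrow> real) \<Rightarrow> bool" where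
  "hlp_state Z h n j g \<longleftrightarrow> elem g \<and> g \<in> borel_measurable borel \<and> (\<forall>t\<ge>0. 0 \<le> g t) \<and>
     (\<forall>s t. real j * h < s \<longrightarrow> s \<le> t \<longrightarrow> g t \<le> g s) \<and>
     g integrable_on {real j * h..real n * h} \<and> (\<forall>t\<ge>real n * h. g t = 0) \<and>
     (\<forall>i<j. \<forall>t. real i * h \<le> t \<longrightarrow> t < real (Suc i) * h \<longrightarrow> g t = Z i) \<and>
     (\<forall>m. j \<le> m \<longrightarrow> m \<le> n \<longrightarrow> h * (\<Sum>i=j..<m. Z i) \<le> integral {real j * h..real m * h} g)"

text \<open>Flattening g at height \<open>Z j\<close> on [s, b) is allowed while \<open>D b\<close>
  >= 0. The end b is a zero of D, or T if mass is left over there. Beyond b the function is at most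
  \<open>Z j\<close>, so it stays decreasing. The partial sums remain dominated: up to b because the
  later values of Z are at most \<open>Z j\<close>, and past an interior b because no mass was
  lost.\<close>

lemma hlp_step:
  assumes h: "0 < h" and Z: "\<And>i. 0 \<le> Z i" "\<And>i k. i \<le> k \<Longrightarrow> Z k \<le> Z i"
    and \<alpha>: "ereal (real n * h) \<le> \<alpha>" and jn: "j < n" and g: "hlp_state Z h n j g"
  shows "\<exists>g'. hlp_state Z h n (Suc j) g' \<and> N g' \<le> N g"
proof -
  define s where "s = real j * h"
  define s' where "s' = real (Suc j) * h"
  define T where "T = real n * h"
  have s: "0 \<le> s" "s' = s + h" using h by (auto simp: s_def s'_def algebra_simps)
  have s'T: "s' \<le> T" using jn h unfolding s'_def T_def by (intro mult_right_mono) auto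
  have el: "elem g" and gb: "g \<in> borel_measurable borel" and nn: "\<And>t. 0 \<le> t \<Longrightarrow> 0 \<le> g t"
    and anti: "\<And>p t. s < p \<Longrightarrow> p \<le> t \<Longrightarrow> g t \<le> g p"
    and int: "g integrable_on {s..T}" and zero: "\<And>t. T \<le> t \<Longrightarrow> g t = 0"
    and cell: "\<And>i t. i < j \<Longrightarrow> real i * h \<le> t \<Longrightarrow> t < real (Suc i) * h \<Longrightarrow> g t = Z i"
    and maj: "\<And>m. j \<le> m \<Longrightarrow> m \<le> n \<Longrightarrow> h * (\<Sum>i=j..<m. Z i) \<le> integral {s..real m * h} g"
    using g unfolding hlp_state_def s_def T_def by auto
  define D where "D t = integral {s..t} g - Z j * (t - s)" for t
  have D1: "0 \<le> D s'" using maj[of "Suc j"] jn s(2) by (simp add: D_def s'_def mult.commute)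
  have cont: "continuous_on {s..T} D"
    unfolding D_def using int by (intro continuous_intros indefinite_integral_continuous_1)
  obtain b where b: "s' \<le> b" "b \<le> T" "0 \<le> D b" "b < T \<Longrightarrow> D b = 0"
  proof (cases "0 \<le> D T")
    case True
    then show thesis using s'T by (intro that[of T]) auto
  next
    case False
    have "continuous_on {s'..T} D"
      using cont by (rule continuous_on_subset) (use s h in auto)
    then obtain b where "s' \<le> b" "b \<le> T" "D b = 0"
      using IVT2'[of D T 0 s'] False D1 s'T by auto
    then show thesis by (intro that[of b]) auto
  qed
  have sb: "s < b" "s \<le> s'" using b(1) s h by auto
  have intc: "g integrable_on {c..d}" if "s \<le> c" "d \<le> T" for c d
    using that by (intro integrable_subinterval_real[OF int]) auto
  let ?g' = "flatten g s b (Z j)"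
  have b\<alpha>: "ereal b \<le> \<alpha>" using b(2) \<alpha> unfolding T_def by (metis ereal_less_eq(3) order_trans)
  have Db: "Z j * (b - s) \<le> integral {s..b} g" using b(3) by (simp add: D_def)
  have el': "elem ?g'" "N ?g' \<le> N g"
    using flatten_norm[OF el gb nn s(1) sb(1) b\<alpha> anti intc[OF order_refl b(2)] Z(1) Db] by auto
  have gZ: "g t \<le> Z j" if t: "b \<le> t" for t
  proof (cases "b < T")
    case True
    have "(b - s) * g t \<le> integral {s..b} g"
      using sb b(2) t by (intro integral_lower_bound intc anti) auto
    also have "\<dots> = (b - s) * Z j" using b(4)[OF True] by (simp add: D_def)
    finally show ?thesis using sb by simp
  next
    case False
    then show ?thesis using zero[of t] t b(2) Z(1)[of j] by auto
  qed
  have "hlp_state Z h n (Suc j) ?g'"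
    unfolding hlp_state_def s'_def[symmetric] T_def[symmetric]
  proof (intro conjI allI impI)
    show "elem ?g'" by (rule el')
    show "?g' \<in> borel_measurable borel" by (intro flatten_borel gb)
    show "0 \<le> ?g' t" if "0 \<le> t" for t using that nn Z(1) by (auto simp: flatten_def)
    show "?g' t \<le> ?g' p" if "s' < p" "p \<le> t" for p t
      using that gZ[of t] anti[of p t] sb by (auto simp: flatten_def)
    show "?g' integrable_on {s'..T}"
      by (rule has_integral_integrable[OF flatten_has_integral_mid_right[OF sb(2) b(1,2) intc]]) (use sb in auto)
    show "?g' t = 0" if "T \<le> t" for t using that zero b(2) by (auto simp: flatten_def)
    show "?g' t = Z i" if i: "i < Suc j" "real i * h \<le> t" "t < real (Suc i) * h" for i t
    proof (cases "i = j")
      case True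
      then show ?thesis using i b(1) by (auto simp: flatten_def s_def s'_def)
    next
      case False
      then have "real (Suc i) * h \<le> s" using i h unfolding s_def by (intro mult_right_mono) auto
      then show ?thesis using i False cell[of i t] by (auto simp: flatten_def)
    qed
    fix m assume m: "Suc j \<le> m" "m \<le> n"
    define p where "p = real m * h"
    have p: "s' \<le> p" "p \<le> T" using m h unfolding s'_def p_def T_def by (auto intro: mult_right_mono)
    show "h * (\<Sum>i=Suc j..<m. Z i) \<le> integral {s'..real m * h} ?g'"
      unfolding p_def[symmetric]
    proof (cases "p \<le> b")
      case True
      have "integral {s'..p} ?g' = Z j * (p - s')"
        by (rule integral_unique[OF flatten_has_integral_mid[OF sb(2) p(1) True]])
      then show "h * (\<Sum>i=Suc j..<m. Z i) \<le> integral {s'..p} ?g'"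
        using sum_h_upper[of "Suc j" Z "Z j" m h] Z(2) m(1) h unfolding p_def s'_def by simp
    next
      case False
      then have bp: "b \<le> p" "b < T" using p by auto
      have "integral {s'..p} ?g' = Z j * (b - s') + integral {b..p} g"
        by (rule integral_unique[OF flatten_has_integral_mid_right[OF sb(2) b(1) bp(1) intc]]) (use sb p in auto)
      moreover have "integral {s..p} g = integral {s..b} g + integral {b..p} g"
        using sb bp p by (intro Henstock_Kurzweil_Integration.integral_combine[symmetric] intc) auto
      moreover have "integral {s..b} g = Z j * (b - s)" using b(4)[OF bp(2)] by (simp add: D_def)
      moreover have "h * (\<Sum>i=j..<m. Z i) \<le> integral {s..p} g" using maj[of m] m by (simp add: p_def)
      moreover have "(\<Sum>i=j..<m. Z i) = Z j + (\<Sum>i=Suc j..<m. Z i)"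
        using m by (intro sum.atLeast_Suc_lessThan) auto
      ultimately show "h * (\<Sum>i=Suc j..<m. Z i) \<le> integral {s'..p} ?g'"
        using s(2) by (simp add: algebra_simps)
    qed
  qed
  with el'(2) show ?thesis by blast
qed

lemma hlp_steps:
  assumes h: "0 < h" and Z: "\<And>i. 0 \<le> Z i" "\<And>i k. i \<le> k \<Longrightarrow> Z k \<le> Z i"
    and \<alpha>: "ereal (real n * h) \<le> \<alpha>" and g: "hlp_state Z h n 0 g"
  shows "\<exists>g'. hlp_state Z h n n g' \<and> N g' \<le> N g"
proof -
  have "\<exists>g'. hlp_state Z h n j g' \<and> N g' \<le> N g" if "j \<le> n" for j
    using that
  proof (induction j)
    case 0
    then show ?case using g by auto
  next
    case (Suc j)
    then obtain g1 where g1: "hlp_state Z h n j g1" "N g1 \<le> N g" by auto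
    from hlp_step[OF h Z \<alpha> _ g1(1)] Suc.prems obtain g2
      where "hlp_state Z h n (Suc j) g2" "N g2 \<le> N g1" by auto
    with g1(2) show ?case by (meson order_trans)
  qed
  then show ?thesis by simp
qed

text \<open>Each dyadic cell carries the value of z* at its right end. Hence the step function lies
  below z*, and refining the cells increases it, as an application of the Fatou property
  requires.\<close>

definition step_approx :: "(real \<Rightarrow> ereal) \<Rightarrow> nat \<Rightarrow> nat \<Rightarrow> real \<Rightarrow> real" where
  "step_approx z k n t =
     (if 0 \<le> t \<and> t < real n / 2 ^ k then rr \<alpha> z ((of_int \<lfloor>t * 2 ^ k\<rfloor> + 1) / 2 ^ k) else 0)"

lemma step_approx_borel: "step_approx z k n \<in> borel_measurable borel"
  unfolding step_approx_def[abs_def] by measurable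

lemma step_sum_le_Phi:
  assumes z: "z \<in> E" and h: "0 < h"
  shows "h * (\<Sum>i<m. rr \<alpha> z (real (Suc i) * h)) \<le> Phi \<alpha> z (real m * h)"
proof (induction m)
  case (Suc m)
  have "(real (Suc m) * h - real m * h) * rr \<alpha> z (real (Suc m) * h) \<le>
      Phi \<alpha> z (real (Suc m) * h) - Phi \<alpha> z (real m * h)"
    using h by (intro Phi_lower[OF z]) auto
  moreover have "real (Suc m) * h - real m * h = h" by (simp add: algebra_simps)
  ultimately show ?case using Suc by (simp add: distrib_left)
qed simp

text \<open>The transformation starts from y* cut off at n h. The initial state is legitimate
  because the step sums of z* are at most \<Phi>_z, hence at most \<Phi>_y; after n steps every cell
  carries the value of the step function.\<close>

lemma step_approx_norm:
  assumes z: "z \<in> E" and y: "y \<in> E" and maj: "\<And>t. 0 < t \<Longrightarrow> Phi \<alpha> z t \<le> Phi \<alpha> y t"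
    and n: "ereal (real n / 2 ^ k) \<le> \<alpha>"
  shows "elem (step_approx z k n)" "N (step_approx z k n) \<le> nrm y"
proof -
  define h :: real where "h = 1 / 2 ^ k"
  have h: "0 < h" by (simp add: h_def)
  have nh: "real n / 2 ^ k = real n * h" by (simp add: h_def)
  define Z where "Z i = rr \<alpha> z (real (Suc i) * h)" for i :: nat
  have Z: "0 \<le> Z i" for i by (simp add: Z_def)
  have Z2: "Z j \<le> Z i" if "i \<le> j" for i j
    unfolding Z_def using that h by (intro rr_antimono[OF z]) auto
  let ?T = "real n * h"
  define f where "f t = (if t < ?T then rr \<alpha> y t else 0)" for t
  have fb: "f \<in> borel_measurable borel" unfolding f_def[abs_def] by measurable
  have f: "elem f" "N f \<le> nrm y"
    using elem_ideal[OF measurable_I_borel[OF fb] elem_rr(1)[OF y]] elem_rr(2)[OF y]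
    by (auto simp: f_def)
  have fint: "(f has_integral Phi \<alpha> y c) {0..c}" if c: "c \<le> ?T" for c
    unfolding Phi_def
    by (rule has_integral_spike_finite[OF _ _ integrable_integral[OF rr_integrable[OF y]], of "{?T}"])
       (use c in \<open>auto simp: f_def\<close>)
  have maj0: "h * (\<Sum>i<m. Z i) \<le> Phi \<alpha> y (real m * h)" for m
  proof (cases "m = 0")
    case False
    then have "Phi \<alpha> z (real m * h) \<le> Phi \<alpha> y (real m * h)" using h by (intro maj) simp
    then show ?thesis using step_sum_le_Phi[OF z h, of m] unfolding Z_def by linarith
  qed simp
  have "hlp_state Z h n 0 f"
    unfolding hlp_state_def
  proof (intro conjI allI impI)
    show "elem f" by (rule f)
    show "f \<in> borel_measurable borel" by (rule fb)
    show "0 \<le> f t" for t by (simp add: f_def)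
    show "f t \<le> f s" if "real 0 * h < s" "s \<le> t" for s t
      using that rr_antimono[OF y, of s t] by (auto simp: f_def)
    show "f integrable_on {real 0 * h..?T}" using has_integral_integrable[OF fint[OF order_refl]] by simp
    show "f t = 0" if "?T \<le> t" for t using that by (simp add: f_def)
    fix m assume "m \<le> n"
    then have "real m * h \<le> ?T" using h by (intro mult_right_mono) auto
    from integral_unique[OF fint[OF this]] maj0[of m]
    show "h * (\<Sum>i=0..<m. Z i) \<le> integral {real 0 * h..real m * h} f"
      by (simp add: lessThan_atLeast0)
  qed auto
  then obtain g where g: "hlp_state Z h n n g" "N g \<le> N f"
    using hlp_steps[where Z = Z and n = n and g = f, OF h Z Z2] n unfolding nh by blast
  have el: "elem g" and cell: "\<And>i t. i < n \<Longrightarrow> real i * h \<le> t \<Longrightarrow> t < real (Suc i) * h \<Longrightarrow> g t = Z i"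
    using g(1) unfolding hlp_state_def by auto
  have le: "\<bar>step_approx z k n t\<bar> \<le> \<bar>g t\<bar>" for t
  proof (cases "0 \<le> t \<and> t < ?T")
    case True
    define i where "i = nat \<lfloor>t * 2 ^ k\<rfloor>"
    have ri: "real i = of_int \<lfloor>t * 2 ^ k\<rfloor>" using True by (simp add: i_def)
    have "real i \<le> t * 2 ^ k" "t * 2 ^ k < real i + 1" unfolding ri by linarith+
    then have it: "real i * h \<le> t" "t < real (Suc i) * h" by (auto simp: h_def field_simps)
    then have "real i * h < real n * h" using True by linarith
    then have "i < n" using h by simp
    then have "g t = Z i" using it by (rule cell)
    moreover have "step_approx z k n t = Z i"
      using True unfolding step_approx_def nh Z_def ri[symmetric] by (simp add: h_def add.commute)
    ultimately show ?thesis by simp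
  next
    case False
    then show ?thesis unfolding step_approx_def nh by auto
  qed
  have "step_approx z k n \<in> borel_measurable (I_measure \<alpha>)"
    by (intro measurable_I_borel step_approx_borel)
  from elem_ideal[OF this el le] g(2) f(2)
  show "elem (step_approx z k n)" "N (step_approx z k n) \<le> nrm y" by auto
qed

text \<open>The dyadic step functions increase almost everywhere to z*, by right continuity, so the
  Fatou property transfers their common bound to z.\<close>

lemma submajorized_norm:
  assumes fatou: "fatou_property \<alpha> E nrm" and z: "z \<in> E" and y: "y \<in> E" and maj: "submajorized \<alpha> z y"
  shows "nrm z \<le> nrm y"
proof -
  have maj': "\<And>t. 0 < t \<Longrightarrow> Phi \<alpha> z t \<le> Phi \<alpha> y t" using submajorized_Phi[OF z y] maj by auto
  \<comment> \<open>The cells of length 1 / 2^k fill [0, 1) if \<alpha> = 1 and [0, 2^k) otherwise;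
    the latter intervals exhaust the half-line.\<close>
  define n where "n k = (if \<alpha> = 1 then 2 ^ k else 4 ^ k :: nat)" for k :: nat
  have four: "(4::real) ^ k = 2 ^ k * 2 ^ k" for k by (simp flip: power_mult_distrib)
  have nT: "real (n k) / 2 ^ k = (if \<alpha> = 1 then 1 else 2 ^ k)" for k
    by (simp add: n_def four)
  have n\<alpha>: "ereal (real (n k) / 2 ^ k) \<le> \<alpha>" for k
    unfolding nT using alpha by (auto simp: one_ereal_def)
  define X where "X k t = ereal (step_approx z k (n k) t)" for k t
  have X: "X k \<in> E" "nrm (X k) \<le> nrm y" for k
    using step_approx_norm[OF z y maj' n\<alpha>[of k]] by (auto simp: X_def[abs_def] elem_def N_def)
  \<comment> \<open>The right end of the dyadic cell containing t, which decreases to t as k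
    grows.\<close>
  let ?p = "\<lambda>(t::real) k. (of_int \<lfloor>t * 2 ^ k\<rfloor> + 1) / 2 ^ k :: real"
  have p1: "t < ?p t k" "?p t k \<le> t + 1 / 2 ^ k" for t k
    by (simp_all add: field_simps) linarith+
  have p2: "?p t (Suc k) \<le> ?p t k" for t k
  proof -
    have "\<lfloor>t * 2 ^ Suc k\<rfloor> + 1 \<le> 2 * (\<lfloor>t * 2 ^ k\<rfloor> + 1)"
    proof -
      have "\<lfloor>2 * a\<rfloor> < 2 * (\<lfloor>a\<rfloor> + 1)" for a :: real
      proof -
        have "2 * a < 2 * real_of_int (\<lfloor>a\<rfloor> + 1)"
          using conjunct2[OF floor_correct[of a]] by (intro mult_strict_left_mono) simp_all
        then show ?thesis by (simp only: floor_less_iff of_int_mult of_int_numeral)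
      qed
      from this[of "t * 2 ^ k"] show ?thesis by (simp add: mult.left_commute)
    qed
    then have "real_of_int (\<lfloor>t * 2 ^ Suc k\<rfloor> + 1) \<le> real_of_int (2 * (\<lfloor>t * 2 ^ k\<rfloor> + 1))"
      by (simp only: of_int_le_iff)
    then have "real_of_int (\<lfloor>t * 2 ^ Suc k\<rfloor> + 1) / 2 ^ Suc k \<le>
        real_of_int (2 * (\<lfloor>t * 2 ^ k\<rfloor> + 1)) / 2 ^ Suc k"
      by (rule divide_right_mono) simp
    also have "\<dots> = ?p t k" by (simp add: add_divide_distrib)
    finally show ?thesis by simp
  qed
  have inc: "incseq (\<lambda>k. X k t)" if t: "0 < t" for t
  proof (rule incseq_SucI)
    fix k
    have "rr \<alpha> z (?p t k) \<le> rr \<alpha> z (?p t (Suc k))"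
      using p1(1)[of t "Suc k"] p2[of t k] t by (intro rr_antimono[OF z]) auto
    moreover have "real (n k) / 2 ^ k \<le> real (n (Suc k)) / 2 ^ Suc k" unfolding nT by simp
    ultimately show "X k t \<le> X (Suc k) t" unfolding X_def step_approx_def by auto
  qed
  have lim: "(\<lambda>k. X k t) \<longlonglongrightarrow> ereal (rr \<alpha> z t)" if t: "t \<in> ival \<alpha>" "0 < t" for t
  proof -
    have "eventually (\<lambda>k. t < real (n k) / 2 ^ k) sequentially"
    proof (cases "\<alpha> = 1")
      case True
      then show ?thesis unfolding nT using t by (auto simp: ival_def one_ereal_def)
    next
      case False
      obtain m where m: "t < 2 ^ m" using real_arch_pow[of 2 t] by auto
      have "t < 2 ^ k" if "m \<le> k" for k
        by (rule less_le_trans[OF m power_increasing[OF that]]) simp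
      then show ?thesis unfolding nT using False by (auto simp: eventually_sequentially)
    qed
    then have ev: "eventually (\<lambda>k. step_approx z k (n k) t = rr \<alpha> z (?p t k)) sequentially"
      by eventually_elim (use t in \<open>simp add: step_approx_def\<close>)
    have "(\<lambda>k. rr \<alpha> z (?p t k)) \<longlonglongrightarrow> rr \<alpha> z t"
    proof (rule order_tendstoI)
      fix l assume l: "l < rr \<alpha> z t"
      show "eventually (\<lambda>k. l < rr \<alpha> z (?p t k)) sequentially"
      proof (cases "0 \<le> l")
        case True
        obtain s where s: "t < s" "l < rr \<alpha> z s" using rr_right_cont[OF z t(2) l True] by auto
        have "(\<lambda>k. t + 1 / 2 ^ k) \<longlonglongrightarrow> t + 0"
          using LIMSEQ_inverse_realpow_zero[of 2] by (intro tendsto_intros) (simp add: inverse_eq_divide)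
        then have "eventually (\<lambda>k. t + 1 / 2 ^ k < s) sequentially"
          using s by (intro order_tendstoD) auto
        then show ?thesis
        proof eventually_elim
          case (elim k)
          then have "rr \<alpha> z s \<le> rr \<alpha> z (?p t k)"
            using p1[of t k] t by (intro rr_antimono[OF z]) auto
          then show ?case using s by simp
        qed
      next
        case False
        then have "l < rr \<alpha> z (?p t k)" for k using rr_nonneg[of \<alpha> z "?p t k"] by linarith
        then show ?thesis by simp
      qed
    next
      fix l assume l: "rr \<alpha> z t < l"
      have "rr \<alpha> z (?p t k) \<le> rr \<alpha> z t" for k
        using p1(1)[of t k] t by (intro rr_antimono[OF z]) auto
      then show "eventually (\<lambda>k. rr \<alpha> z (?p t k) < l) sequentially"
        using l by (intro always_eventually allI) (rule le_less_trans)
    qed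
    then have "(\<lambda>k. step_approx z k (n k) t) \<longlonglongrightarrow> rr \<alpha> z t"
      using ev by (subst tendsto_cong)
    then show ?thesis unfolding X_def by simp
  qed
  have "AE t in I_measure \<alpha>. incseq (\<lambda>k. X k t) \<and> (\<lambda>k. X k t) \<longlonglongrightarrow> ereal (rr \<alpha> z t)"
    using AE_I_pos AE_space by eventually_elim (use inc lim in auto)
  moreover have "bdd_above (range (\<lambda>k. nrm (X k)))" using X(2) by (intro bdd_aboveI2)
  moreover have "(\<lambda>t. ereal (rr \<alpha> z t)) \<in> L0 \<alpha>"
    using elem_rr(1)[OF z] subset_L0 by (auto simp: elem_def)
  moreover have "\<forall>k. X k \<in> E \<and> (AE t in I_measure \<alpha>. 0 \<le> X k t)"
    using X(1) by (simp add: X_def step_approx_def)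
  ultimately have "(\<lambda>k. nrm (X k)) \<longlonglongrightarrow> nrm (\<lambda>t. ereal (rr \<alpha> z t))"
    using fatou unfolding fatou_property_def by meson
  then have "(\<lambda>k. nrm (X k)) \<longlonglongrightarrow> nrm z"
    using elem_rr(2)[OF z] by (simp add: N_def)
  then show ?thesis using X(2) by (intro LIMSEQ_le_const2) auto
qed

end

section \<open>Convergence in measure\<close>

text \<open>Convergence almost everywhere controls the measure only on sets of finite measure. The
  hypothesis \<open>tail\<close> confines the exceptional sets to [0, T), where dominated
  convergence applies to their indicators.\<close>

lemma tendsto_emeasure_of_AE:
  fixes F :: "nat \<Rightarrow> real \<Rightarrow> real"
  assumes F: "\<And>n. F n \<in> borel_measurable (I_measure \<alpha>)" "f \<in> borel_measurable (I_measure \<alpha>)"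
    and lim: "AE t in I_measure \<alpha>. (\<lambda>n. F n t) \<longlonglongrightarrow> f t"
    and tail: "\<exists>T. eventually (\<lambda>n. \<forall>t\<in>ival \<alpha>. T \<le> t \<longrightarrow> \<bar>F n t - f t\<bar> \<le> e) sequentially"
    and e: "0 < e"
  shows "(\<lambda>n. emeasure (I_measure \<alpha>) {t \<in> ival \<alpha>. e < \<bar>F n t - f t\<bar>}) \<longlonglongrightarrow> 0"
proof -
  let ?I = "I_measure \<alpha>"
  note [measurable] = F
  have id[measurable]: "(\<lambda>t. t) \<in> borel_measurable ?I" by (intro measurable_I_borel) simp
  obtain T where T: "eventually (\<lambda>n. \<forall>t\<in>ival \<alpha>. T \<le> t \<longrightarrow> \<bar>F n t - f t\<bar> \<le> e) sequentially"
    using tail by auto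
  define A where "A n = {t \<in> space ?I. t < T \<and> e < \<bar>F n t - f t\<bar>}" for n
  have A[measurable]: "A n \<in> sets ?I" for n unfolding A_def by measurable
  have W: "{t \<in> space ?I. t < T} \<in> sets ?I" by measurable
  have "(\<lambda>n. \<integral>\<^sup>+t. indicator (A n) t \<partial>?I) \<longlonglongrightarrow> (\<integral>\<^sup>+t. 0 \<partial>?I)"
  proof (rule nn_integral_dominated_convergence[where w = "indicator {t \<in> space ?I. t < T}"])
    show "AE t in ?I. indicator (A n) t \<le> (indicator {t \<in> space ?I. t < T} t :: ennreal)" for n
      by (intro AE_I2) (auto simp: indicator_def A_def)
    have "(\<integral>\<^sup>+t. indicator {t \<in> space ?I. t < T} t \<partial>?I) = emeasure lebesgue {t \<in> ival \<alpha>. t < T}"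
      using W by (simp add: emeasure_I)
    also have "\<dots> \<le> emeasure lebesgue {0..<T}" by (intro emeasure_mono) (auto simp: ival_def)
    also have "\<dots> < \<infinity>" by (cases "0 \<le> T") auto
    finally show "(\<integral>\<^sup>+t. indicator {t \<in> space ?I. t < T} t \<partial>?I) < \<infinity>" .
    show "AE t in ?I. (\<lambda>n. indicator (A n) t :: ennreal) \<longlonglongrightarrow> 0"
      using lim
    proof eventually_elim
      case (elim t)
      have "eventually (\<lambda>n. dist (F n t) (f t) < e) sequentially" using elim e by (rule tendstoD)
      then have "eventually (\<lambda>n. indicator (A n) t = (0::ennreal)) sequentially"
        by eventually_elim (auto simp: A_def indicator_def dist_real_def)
      then show ?case by (rule tendsto_eventually)
    qed
  qed (use W in \<open>simp_all add: borel_measurable_indicator\<close>)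
  then have lim0: "(\<lambda>n. emeasure ?I (A n)) \<longlonglongrightarrow> 0" by simp
  have "eventually (\<lambda>n. A n = {t \<in> ival \<alpha>. e < \<bar>F n t - f t\<bar>}) sequentially"
    using T by eventually_elim (force simp: A_def)
  then have "eventually (\<lambda>n. emeasure ?I (A n) = emeasure ?I {t \<in> ival \<alpha>. e < \<bar>F n t - f t\<bar>}) sequentially"
    by eventually_elim simp
  from tendsto_cong[OF this] lim0 show ?thesis by blast
qed

lemma tendsto_in_measure_real_iff:
  assumes Y: "\<And>n. Y n \<in> borel_measurable (I_measure \<alpha>)" "y \<in> borel_measurable (I_measure \<alpha>)"
    and F: "\<And>n. F n \<in> borel_measurable (I_measure \<alpha>)" "f \<in> borel_measurable (I_measure \<alpha>)"
    and eq: "\<And>n. AE t in I_measure \<alpha>. Y n t = ereal (F n t)" "AE t in I_measure \<alpha>. y t = ereal (f t)"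
  shows "tendsto_in_measure \<alpha> Y y \<longleftrightarrow>
     (\<forall>e>0. (\<lambda>n. emeasure (I_measure \<alpha>) {t \<in> ival \<alpha>. e < \<bar>F n t - f t\<bar>}) \<longlonglongrightarrow> 0)"
proof -
  let ?I = "I_measure \<alpha>"
  note [measurable] = F Y
  have "emeasure ?I {t \<in> space ?I. ereal e < \<bar>Y n t - y t\<bar>} = emeasure ?I {t \<in> space ?I. e < \<bar>F n t - f t\<bar>}" for n e
  proof (rule emeasure_eq_AE)
    show "AE t in ?I. (t \<in> {t \<in> space ?I. ereal e < \<bar>Y n t - y t\<bar>}) = (t \<in> {t \<in> space ?I. e < \<bar>F n t - f t\<bar>})"
      using eq(1)[of n] eq(2) by eventually_elim simp
  qed measurable
  then show ?thesis unfolding tendsto_in_measure_def by simp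
qed

text \<open>Nested superlevel sets of equal finite measure differ by a null set, and rational levels
  exhaust {f < g}. This upgrades the one-sided inequality delivered by Ryff's map to an
  equality.\<close>

lemma AE_eq_of_equal_distr:
  fixes f g :: "real \<Rightarrow> real"
  assumes [measurable]: "f \<in> borel_measurable M" "g \<in> borel_measurable M"
    and fg: "\<And>t. t \<in> space M \<Longrightarrow> 0 \<le> f t \<and> f t \<le> g t"
    and eq: "\<And>l. 0 < l \<Longrightarrow> emeasure M {t \<in> space M. l < f t} = emeasure M {t \<in> space M. l < g t}"
    and fin: "\<And>l. 0 < l \<Longrightarrow> emeasure M {t \<in> space M. l < g t} < \<infinity>"
  shows "AE t in M. f t = g t"
proof -
  have null: "AE t in M. \<not> (f t \<le> l \<and> l < g t)" if l: "0 < l" for l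
  proof -
    have "emeasure M ({t \<in> space M. l < g t} - {t \<in> space M. l < f t}) =
        emeasure M {t \<in> space M. l < g t} - emeasure M {t \<in> space M. l < f t}"
    proof (rule emeasure_Diff)
      show "emeasure M {t \<in> space M. l < f t} \<noteq> \<infinity>" using fin[OF l] eq[OF l] by simp
      show "{t \<in> space M. l < f t} \<subseteq> {t \<in> space M. l < g t}" using fg by force
    qed measurable
    also have "\<dots> = 0" unfolding eq[OF l] using fin[OF l] by (intro ennreal_diff_self) auto
    also have "{t \<in> space M. l < g t} - {t \<in> space M. l < f t} = {t \<in> space M. \<not> \<not> (f t \<le> l \<and> l < g t)}"
      by auto
    finally show ?thesis by (subst AE_iff_measurable[OF _ refl]) measurable
  qed
  have "AE t in M. \<forall>q\<in>\<rat>. 0 < q \<longrightarrow> \<not> (f t \<le> q \<and> q < g t)"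
    unfolding AE_ball_countable[OF countable_rat]
  proof
    fix q :: real
    show "AE t in M. 0 < q \<longrightarrow> \<not> (f t \<le> q \<and> q < g t)"
      using null[of q] by (cases "0 < q") auto
  qed
  then show ?thesis
    using AE_space
  proof eventually_elim
    case (elim t)
    show ?case
    proof (rule ccontr)
      assume "f t \<noteq> g t"
      then have "f t < g t" using fg[OF elim(2)] by simp
      then obtain q where "q \<in> \<rat>" "f t < q" "q < g t" using Rats_dense_in_real by blast
      then show False using elim(1) fg[OF elim(2)] by force
    qed
  qed
qed

section \<open>Vanishing at infinity, and cutting the primitive by a line\<close>

context symmetric_space
begin

text \<open>The form of x*(\<infinity>) = 0 that covers both intervals; for \<alpha> = 1 it holds
  because x* is zero from 1 on.\<close>

definition vanishing :: "(real \<Rightarrow> ereal) \<Rightarrow> bool" where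
  "vanishing x \<longleftrightarrow> (\<forall>e>0. \<exists>T>0. \<forall>t\<ge>T. rr \<alpha> x t \<le> e)"

lemma vanishing_of_limit:
  assumes x: "x \<in> E" and lim: "rearrangement_at_infinity \<alpha> x = 0"
  shows "vanishing x"
  unfolding vanishing_def
proof (intro allI impI)
  fix e :: real assume e: "0 < e"
  show "\<exists>T>0. \<forall>t\<ge>T. rr \<alpha> x t \<le> e"
  proof (cases "\<alpha> = \<infinity>")
    case False
    then have "rr \<alpha> x t \<le> e" if "1 \<le> t" for t
      using rr_outside[OF x, of t] that alpha e by (auto simp: ival_def one_ereal_def)
    then show ?thesis by (intro exI[of _ 1]) auto
  next
    case True
    let ?f = "rearrangement \<alpha> x"
    \<comment> \<open>\<open>Lim\<close> is informative only once a limit is known to exist. A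
      decreasing function converges to its infimum.\<close>
    have "(?f \<longlongrightarrow> (INF t. ?f t)) at_top"
    proof (rule order_tendstoI)
      fix a assume "a < (INF t. ?f t)"
      then have "a < ?f t" for t by (meson INF_lower UNIV_I less_le_trans)
      then show "eventually (\<lambda>t. a < ?f t) at_top" by simp
    next
      fix a assume "(INF t. ?f t) < a"
      then obtain t0 where t0: "?f t0 < a" by (auto simp: INF_less_iff)
      have "?f t < a" if "t0 \<le> t" for t
        using rearrangement_antimono[OF that, of \<alpha> x] t0 by (rule le_less_trans)
      then show "eventually (\<lambda>t. ?f t < a) at_top" by (auto simp: eventually_at_top_linorder)
    qed
    moreover from this have "(INF t. ?f t) = 0"
      using lim True tendsto_Lim[of "at_top :: real filter" ?f]
      by (simp add: rearrangement_at_infinity_def)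
    ultimately have "eventually (\<lambda>t. ?f t < ereal e) at_top"
      using e by (intro order_tendstoD(2)) auto
    then obtain T where T: "\<And>t. T \<le> t \<Longrightarrow> ?f t < ereal e" by (auto simp: eventually_at_top_linorder)
    have "rr \<alpha> x t \<le> e" if "max T 1 \<le> t" for t
    proof -
      have "ereal (rr \<alpha> x t) < ereal e" using T[of t] ereal_rr[OF x, of t] that by simp
      then show ?thesis by simp
    qed
    then show ?thesis by (intro exI[of _ "max T 1"]) auto
  qed
qed

text \<open>From T on, \<Phi>_x grows with slope at most e/2, and the initial amount \<Phi>_x(T) is
  absorbed as soon as t >= 2 \<Phi>_x(T) / e.\<close>

lemma Phi_sublinear:
  assumes x: "x \<in> E" and v: "vanishing x" and e: "0 < e"
  shows "\<exists>T>0. \<forall>t\<ge>T. Phi \<alpha> x t \<le> e * t"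
proof -
  obtain T where T: "0 < T" "\<And>t. T \<le> t \<Longrightarrow> rr \<alpha> x t \<le> e / 2"
    using v e unfolding vanishing_def by (meson half_gt_zero)
  have "Phi \<alpha> x t \<le> e * t" if t: "max T (2 * Phi \<alpha> x T / e) \<le> t" for t
  proof -
    have "Phi \<alpha> x t - Phi \<alpha> x T \<le> (t - T) * rr \<alpha> x T" using T t by (intro Phi_upper[OF x]) auto
    also have "\<dots> \<le> (t - T) * (e / 2)" using T t by (intro mult_left_mono) auto
    also have "\<dots> \<le> t * (e / 2)" using T e by (intro mult_right_mono) auto
    finally have 1: "Phi \<alpha> x t \<le> Phi \<alpha> x T + t * (e / 2)" by simp
    have "2 * Phi \<alpha> x T / e \<le> t" using t by simp
    then have "Phi \<alpha> x T \<le> t * (e / 2)" using e by (simp add: field_simps)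
    with 1 show ?thesis by (simp add: algebra_simps)
  qed
  then show ?thesis using T(1) by (intro exI[of _ "max T (2 * Phi \<alpha> x T / e)"]) auto
qed

lemma Phi_beyond:
  assumes z: "z \<in> E" and b: "0 < b" "b \<notin> ival \<alpha>" "b \<le> t"
  shows "Phi \<alpha> z t = Phi \<alpha> z b"
  using Phi_upper[OF z b(1,3)] Phi_mono[OF z _ b(3)] rr_outside[OF z _ b(2)] b(1) by simp

text \<open>\<open>left\<close> and \<open>right\<close> place q between the values of x* on the two
  sides of [a, b), so the flattened function is still decreasing and right continuous.\<close>

lemma flatten_rearrangement:
  assumes x: "x \<in> E" and ab: "0 \<le> a" "a < b" "ereal b \<le> \<alpha>" and q: "0 < q"
    and left: "0 < a \<Longrightarrow> q \<le> rr \<alpha> x a" and right: "rr \<alpha> x b \<le> q"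
    and y: "y = (\<lambda>t. if a \<le> t \<and> t < b then ereal q else rearrangement \<alpha> x t)" and t: "0 \<le> t"
  shows "rearrangement \<alpha> y t = y t"
proof (rule rearrangement_of_decreasing)
  show "y \<in> L0 \<alpha>" unfolding y L0_def by (intro measurable_I_borel) measurable
  have left': "ereal q \<le> rearrangement \<alpha> x s" if "0 \<le> s" "s < a" for s
  proof -
    have "ereal q \<le> ereal (rr \<alpha> x a)" using left that by simp
    also have "\<dots> = rearrangement \<alpha> x a" using that by (intro ereal_rr[OF x]) simp
    also have "\<dots> \<le> rearrangement \<alpha> x s" using that by (intro rearrangement_antimono) simp
    finally show ?thesis .
  qed
  have right': "rearrangement \<alpha> x s \<le> ereal q" if "b \<le> s" for s
  proof -
    have "rearrangement \<alpha> x s \<le> rearrangement \<alpha> x b" using that by (rule rearrangement_antimono)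
    also have "\<dots> = ereal (rr \<alpha> x b)" using ab by (intro ereal_rr[OF x, symmetric]) simp
    also have "\<dots> \<le> ereal q" using right by simp
    finally show ?thesis .
  qed
  show "y t \<le> y s" if st: "0 \<le> s" "s \<le> t" for s t
    using left'[of s] right'[of t] rearrangement_antimono[OF st(2), of \<alpha> x] st
    by (auto simp: y)
  show "0 \<le> y t" for t using q by (auto simp: y)
  show "\<exists>s>t. ereal l < y s" if t: "0 \<le> t" and l: "0 \<le> l" "ereal l < y t" for t l
  proof (cases "a \<le> t \<and> t < b")
    case True
    then show ?thesis using l by (intro exI[of _ "(t + b) / 2"]) (auto simp: y)
  next
    case False
    then have "ereal l < rearrangement \<alpha> x t" using l(2) by (auto simp: y)
    then obtain s where s: "t < s" "ereal l < rearrangement \<alpha> x s"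
      using rearrangement_right_cont[OF in_L0[OF x] t _ l(1)] by blast
    show ?thesis
    proof (cases "t < a")
      case True
      \<comment> \<open>The witness must stay left of a, where y still agrees with x*.\<close>
      have "rearrangement \<alpha> x s \<le> rearrangement \<alpha> x (min s ((t + a) / 2))"
        by (rule rearrangement_antimono) simp
      then have "ereal l < rearrangement \<alpha> x (min s ((t + a) / 2))" using s(2) by simp
      then show ?thesis using True s(1) by (intro exI[of _ "min s ((t + a) / 2)"]) (auto simp: y min_def)
    next
      case f: False
      then show ?thesis using False s by (intro exI[of _ s]) (auto simp: y)
    qed
  qed
  show "y t = 0" if t: "0 \<le> t" "t \<notin> ival \<alpha>" for t
  proof -
    have "\<alpha> \<le> ereal t" using t by (simp add: ival_def)
    then have "b \<le> t" using ab(3) by (meson ereal_less_eq(3) order_trans)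
    then show ?thesis using rearrangement_outside[OF in_L0[OF x] t] by (simp add: y)
  qed
qed (fact t)

text \<open>Replacing the concave function \<open>\<Phi>\<^sub>x\<close> by its minimum with a line yields the primitive of a
  decreasing function, obtained from \<open>x\<^sup>*\<close> by flattening it on the interval where \<open>\<Phi>\<^sub>x\<close> lies above
  the line.\<close>

lemma cut_by_line:
  assumes x: "x \<in> E" and v: "vanishing x" and t0: "t0 \<in> ival \<alpha>" "0 < t0"
    and p: "0 \<le> p" and q: "0 < q" and less: "p + q * t0 < Phi \<alpha> x t0"
  obtains y where "y \<in> E" "submajorized \<alpha> y x" "rearrangement \<alpha> x \<noteq> rearrangement \<alpha> y"
    "\<And>z. z \<in> E \<Longrightarrow> submajorized \<alpha> z x \<Longrightarrow> (\<And>t. 0 < t \<Longrightarrow> Phi \<alpha> z t \<le> p + q * t) \<Longrightarrow> submajorized \<alpha> z y"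
proof -
  define D where "D t = Phi \<alpha> x t - (p + q * t)" for t
  have cont: "continuous_on {c..d} D" if "0 \<le> c" for c d
    unfolding D_def
    by (intro continuous_intros continuous_on_subset[OF Phi_continuous[OF x, of d]]) (use that in auto)
  have D0: "D 0 \<le> 0" "0 < D t0" using p less by (auto simp: D_def)
  obtain a where a: "0 \<le> a" "a < t0" "D a = 0"
  proof -
    obtain a where "0 \<le> a" "a \<le> t0" "D a = 0"
      using IVT'[of D 0 0 t0] cont[of 0 t0] D0 t0 by auto
    then show thesis using D0 by (intro that[of a]) (auto simp: less_le)
  qed
  \<comment> \<open>On the half-line, sublinearity forces a second crossing with the line. For
    \<alpha> = 1 there may be none inside I; then b = 1, and only \<open>D b\<close> >= 0 is
    known.\<close>
  obtain b where b: "t0 < b" "ereal b \<le> \<alpha>" "0 \<le> D b" "D b = 0 \<or> b \<notin> ival \<alpha>"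
  proof -
    note found = that
    have *: thesis if T: "t0 \<le> T" "ereal T \<le> \<alpha>" "D T \<le> 0" for T
    proof -
      obtain b where b: "t0 \<le> b" "b \<le> T" "D b = 0"
        using IVT2'[of D T 0 t0] cont[of t0 T] T D0 t0 by auto
      moreover have "t0 \<noteq> b" using b D0 by auto
      moreover have "ereal b \<le> \<alpha>" using b(2) T(2) by (meson ereal_less_eq(3) order_trans)
      ultimately show thesis by (intro found[of b]) auto
    qed
    show thesis
    proof (cases "\<alpha> = \<infinity>")
      case True
      obtain T where T: "0 < T" "\<And>t. T \<le> t \<Longrightarrow> Phi \<alpha> x t \<le> q * t"
        using Phi_sublinear[OF x v q] by auto
      show thesis
        by (rule *[of "max T t0"]) (use True T(2)[of "max T t0"] p in \<open>auto simp: D_def\<close>)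
    next
      case False
      then have \<alpha>: "\<alpha> = 1" using alpha by simp
      then have t1: "t0 < 1" using t0 by (simp add: ival_def one_ereal_def)
      show thesis
      proof (cases "D 1 \<le> 0")
        case True
        show thesis by (rule *[of 1]) (use t1 True \<alpha> in \<open>auto simp: one_ereal_def\<close>)
      next
        case False
        then show thesis using t1 \<alpha> by (intro that[of 1]) (auto simp: one_ereal_def ival_def)
      qed
    qed
  qed
  have ab: "a < b" "0 < b" using a b t0 by auto
  have D_upper: "D t - D s \<le> (t - s) * (rr \<alpha> x s - q)" if "0 < s" "s \<le> t" for s t
    using Phi_upper[OF x that] by (simp add: D_def algebra_simps)
  have D_lower: "(t - s) * (rr \<alpha> x t - q) \<le> D t - D s" if "0 \<le> s" "s \<le> t" for s t
    using Phi_lower[OF x that] by (simp add: D_def algebra_simps)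
  have left: "q \<le> rr \<alpha> x a" if "0 < a"
  proof -
    have "0 < (t0 - a) * (rr \<alpha> x a - q)" using D_upper[OF that, of t0] a D0 by linarith
    then show ?thesis using a(2) by (simp add: zero_less_mult_iff)
  qed
  have right: "rr \<alpha> x b \<le> q"
  proof (cases "b \<in> ival \<alpha>")
    case True
    then have "(b - t0) * (rr \<alpha> x b - q) < 0" using D_lower[of t0 b] b D0 t0 by auto
    then show ?thesis using b(1) by (simp add: mult_less_0_iff)
  next
    case False
    then show ?thesis using rr_outside[OF x, of b] ab q by simp
  qed
  \<comment> \<open>By concavity, if D has dropped from 0 at a to a negative value, it does not rise
    again, which contradicts \<open>D b\<close> >= 0.\<close>
  have D_between: "0 \<le> D t" if t: "a < t" "t < b" for t
  proof (rule ccontr)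
    assume neg: "\<not> 0 \<le> D t"
    have t0: "0 < t" using a t by simp
    have "(t - a) * (rr \<alpha> x t - q) < 0" using D_lower[of a t] a t neg by linarith
    then have "rr \<alpha> x t - q < 0" using t by (simp add: mult_less_0_iff)
    then have "(b - t) * (rr \<alpha> x t - q) \<le> 0" using t by (intro mult_nonneg_nonpos) auto
    then have "D b \<le> D t" using D_upper[OF t0, of b] t by linarith
    then show False using neg b(3) by linarith
  qed
  define y where "y = (\<lambda>t. if a \<le> t \<and> t < b then ereal q else rearrangement \<alpha> x t)"
  have ry: "rearrangement \<alpha> y t = y t" if "0 \<le> t" for t
    using flatten_rearrangement[OF x a(1) ab(1) b(2) q left right y_def that] by simp
  let ?f = "flatten (rr \<alpha> x) a b q"
  have rry: "rr \<alpha> y t = ?f t" if "0 \<le> t" for t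
    using ry[OF that] by (simp add: rr_def y_def flatten_def)
  have "q * (b - a) \<le> integral {a..b} (rr \<alpha> x)"
    using Phi_diff[OF x a(1), of b] ab a b by (simp add: D_def algebra_simps)
  then have elf: "elem ?f"
    using flatten_norm[OF elem_rr(1)[OF x] rr_borel rr_nonneg a(1) ab(1) b(2)] rr_antimono[OF x]
      rr_integrable_Icc[OF x a(1)] q a(1) by auto
  have yE: "y \<in> E"
  proof (rule nrm_cong_AE(1))
    show "(\<lambda>t. ereal (?f t)) \<in> E" using elf by (simp add: elem_def)
    show "y \<in> L0 \<alpha>" unfolding y_def L0_def by (intro measurable_I_borel) measurable
    show "AE t in I_measure \<alpha>. \<bar>y t\<bar> = \<bar>ereal (?f t)\<bar>"
      using AE_rr[OF x] by eventually_elim (auto simp: y_def flatten_def)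
  qed
  have Phiy: "Phi \<alpha> y t = integral {0..t} ?f" if "0 \<le> t" for t
    unfolding Phi_def by (rule integral_cong) (simp add: rry)
  have intx: "rr \<alpha> x integrable_on {c..d}" if "0 \<le> c" for c d using x that by (rule rr_integrable_Icc)
  have P1: "Phi \<alpha> y t = Phi \<alpha> x t" if "0 \<le> t" "t \<le> a" for t
    using Phiy[OF that(1)] integral_unique[OF flatten_has_integral_left[OF that(2) intx[OF order_refl]]]
    by (simp add: Phi_def)
  have P2: "Phi \<alpha> y t = p + q * t" if t: "a \<le> t" "t \<le> b" for t
  proof -
    have "(?f has_integral Phi \<alpha> x a + q * (t - a)) {0..t}"
      unfolding Phi_def
      by (rule has_integral_combine[OF a(1) t(1) flatten_has_integral_left[OF order_refl intx]
            flatten_has_integral_mid[OF order_refl t]]) simp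
    then have "Phi \<alpha> y t = Phi \<alpha> x a + q * (t - a)"
      using Phiy[of t] a t integral_unique by auto
    then show ?thesis using a(3) by (simp add: D_def algebra_simps)
  qed
  \<comment> \<open>Flattening loses the mass \<open>D b\<close>, which is zero unless b is the
    right end of I.\<close>
  have P3: "Phi \<alpha> y t = Phi \<alpha> x t - D b" if t: "b \<le> t" for t
  proof -
    have "Phi \<alpha> y t - Phi \<alpha> y b = integral {b..t} (rr \<alpha> y)" using t ab by (intro Phi_diff[OF yE]) auto
    also have "\<dots> = integral {b..t} (rr \<alpha> x)"
      using ab by (intro integral_cong) (simp add: rry flatten_def)
    also have "\<dots> = Phi \<alpha> x t - Phi \<alpha> x b" using t ab by (intro Phi_diff[OF x, symmetric]) auto
    finally show ?thesis using P2[of b] ab by (simp add: D_def)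
  qed
  show thesis
  proof (rule that[OF yE])
    show "submajorized \<alpha> y x"
      unfolding submajorized_Phi[OF yE x]
    proof (intro allI impI)
      fix t :: real assume "0 < t"
      then show "Phi \<alpha> y t \<le> Phi \<alpha> x t"
        using P1[of t] P2[of t] P3[of t] D_between[of t] b(3)
        by (cases "t \<le> a"; cases "b \<le> t") (auto simp: D_def not_le)
    qed
    show "rearrangement \<alpha> x \<noteq> rearrangement \<alpha> y"
    proof
      assume "rearrangement \<alpha> x = rearrangement \<alpha> y"
      then have "Phi \<alpha> x t0 = Phi \<alpha> y t0" by (simp add: Phi_def rr_def[abs_def])
      then show False using P2[of t0] a b less by simp
    qed
    fix z assume z: "z \<in> E" "submajorized \<alpha> z x" and zl: "\<And>t. 0 < t \<Longrightarrow> Phi \<alpha> z t \<le> p + q * t"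
    have zx: "\<And>t. 0 < t \<Longrightarrow> Phi \<alpha> z t \<le> Phi \<alpha> x t" using submajorized_Phi[OF z(1) x] z(2) by auto
    show "submajorized \<alpha> z y"
      unfolding submajorized_Phi[OF z(1) yE]
    proof (intro allI impI)
      fix t :: real assume t: "0 < t"
      consider "t \<le> a" | "a \<le> t" "t \<le> b" | "b \<le> t" by linarith
      then show "Phi \<alpha> z t \<le> Phi \<alpha> y t"
      proof cases
        case 1
        then show ?thesis using P1[of t] zx t by simp
      next
        case 2
        then show ?thesis using P2[of t] zl t by simp
      next
        \<comment> \<open>If b lies in I, then \<open>D b\<close> = 0 and y has the primitive of x
          from b on. Otherwise both primitives are constant beyond b, and the comparison at b
          suffices.\<close>
        case 3
        show ?thesis
        proof (cases "b \<in> ival \<alpha>")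
          case True
          then show ?thesis using b(4) P3[OF 3] zx[OF t] by simp
        next
          case False
          then show ?thesis
            using Phi_beyond[OF z(1) ab(2) False 3] Phi_beyond[OF yE ab(2) False 3] P2[of b] zl[OF ab(2)] ab
            by simp
        qed
      qed
    qed
  qed
qed

section \<open>Maximal functions in measure and norms of differences of rearrangements\<close>

lemma Phi_borel: "x \<in> E \<Longrightarrow> Phi \<alpha> x \<in> borel_measurable borel"
proof (rule borel_measurable_mono, rule monoI)
  fix s t :: real assume x: "x \<in> E" and st: "s \<le> t"
  have neg: "Phi \<alpha> x u = 0" if "u < 0" for u using that by (simp add: Phi_def)
  show "Phi \<alpha> x s \<le> Phi \<alpha> x t"
    using neg[of s] neg[of t] Phi_nonneg[OF x, of t] Phi_mono[OF x _ st]
    by (cases "0 \<le> s"; cases "0 \<le> t") (use st in auto)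
qed

lemma mean_borel: "x \<in> E \<Longrightarrow> (\<lambda>t. Phi \<alpha> x t / t) \<in> borel_measurable (I_measure \<alpha>)"
  by (intro measurable_I_borel borel_measurable_divide Phi_borel) simp_all

lemma AE_maximal_fun: "x \<in> E \<Longrightarrow> AE t in I_measure \<alpha>. maximal_fun \<alpha> x t = ereal (Phi \<alpha> x t / t)"
  using AE_I_pos by eventually_elim (rule maximal_fun_Phi)

lemma maximal_fun_borel:
  assumes x: "x \<in> E"
  shows "maximal_fun \<alpha> x \<in> borel_measurable (I_measure \<alpha>)"
proof -
  have [measurable]: "Phi \<alpha> x \<in> borel_measurable borel" using x by (rule Phi_borel)
  have "(\<lambda>t. if t = 0 then maximal_fun \<alpha> x 0 else ereal (Phi \<alpha> x t / t)) \<in> borel_measurable (I_measure \<alpha>)"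
    by (intro measurable_I_borel) measurable
  moreover have "(if t = 0 then maximal_fun \<alpha> x 0 else ereal (Phi \<alpha> x t / t)) = maximal_fun \<alpha> x t"
    if "t \<in> space (I_measure \<alpha>)" for t
    using that maximal_fun_Phi[OF x, of t] by (auto simp: ival_def)
  ultimately show ?thesis
    using measurable_cong[of "I_measure \<alpha>" "\<lambda>t. if t = 0 then maximal_fun \<alpha> x 0 else ereal (Phi \<alpha> x t / t)"
        "maximal_fun \<alpha> x" borel] by blast
qed

lemma maximal_in_measure_iff:
  assumes x: "x \<in> E" and X: "\<And>n. X n \<in> E"
  shows "tendsto_in_measure \<alpha> (\<lambda>n. maximal_fun \<alpha> (X n)) (maximal_fun \<alpha> x) \<longleftrightarrow>
     (\<forall>e>0. (\<lambda>n. emeasure (I_measure \<alpha>)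
        {t \<in> ival \<alpha>. e < \<bar>Phi \<alpha> (X n) t / t - Phi \<alpha> x t / t\<bar>}) \<longlonglongrightarrow> 0)"
  using assms by (intro tendsto_in_measure_real_iff maximal_fun_borel mean_borel AE_maximal_fun)

text \<open>Condition (ii) and \<open>LLUKM_point\<close> subtract in opposite orders; both norms
  are reduced to that of one real function.\<close>

lemma nrm_rearrangement_diff:
  assumes x: "x \<in> E" and y: "y \<in> E"
  shows "nrm (\<lambda>t. rearrangement \<alpha> y t - rearrangement \<alpha> x t) = N (\<lambda>t. rr \<alpha> y t - rr \<alpha> x t)"
    and "nrm (\<lambda>t. rearrangement \<alpha> x t - rearrangement \<alpha> y t) = N (\<lambda>t. rr \<alpha> y t - rr \<alpha> x t)"
proof -
  have E: "(\<lambda>t. ereal (rr \<alpha> y t - rr \<alpha> x t)) \<in> E"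
    using elem_diff[OF elem_rr(1)[OF y] elem_rr(1)[OF x]] by (simp add: elem_def)
  have L: "(\<lambda>t. rearrangement \<alpha> y t - rearrangement \<alpha> x t) \<in> L0 \<alpha>" "(\<lambda>t. rearrangement \<alpha> x t - rearrangement \<alpha> y t) \<in> L0 \<alpha>"
    unfolding L0_def by (intro measurable_I_borel, measurable)+
  have A1: "AE t in I_measure \<alpha>. \<bar>rearrangement \<alpha> y t - rearrangement \<alpha> x t\<bar> = \<bar>ereal (rr \<alpha> y t - rr \<alpha> x t)\<bar>"
    using AE_rr[OF x] AE_rr[OF y]
  proof eventually_elim
    case (elim t)
    show ?case unfolding elim[symmetric] by simp
  qed
  have A2: "AE t in I_measure \<alpha>. \<bar>rearrangement \<alpha> x t - rearrangement \<alpha> y t\<bar> = \<bar>ereal (rr \<alpha> y t - rr \<alpha> x t)\<bar>"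
    using AE_rr[OF x] AE_rr[OF y]
  proof eventually_elim
    case (elim t)
    show ?case unfolding elim[symmetric] by (simp add: abs_minus_commute)
  qed
  show "nrm (\<lambda>t. rearrangement \<alpha> y t - rearrangement \<alpha> x t) = N (\<lambda>t. rr \<alpha> y t - rr \<alpha> x t)"
    using nrm_cong_AE(2)[OF E L(1) A1] by (simp add: N_def)
  show "nrm (\<lambda>t. rearrangement \<alpha> x t - rearrangement \<alpha> y t) = N (\<lambda>t. rr \<alpha> y t - rr \<alpha> x t)"
    using nrm_cong_AE(2)[OF E L(2) A2] by (simp add: N_def)
qed

text \<open>By right continuity a strict inequality at t would persist on an interval (t, s) inside
  I. Pointwise equality is wanted because \<open>LKM_point\<close> compares rearrangements as
  functions.\<close>

lemma rearrangement_le_of_AE_eq: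
  assumes x: "x \<in> E" and y: "y \<in> E" and eq: "AE t in I_measure \<alpha>. rr \<alpha> x t = rr \<alpha> y t" and t: "0 \<le> t"
  shows "rearrangement \<alpha> x t \<le> rearrangement \<alpha> y t"
proof (rule ccontr)
  assume "\<not> ?thesis"
  then obtain l where l: "rearrangement \<alpha> y t < ereal l" "ereal l < rearrangement \<alpha> x t"
    using ereal_dense2 by (meson not_le)
  have "0 \<le> l" using l(1) le_less_trans[OF rearrangement_nonneg[of \<alpha> y t] l(1)] by simp
  then obtain s where s: "t < s" "ereal l < rearrangement \<alpha> x s"
    using rearrangement_right_cont[OF in_L0[OF x] t l(2)] by blast
  have "s \<in> ival \<alpha>"
    using rearrangement_outside[OF in_L0[OF x], of s] s t \<open>0 \<le> l\<close> by (cases "s \<in> ival \<alpha>") auto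
  have "rr \<alpha> x u \<noteq> rr \<alpha> y u" if u: "t < u" "u < s" for u
  proof -
    have "ereal l < rearrangement \<alpha> x u"
      using rearrangement_antimono[of u s \<alpha> x] u s by (meson less_imp_le less_le_trans)
    moreover have "rearrangement \<alpha> y u < ereal l"
      using rearrangement_antimono[of t u \<alpha> y] u l by (meson less_imp_le le_less_trans)
    ultimately show ?thesis
      using ereal_rr[OF x, of u] ereal_rr[OF y, of u] u t by (metis le_less_trans less_asym)
  qed
  moreover have "u \<in> ival \<alpha>" if "t < u" "u < s" for u
    using ival_mono[OF \<open>s \<in> ival \<alpha>\<close>, of u] that t by simp
  moreover have "AE u in lebesgue. u \<in> ival \<alpha> \<longrightarrow> rr \<alpha> x u = rr \<alpha> y u" using eq by (simp only: AE_I_iff)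
  ultimately have "AE u in lebesgue. u \<notin> {t<..<s}" by (auto elim!: eventually_mono)
  then have "emeasure lebesgue {t<..<s} = 0"
    by (subst (asm) AE_iff_measurable[where N = "{t<..<s}"]) auto
  with s(1) show False by simp
qed

lemma rearrangement_eq_of_N:
  assumes x: "x \<in> E" and y: "y \<in> E" and N: "N (\<lambda>t. rr \<alpha> y t - rr \<alpha> x t) = 0"
  shows "rearrangement \<alpha> x = rearrangement \<alpha> y"
proof
  fix t
  have "AE t in I_measure \<alpha>. rr \<alpha> y t - rr \<alpha> x t = 0"
    using N N_eq_0_iff[OF elem_diff[OF elem_rr(1)[OF y] elem_rr(1)[OF x]]] by simp
  then have eq: "AE t in I_measure \<alpha>. rr \<alpha> x t = rr \<alpha> y t" "AE t in I_measure \<alpha>. rr \<alpha> y t = rr \<alpha> x t"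
    by (auto elim!: eventually_mono)
  have nn: "rearrangement \<alpha> x s = rearrangement \<alpha> y s" if "0 \<le> s" for s
    using rearrangement_le_of_AE_eq[OF x y eq(1) that] rearrangement_le_of_AE_eq[OF y x eq(2) that] by simp
  show "rearrangement \<alpha> x t = rearrangement \<alpha> y t"
    using nn[of t] nn[of 0] rearrangement_neg[of t \<alpha> x] rearrangement_neg[of t \<alpha> y] by (cases "0 \<le> t") auto
qed

text \<open>If \<open>\<Phi>\<^sub>X\<close> stays below \<open>\<Phi>\<^sub>x\<close> at \<open>t\<^sub>0\<close> by a fixed amount for infinitely many members of the
  sequence, then, their slopes at \<open>t\<^sub>0\<close> being bounded, infinitely many of them lie below one and the
  same line; cutting \<open>\<Phi>\<^sub>x\<close> by this line contradicts lower \<open>K\<close>-monotonicity.\<close>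

lemma Phi_pointwise_of_norm:
  assumes fatou: "fatou_property \<alpha> E nrm" and x: "x \<in> E" and v: "vanishing x"
    and lkm: "LKM_point \<alpha> E nrm x" and X: "\<And>n. X n \<in> E" "\<And>n. submajorized \<alpha> (X n) x"
    and lim: "(\<lambda>n. nrm (X n)) \<longlonglongrightarrow> nrm x" and t0: "t0 \<in> ival \<alpha>" "0 < t0"
  shows "(\<lambda>n. Phi \<alpha> (X n) t0) \<longlonglongrightarrow> Phi \<alpha> x t0"
proof (rule ccontr)
  have XPhi: "Phi \<alpha> (X n) t \<le> Phi \<alpha> x t" if "0 < t" for n t
    using X submajorized_Phi[OF X(1) x] that by auto
  assume "\<not> ?thesis"
  then obtain \<delta> where \<delta>: "0 < \<delta>" "\<not> eventually (\<lambda>n. dist (Phi \<alpha> (X n) t0) (Phi \<alpha> x t0) < \<delta>) sequentially"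
    unfolding tendsto_iff by blast
  have fr1: "frequently (\<lambda>n. Phi \<alpha> (X n) t0 \<le> Phi \<alpha> x t0 - \<delta>) sequentially"
    using \<delta>(2) unfolding not_eventually
  proof (rule frequently_elim1)
    fix n assume "\<not> dist (Phi \<alpha> (X n) t0) (Phi \<alpha> x t0) < \<delta>"
    then show "Phi \<alpha> (X n) t0 \<le> Phi \<alpha> x t0 - \<delta>"
      using XPhi[OF t0(2), of n] unfolding dist_real_def by linarith
  qed
  \<comment> \<open>Slopes at t0 are rounded to multiples of \<epsilon>, at a cost of at most
    \<epsilon> t0 = \<delta>/2 on [0, t0]. They are bounded by \<Phi>_x(t0) / t0, so only finitely
    many indices \<open>j n\<close> occur.\<close>
  define \<epsilon> where "\<epsilon> = \<delta> / (2 * t0)"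
  have \<epsilon>: "0 < \<epsilon>" "\<epsilon> * t0 = \<delta> / 2" using \<delta> t0 by (auto simp: \<epsilon>_def)
  define c where "c n = rr \<alpha> (X n) t0" for n
  define j where "j n = nat \<lfloor>c n / \<epsilon>\<rfloor>" for n
  define M where "M = nat \<lfloor>Phi \<alpha> x t0 / t0 / \<epsilon>\<rfloor>"
  have jM: "j n \<in> {..M}" for n
  proof -
    have "t0 * c n \<le> Phi \<alpha> x t0"
      using Phi_lower[OF X(1), of 0 t0 n] t0 XPhi[OF t0(2), of n] by (simp add: c_def)
    then have "c n \<le> Phi \<alpha> x t0 / t0" using t0 by (simp add: field_simps)
    then have "c n / \<epsilon> \<le> Phi \<alpha> x t0 / t0 / \<epsilon>" using \<epsilon> by (intro divide_right_mono) auto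
    then show ?thesis unfolding j_def M_def by (auto intro: nat_mono floor_mono)
  qed
  have "frequently (\<lambda>n. \<exists>i\<in>{..M}. Phi \<alpha> (X n) t0 \<le> Phi \<alpha> x t0 - \<delta> \<and> j n = i) sequentially"
    using fr1 by (rule frequently_elim1) (use jM in auto)
  then have "\<exists>i\<in>{..M}. frequently (\<lambda>n. Phi \<alpha> (X n) t0 \<le> Phi \<alpha> x t0 - \<delta> \<and> j n = i) sequentially"
    by (subst (asm) frequently_bex_finite_distrib) auto
  then obtain i where i: "frequently (\<lambda>n. Phi \<alpha> (X n) t0 \<le> Phi \<alpha> x t0 - \<delta> \<and> j n = i) sequentially" by blast
  \<comment> \<open>q is the upper end of the i-th slope cell. The line of slope q passes \<delta>/2
    below \<Phi>_x at t0, which leaves \<delta>/2 above the selected members to absorb the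
    rounding.\<close>
  define q where "q = (real i + 1) * \<epsilon>"
  define p where "p = Phi \<alpha> x t0 - \<delta> / 2 - q * t0"
  have q: "0 < q" using \<epsilon> by (simp add: q_def)
  have line: "Phi \<alpha> (X n) t \<le> p + q * t"
    if n: "Phi \<alpha> (X n) t0 \<le> Phi \<alpha> x t0 - \<delta>" "j n = i" and t: "0 \<le> t" for n t
  proof -
    have "0 \<le> c n / \<epsilon>" using \<epsilon> by (simp add: c_def)
    then have "real i \<le> c n / \<epsilon>" "c n / \<epsilon> < real i + 1" using n(2) unfolding j_def by linarith+
    then have c: "q - \<epsilon> \<le> c n" "c n \<le> q" using \<epsilon> by (auto simp: q_def field_simps)
    show ?thesis
    proof (cases "t0 \<le> t")
      case True
      have "Phi \<alpha> (X n) t \<le> Phi \<alpha> (X n) t0 + (t - t0) * c n"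
        using Phi_upper[OF X(1) t0(2) True, of n] by (simp add: c_def)
      also have "(t - t0) * c n \<le> (t - t0) * q" using c True by (intro mult_left_mono) auto
      finally show ?thesis using n(1) \<delta>(1) by (simp add: p_def algebra_simps)
    next
      case False
      then have "Phi \<alpha> (X n) t \<le> Phi \<alpha> (X n) t0 - (t0 - t) * c n"
        using Phi_lower[OF X(1) t, of t0 n] by (simp add: c_def)
      moreover have "(t0 - t) * (q - \<epsilon>) \<le> (t0 - t) * c n" using c False by (intro mult_left_mono) auto
      moreover have "(t0 - t) * (q - \<epsilon>) = t0 * q - t * q - \<delta> / 2 + t * \<epsilon>"
        using \<epsilon>(2) by (simp add: algebra_simps)
      moreover have "0 \<le> t * \<epsilon>" using t \<epsilon> by simp
      ultimately show ?thesis using n(1) by (simp add: p_def algebra_simps)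
    qed
  qed
  obtain n where n: "Phi \<alpha> (X n) t0 \<le> Phi \<alpha> x t0 - \<delta>" "j n = i"
    using frequently_ex[OF i] by blast
  have p: "0 \<le> p" using line[OF n, of 0] by simp
  have "p + q * t0 < Phi \<alpha> x t0" using \<delta>(1) by (simp add: p_def)
  then obtain y where y: "y \<in> E" "submajorized \<alpha> y x" "rearrangement \<alpha> x \<noteq> rearrangement \<alpha> y"
    "\<And>z. z \<in> E \<Longrightarrow> submajorized \<alpha> z x \<Longrightarrow> (\<And>t. 0 < t \<Longrightarrow> Phi \<alpha> z t \<le> p + q * t) \<Longrightarrow> submajorized \<alpha> z y"
    using cut_by_line[OF x v t0 p q] by metis
  have "nrm y < nrm x" using lkm y(1-3) unfolding LKM_point_def by blast
  with lim have "eventually (\<lambda>n. nrm y < nrm (X n)) sequentially" by (rule order_tendstoD)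
  moreover have "frequently (\<lambda>n. nrm (X n) \<le> nrm y) sequentially"
    using i
  proof (rule frequently_elim1)
    fix n assume "Phi \<alpha> (X n) t0 \<le> Phi \<alpha> x t0 - \<delta> \<and> j n = i"
    then have "submajorized \<alpha> (X n) y" using line[of n] by (intro y(4) X) auto
    then show "nrm (X n) \<le> nrm y" by (rule submajorized_norm[OF fatou X(1) y(1)])
  qed
  ultimately show False unfolding frequently_def not_le by blast
qed

text \<open>Pointwise convergence on I is at hand; the tail is uniform because the maximal functions
  of the sequence lie between 0 and x**, which tends to 0.\<close>

lemma maximal_in_measure_of_norm:
  assumes fatou: "fatou_property \<alpha> E nrm" and x: "x \<in> E" and v: "vanishing x"
    and lkm: "LKM_point \<alpha> E nrm x" and X: "\<And>n. X n \<in> E" "\<And>n. submajorized \<alpha> (X n) x"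
    and lim: "(\<lambda>n. nrm (X n)) \<longlonglongrightarrow> nrm x"
  shows "tendsto_in_measure \<alpha> (\<lambda>n. maximal_fun \<alpha> (X n)) (maximal_fun \<alpha> x)"
  unfolding maximal_in_measure_iff[OF x X(1)]
proof (intro allI impI)
  fix e :: real assume e: "0 < e"
  show "(\<lambda>n. emeasure (I_measure \<alpha>) {t \<in> ival \<alpha>. e < \<bar>Phi \<alpha> (X n) t / t - Phi \<alpha> x t / t\<bar>}) \<longlonglongrightarrow> 0"
  proof (rule tendsto_emeasure_of_AE)
    show "(\<lambda>t. Phi \<alpha> (X n) t / t) \<in> borel_measurable (I_measure \<alpha>)" for n by (rule mean_borel[OF X(1)])
    show "(\<lambda>t. Phi \<alpha> x t / t) \<in> borel_measurable (I_measure \<alpha>)" by (rule mean_borel[OF x])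
    show "AE t in I_measure \<alpha>. (\<lambda>n. Phi \<alpha> (X n) t / t) \<longlonglongrightarrow> Phi \<alpha> x t / t"
      using AE_I_pos AE_space
      by eventually_elim
        (intro tendsto_divide tendsto_const Phi_pointwise_of_norm[OF fatou x v lkm X lim], auto)
    obtain T where T: "0 < T" "\<And>t. T \<le> t \<Longrightarrow> Phi \<alpha> x t \<le> e * t"
      using Phi_sublinear[OF x v e] by auto
    have "\<bar>Phi \<alpha> (X n) t / t - Phi \<alpha> x t / t\<bar> \<le> e" if t: "T \<le> t" for n t
    proof -
      have t0: "0 < t" using T t by simp
      have "0 \<le> Phi \<alpha> (X n) t / t" using Phi_nonneg[OF X(1), of t n] t0 by simp
      moreover have "Phi \<alpha> (X n) t / t \<le> Phi \<alpha> x t / t"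
        using submajorized_Phi[OF X(1) x, of n] X(2)[of n] t0 by (intro divide_right_mono) auto
      moreover have "Phi \<alpha> x t / t \<le> e" using T(2)[OF t] t0 by (simp add: field_simps)
      ultimately show ?thesis by linarith
    qed
    then show "\<exists>T. eventually (\<lambda>n. \<forall>t\<in>ival \<alpha>. T \<le> t \<longrightarrow> \<bar>Phi \<alpha> (X n) t / t - Phi \<alpha> x t / t\<bar> \<le> e) sequentially"
      by (intro exI[of _ T]) auto
  qed (fact e)
qed

section \<open>From maximal functions back to rearrangements\<close>

lemma mean_antimono:
  assumes x: "x \<in> E" and st: "0 < s" "s \<le> t"
  shows "Phi \<alpha> x t / t \<le> Phi \<alpha> x s / s"
proof -
  have "Phi \<alpha> x t - Phi \<alpha> x s \<le> (t - s) * rr \<alpha> x s" using st by (intro Phi_upper[OF x]) auto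
  then have "s * (Phi \<alpha> x t - Phi \<alpha> x s) \<le> s * ((t - s) * rr \<alpha> x s)" using st by (intro mult_left_mono) auto
  also have "\<dots> = (t - s) * (s * rr \<alpha> x s)" by simp
  also have "\<dots> \<le> (t - s) * Phi \<alpha> x s"
    using Phi_lower[OF x, of 0 s] st by (intro mult_left_mono) auto
  finally show ?thesis using st by (simp add: field_simps)
qed

text \<open>The means are decreasing and the limit is continuous at t0. A deviation e at t0
  therefore persists as e/2 on an interval of fixed length on one side of t0, against convergence in
  measure.\<close>

lemma Phi_pointwise_of_maximal:
  assumes x: "x \<in> E" and X: "\<And>n. X n \<in> E"
    and lim: "tendsto_in_measure \<alpha> (\<lambda>n. maximal_fun \<alpha> (X n)) (maximal_fun \<alpha> x)"
    and t0: "t0 \<in> ival \<alpha>" "0 < t0"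
  shows "(\<lambda>n. Phi \<alpha> (X n) t0) \<longlonglongrightarrow> Phi \<alpha> x t0"
proof -
  define G where "G n t = Phi \<alpha> (X n) t / t" for n t
  define g where "g t = Phi \<alpha> x t / t" for t
  obtain t1 where t1: "t1 \<in> ival \<alpha>" "t0 < t1"
  proof (cases "\<alpha> = \<infinity>")
    case True
    then show thesis using t0 by (intro that[of "t0 + 1"]) (auto simp: ival_def)
  next
    case False
    then show thesis using t0 alpha by (intro that[of "(t0 + 1) / 2"]) (auto simp: ival_def one_ereal_def)
  qed
  have cont: "continuous_on {t0 / 2..t1} g"
    unfolding g_def
    by (intro continuous_intros continuous_on_subset[OF Phi_continuous[OF x, of t1]]) (use t0 in auto)
  have "(\<lambda>n. G n t0) \<longlonglongrightarrow> g t0"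
  proof (rule tendstoI)
    fix e :: real assume e: "0 < e"
    obtain d where d: "0 < d" "\<And>t. t \<in> {t0 / 2..t1} \<Longrightarrow> dist t t0 < d \<Longrightarrow> dist (g t) (g t0) < e / 2"
      using cont[unfolded continuous_on_iff, rule_format, of t0 "e / 2"] e t0 t1 by auto
    define \<eta> where "\<eta> = min d (min (t0 / 2) (t1 - t0))"
    have \<eta>: "0 < \<eta>" "\<eta> \<le> d" "\<eta> \<le> t0 / 2" "\<eta> \<le> t1 - t0"
      unfolding \<eta>_def using d(1) t0(2) t1(2) by linarith+
    define S where "S n = {t \<in> ival \<alpha>. e / 2 < \<bar>G n t - g t\<bar>}" for n
    have S: "S n \<in> sets lebesgue" for n
    proof -
      have [measurable]: "G n \<in> borel_measurable (I_measure \<alpha>)" "g \<in> borel_measurable (I_measure \<alpha>)"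
        unfolding G_def[abs_def] g_def[abs_def] by (intro mean_borel X x)+
      have "{t \<in> space (I_measure \<alpha>). e / 2 < \<bar>G n t - g t\<bar>} \<in> sets (I_measure \<alpha>)" by measurable
      then show ?thesis by (simp add: S_def sets_I_iff)
    qed
    have "(\<lambda>n. emeasure (I_measure \<alpha>) (S n)) \<longlonglongrightarrow> 0"
      using lim[unfolded maximal_in_measure_iff[OF x X], rule_format, of "e / 2"] e
      unfolding S_def G_def g_def by simp
    then have "(\<lambda>n. emeasure lebesgue (S n)) \<longlonglongrightarrow> 0" by (simp add: emeasure_I S_def)
    then have "eventually (\<lambda>n. emeasure lebesgue (S n) < ennreal \<eta>) sequentially"
      using \<eta> by (intro order_tendstoD) auto
    then show "eventually (\<lambda>n. dist (G n t0) (g t0) < e) sequentially"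
    proof eventually_elim
      case (elim n)
      have near: "t \<in> ival \<alpha> \<and> \<bar>g t - g t0\<bar> < e / 2 \<and> 0 < t" if "t0 - \<eta> < t" "t < t0 + \<eta>" for t
      proof -
        have "t \<in> {t0 / 2..t1}" "dist t t0 < d" using that \<eta> by (auto simp: dist_real_def abs_if)
        then show ?thesis using d(2)[of t] ival_mono[OF t1(1), of t] t0 by (auto simp: dist_real_def)
      qed
      have no: "\<not> {c<..<c + \<eta>} \<subseteq> S n" for c
      proof
        assume "{c<..<c + \<eta>} \<subseteq> S n"
        then have "emeasure lebesgue {c<..<c + \<eta>} \<le> emeasure lebesgue (S n)" using S by (rule emeasure_mono)
        then show False using elim \<eta> by simp
      qed
      have anti: "G n t \<le> G n s" if "0 < s" "s \<le> t" for s t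
        unfolding G_def using mean_antimono[OF X that] .
      show ?case
      proof (rule ccontr)
        assume "\<not> ?case"
        then consider "g t0 + e \<le> G n t0" | "G n t0 \<le> g t0 - e" by (auto simp: dist_real_def abs_if split: if_splits)
        then show False
        proof cases
          case 1
          have "{t0 - \<eta><..<t0 - \<eta> + \<eta>} \<subseteq> S n"
          proof
            fix t assume "t \<in> {t0 - \<eta><..<t0 - \<eta> + \<eta>}"
            then have t: "t0 - \<eta> < t" "t < t0" "t < t0 + \<eta>" using \<eta> by auto
            note n = near[OF t(1,3)]
            have "e / 2 < \<bar>G n t - g t\<bar>" using n anti[of t t0] t(2) 1 by linarith
            then show "t \<in> S n" using n by (simp add: S_def)
          qed
          then show False using no by blast
        next
          case 2
          have "{t0<..<t0 + \<eta>} \<subseteq> S n"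
          proof
            fix t assume "t \<in> {t0<..<t0 + \<eta>}"
            then have t: "t0 - \<eta> < t" "t0 < t" "t < t0 + \<eta>" using \<eta> by auto
            note n = near[OF t(1,3)]
            have "e / 2 < \<bar>G n t - g t\<bar>" using n anti[of t0 t] t(2) t0(2) 2 by linarith
            then show "t \<in> S n" using n by (simp add: S_def)
          qed
          then show False using no by blast
        qed
      qed
    qed
  qed
  then have "(\<lambda>n. G n t0 * t0) \<longlonglongrightarrow> g t0 * t0" by (intro tendsto_intros)
  then show ?thesis using t0 by (simp add: G_def g_def)
qed

text \<open>By concavity x_n*(t) lies between the slopes of chords on the two sides of t, and these
  slopes converge. Short chords to the right are close to x*(t) by right continuity; those to the
  left need continuity of x* at t.\<close>

lemma rr_pointwise:
  assumes x: "x \<in> E" and X: "\<And>n. X n \<in> E"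
    and lim: "\<And>t. t \<in> ival \<alpha> \<Longrightarrow> 0 < t \<Longrightarrow> (\<lambda>n. Phi \<alpha> (X n) t) \<longlonglongrightarrow> Phi \<alpha> x t"
    and t: "t \<in> ival \<alpha>" "0 < t" and cont: "continuous (at t within {0<..}) (rr \<alpha> x)"
  shows "(\<lambda>n. rr \<alpha> (X n) t) \<longlonglongrightarrow> rr \<alpha> x t"
proof (rule order_tendstoI)
  have quot: "(\<lambda>n. (Phi \<alpha> (X n) b - Phi \<alpha> (X n) a) / (b - a)) \<longlonglongrightarrow> (Phi \<alpha> x b - Phi \<alpha> x a) / (b - a)"
    if "0 < a" "a < b" "b \<in> ival \<alpha>" for a b
    using that ival_mono[OF that(3), of a] by (intro tendsto_intros lim) auto
  fix l assume l: "rr \<alpha> x t < l"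
  have "eventually (\<lambda>s. rr \<alpha> x s < l) (at t within {0<..})"
    using cont l unfolding continuous_within by (rule order_tendstoD)
  then obtain d where d: "0 < d" "\<And>s. 0 < s \<Longrightarrow> s \<noteq> t \<Longrightarrow> dist s t < d \<Longrightarrow> rr \<alpha> x s < l"
    unfolding eventually_at by auto
  define s where "s = max (t / 2) (t - d / 2)"
  have s: "0 < s" "s < t" "rr \<alpha> x s < l"
    using d(1) t by (auto simp: s_def) (rule d(2), auto simp: dist_real_def)
  have "(Phi \<alpha> x t - Phi \<alpha> x s) / (t - s) \<le> rr \<alpha> x s"
    using Phi_upper[OF x s(1), of t] s(2) by (simp add: pos_divide_le_eq mult.commute)
  then have "eventually (\<lambda>n. (Phi \<alpha> (X n) t - Phi \<alpha> (X n) s) / (t - s) < l) sequentially"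
    using s by (intro order_tendstoD(2)[OF quot[OF s(1,2) t(1)]]) simp
  then show "eventually (\<lambda>n. rr \<alpha> (X n) t < l) sequentially"
  proof eventually_elim
    case (elim n)
    have "rr \<alpha> (X n) t \<le> (Phi \<alpha> (X n) t - Phi \<alpha> (X n) s) / (t - s)"
      using Phi_lower[OF X, of s t n] s by (simp add: pos_le_divide_eq mult.commute)
    then show ?case using elim by simp
  qed
next
  have quot: "(\<lambda>n. (Phi \<alpha> (X n) b - Phi \<alpha> (X n) a) / (b - a)) \<longlonglongrightarrow> (Phi \<alpha> x b - Phi \<alpha> x a) / (b - a)"
    if "0 < a" "a < b" "b \<in> ival \<alpha>" for a b
    using that ival_mono[OF that(3), of a] by (intro tendsto_intros lim) auto
  fix l assume l: "l < rr \<alpha> x t"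
  show "eventually (\<lambda>n. l < rr \<alpha> (X n) t) sequentially"
  proof (cases "0 \<le> l")
    case False
    then have "l < rr \<alpha> (X n) t" for n using rr_nonneg[of \<alpha> "X n" t] by linarith
    then show ?thesis by simp
  next
    case True
    obtain u where u: "t < u" "l < rr \<alpha> x u" using rr_right_cont[OF x t(2) l True] by auto
    have ui: "u \<in> ival \<alpha>" using rr_outside[OF x, of u] u t True by (cases "u \<in> ival \<alpha>") auto
    have "rr \<alpha> x u \<le> (Phi \<alpha> x u - Phi \<alpha> x t) / (u - t)"
      using Phi_lower[OF x, of t u] u t by (simp add: pos_le_divide_eq mult.commute)
    then have "eventually (\<lambda>n. l < (Phi \<alpha> (X n) u - Phi \<alpha> (X n) t) / (u - t)) sequentially"
      using u by (intro order_tendstoD(1)[OF quot[OF t(2) u(1) ui]]) simp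
    then show ?thesis
    proof eventually_elim
      case (elim n)
      have "(Phi \<alpha> (X n) u - Phi \<alpha> (X n) t) / (u - t) \<le> rr \<alpha> (X n) t"
        using Phi_upper[OF X t(2), of u n] u by (simp add: pos_divide_le_eq mult.commute)
      then show ?case using elim by simp
    qed
  qed
qed

text \<open>The monotone function x* has only countably many discontinuities. For the tail, the
  slope of the chord over [T, 2T] bounds x_n* beyond 2T, and its limit is at most x*(T).\<close>

lemma rr_in_measure:
  assumes x: "x \<in> E" and v: "vanishing x" and X: "\<And>n. X n \<in> E"
    and lim: "\<And>t. t \<in> ival \<alpha> \<Longrightarrow> 0 < t \<Longrightarrow> (\<lambda>n. Phi \<alpha> (X n) t) \<longlonglongrightarrow> Phi \<alpha> x t"
    and e: "0 < e"
  shows "(\<lambda>n. emeasure (I_measure \<alpha>) {t \<in> ival \<alpha>. e < \<bar>rr \<alpha> (X n) t - rr \<alpha> x t\<bar>}) \<longlonglongrightarrow> 0"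
proof (rule tendsto_emeasure_of_AE)
  show "rr \<alpha> (X n) \<in> borel_measurable (I_measure \<alpha>)" for n by (intro measurable_I_borel rr_borel)
  show "rr \<alpha> x \<in> borel_measurable (I_measure \<alpha>)" by (intro measurable_I_borel rr_borel)
  have "mono_on {0<..} (\<lambda>t. - rr \<alpha> x t)" by (auto intro!: mono_onI rr_antimono[OF x])
  from mono_on_ctble_discont[OF this]
  have "countable {a \<in> {0<..}. \<not> continuous (at a within {0<..}) (\<lambda>t. - rr \<alpha> x t)}" .
  then have "AE t in lborel. t \<notin> {a \<in> {0<..}. \<not> continuous (at a within {0<..}) (\<lambda>t. - rr \<alpha> x t)}"
    by (intro AE_not_in countable_imp_null_set_lborel)
  then have "AE t in lebesgue. t \<notin> {a \<in> {0<..}. \<not> continuous (at a within {0<..}) (\<lambda>t. - rr \<alpha> x t)}"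
    by (rule AE_completion)
  then have "AE t in I_measure \<alpha>. t \<notin> {a \<in> {0<..}. \<not> continuous (at a within {0<..}) (\<lambda>t. - rr \<alpha> x t)}"
    unfolding AE_I_iff by auto
  then show "AE t in I_measure \<alpha>. (\<lambda>n. rr \<alpha> (X n) t) \<longlonglongrightarrow> rr \<alpha> x t"
    using AE_I_pos AE_space
  proof eventually_elim
    case (elim t)
    then have "continuous (at t within {0<..}) (\<lambda>t. - rr \<alpha> x t)" by simp
    from continuous_minus[OF this] have "continuous (at t within {0<..}) (rr \<alpha> x)" by simp
    then show ?case using elim by (intro rr_pointwise[OF x X lim]) auto
  qed
  show "\<exists>T. eventually (\<lambda>n. \<forall>t\<in>ival \<alpha>. T \<le> t \<longrightarrow> \<bar>rr \<alpha> (X n) t - rr \<alpha> x t\<bar> \<le> e) sequentially"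
  proof (cases "\<alpha> = \<infinity>")
    case False
    then show ?thesis using alpha by (intro exI[of _ 1]) (auto simp: ival_def one_ereal_def)
  next
    case True
    obtain T where T: "0 < T" "\<And>t. T \<le> t \<Longrightarrow> rr \<alpha> x t \<le> e / 2"
      using v e unfolding vanishing_def by (meson half_gt_zero)
    have "(\<lambda>n. (Phi \<alpha> (X n) (2 * T) - Phi \<alpha> (X n) T) / T) \<longlonglongrightarrow> (Phi \<alpha> x (2 * T) - Phi \<alpha> x T) / T"
      using T True by (intro tendsto_intros lim) (auto simp: ival_def)
    moreover have "(Phi \<alpha> x (2 * T) - Phi \<alpha> x T) / T < e"
    proof -
      have "(Phi \<alpha> x (2 * T) - Phi \<alpha> x T) / T \<le> rr \<alpha> x T"
        using Phi_upper[OF x T(1), of "2 * T"] T(1) by (simp add: pos_divide_le_eq mult.commute)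
      also have "\<dots> < e" using T(2)[of T] e by simp
      finally show ?thesis .
    qed
    ultimately have "eventually (\<lambda>n. (Phi \<alpha> (X n) (2 * T) - Phi \<alpha> (X n) T) / T < e) sequentially"
      by (rule order_tendstoD)
    then have "eventually (\<lambda>n. \<forall>t\<in>ival \<alpha>. 2 * T \<le> t \<longrightarrow> \<bar>rr \<alpha> (X n) t - rr \<alpha> x t\<bar> \<le> e) sequentially"
    proof eventually_elim
      case (elim n)
      have "rr \<alpha> (X n) (2 * T) \<le> (Phi \<alpha> (X n) (2 * T) - Phi \<alpha> (X n) T) / T"
        using Phi_lower[OF X, of T "2 * T" n] T(1) by (simp add: pos_le_divide_eq mult.commute)
      then have 1: "rr \<alpha> (X n) (2 * T) \<le> e" using elim by simp
      show ?case
      proof (intro ballI impI)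
        fix t assume t: "2 * T \<le> t"
        have "rr \<alpha> (X n) t \<le> e" using rr_antimono[OF X _ t, of n] 1 T(1) by simp
        moreover have "rr \<alpha> x t \<le> e" using T(2)[of t] T(1) t e by simp
        ultimately show "\<bar>rr \<alpha> (X n) t - rr \<alpha> x t\<bar> \<le> e"
          using rr_nonneg[of \<alpha> "X n" t] rr_nonneg[of \<alpha> x t] by linarith
      qed
    qed
    then show ?thesis by blast
  qed
qed (fact e)

text \<open>With a measure preserving \<open>\<sigma>\<close> such that \<open>|x| = x\<^sup>* \<circ> \<sigma>\<close>, the functions
  \<open>sgn x \<cdot> (x\<^sub>n\<^sup>* \<circ> \<sigma>)\<close> converge to \<open>x\<close> in measure, and their distance to \<open>x\<close> is that of \<open>x\<^sub>n\<^sup>*\<close>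
  to \<open>x\<^sup>*\<close>.\<close>

lemma Hg_transport:
  assumes x: "x \<in> E" and v: "vanishing x" and Hg: "Hg_point \<alpha> E nrm x" and X: "\<And>n. X n \<in> E"
    and meas: "\<And>e. 0 < e \<Longrightarrow>
      (\<lambda>n. emeasure (I_measure \<alpha>) {t \<in> ival \<alpha>. e < \<bar>rr \<alpha> (X n) t - rr \<alpha> x t\<bar>}) \<longlonglongrightarrow> 0"
    and lim: "(\<lambda>n. nrm (X n)) \<longlonglongrightarrow> nrm x"
  shows "(\<lambda>n. N (\<lambda>t. rr \<alpha> (X n) t - rr \<alpha> x t)) \<longlonglongrightarrow> 0"
proof -
  let ?I = "I_measure \<alpha>"
  define xr where "xr t = real_of_ereal (x t)" for t
  define w where "w t = \<bar>xr t\<bar>" for t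
  have xm[measurable]: "x \<in> borel_measurable ?I" using in_L0[OF x] by (simp add: L0_def)
  have xrm[measurable]: "xr \<in> borel_measurable ?I" unfolding xr_def[abs_def] by measurable
  have wm[measurable]: "w \<in> borel_measurable ?I" unfolding w_def[abs_def] by measurable
  have xAE: "AE t in ?I. x t = ereal (xr t)"
    using finite_AE[OF x] by eventually_elim (simp add: xr_def ereal_real)
  have dw: "emeasure lebesgue {s \<in> ival \<alpha>. l < w s} = distr_fun \<alpha> x l" for l
  proof -
    have "emeasure ?I {s \<in> space ?I. l < w s} = emeasure ?I {s \<in> space ?I. ereal l < \<bar>x s\<bar>}"
    proof (rule emeasure_eq_AE)
      show "AE s in ?I. (s \<in> {s \<in> space ?I. l < w s}) = (s \<in> {s \<in> space ?I. ereal l < \<bar>x s\<bar>})"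
        using xAE by eventually_elim (simp add: w_def)
    qed measurable
    then show ?thesis by (simp add: distr_fun_def emeasure_I)
  qed
  \<comment> \<open>Vanishing at infinity yields the finite superlevel sets that Ryff's map
    requires.\<close>
  have fin: "emeasure lebesgue {s \<in> ival \<alpha>. l < w s} < \<infinity>" if l: "0 < l" for l
  proof -
    obtain T where T: "0 < T" "rr \<alpha> x T \<le> l" using v l unfolding vanishing_def by blast
    then have "\<not> ereal l < rearrangement \<alpha> x T" using ereal_rr[OF x T(1)] by (metis ereal_less_eq(3) not_le)
    then have "distr_fun \<alpha> x l \<le> ennreal T" using rearrangement_greater_iff[OF in_L0[OF x], of l T] l by simp
    then show ?thesis unfolding dw using le_less_trans by fastforce
  qed
  obtain D \<sigma> where mp: "mp_map \<alpha> D \<sigma>"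
    and D0: "\<And>t. t \<in> ival \<alpha> - D \<Longrightarrow> w t = 0"
    and D\<sigma>: "\<And>t. t \<in> D \<Longrightarrow> emeasure lebesgue {s \<in> ival \<alpha>. w t < w s} \<le> ennreal (\<sigma> t)"
    using ryff_map[OF alpha wm _ fin] by (auto simp: w_def)
  \<comment> \<open>On D, the measure of {w > w t} is at most \<open>\<sigma> t\<close>, which says
    that x* at \<open>\<sigma> t\<close> is at most \<open>w t\<close>. Equality holds almost
    everywhere because both sides have the same distribution.\<close>
  have P_le: "0 \<le> pull D \<sigma> (rr \<alpha> x) t \<and> pull D \<sigma> (rr \<alpha> x) t \<le> w t" for t
  proof (cases "t \<in> D")
    case True
    have "0 \<le> w t" by (simp add: w_def)
    then have "\<not> ereal (w t) < rearrangement \<alpha> x (\<sigma> t)"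
      using D\<sigma>[OF True, unfolded dw] rearrangement_greater_iff[OF in_L0[OF x], of "w t" "\<sigma> t"]
      by (simp add: not_less)
    then have "rr \<alpha> x (\<sigma> t) \<le> w t"
      unfolding rr_def using rearrangement_nonneg[of \<alpha> x "\<sigma> t"] by (cases "rearrangement \<alpha> x (\<sigma> t)") auto
    then show ?thesis using True by (simp add: pull_def)
  next
    case False
    then show ?thesis by (simp add: pull_def w_def)
  qed
  have pm[measurable]: "pull D \<sigma> f \<in> borel_measurable ?I" if "f \<in> borel_measurable borel" for f
    using mp that by (rule pull_measurable)
  have P_eq: "AE t in ?I. pull D \<sigma> (rr \<alpha> x) t = w t"
  proof (rule AE_eq_of_equal_distr)
    show "pull D \<sigma> (rr \<alpha> x) \<in> borel_measurable ?I" by (intro pm rr_borel)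
    show "0 \<le> pull D \<sigma> (rr \<alpha> x) t \<and> pull D \<sigma> (rr \<alpha> x) t \<le> w t" for t by (rule P_le)
    fix l :: real assume l: "0 < l"
    show "emeasure ?I {t \<in> space ?I. l < w t} < \<infinity>" using fin[OF l] by (simp add: emeasure_I)
    have "emeasure ?I {t \<in> space ?I. l < pull D \<sigma> (rr \<alpha> x) t} = emeasure lebesgue {t \<in> ival \<alpha>. l < \<bar>pull D \<sigma> (rr \<alpha> x) t\<bar>}"
      using P_le by (simp add: emeasure_I)
    also have "\<dots> = emeasure lebesgue {t \<in> ival \<alpha>. l < \<bar>rr \<alpha> x t\<bar>}"
      using l by (intro distr_pull_pos[OF alpha mp rr_borel]) simp
    also have "\<dots> = emeasure ?I {t \<in> space ?I. l < rr \<alpha> x t}" by (simp add: emeasure_I)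
    also have "\<dots> = emeasure ?I {t \<in> space ?I. ereal l < \<bar>rearrangement \<alpha> x t\<bar>}"
    proof (rule emeasure_eq_AE)
      show "AE t in ?I. (t \<in> {t \<in> space ?I. l < rr \<alpha> x t}) = (t \<in> {t \<in> space ?I. ereal l < \<bar>rearrangement \<alpha> x t\<bar>})"
        using AE_rr[OF x]
      proof eventually_elim
        case (elim t)
        show ?case unfolding mem_Collect_eq elim[symmetric] by simp
      qed
      have "rr \<alpha> x \<in> borel_measurable ?I" "rearrangement \<alpha> x \<in> borel_measurable ?I"
        by (intro measurable_I_borel; measurable)+
      note [measurable] = this
      show "{t \<in> space ?I. l < rr \<alpha> x t} \<in> sets ?I" by measurable
      show "{t \<in> space ?I. ereal l < \<bar>rearrangement \<alpha> x t\<bar>} \<in> sets ?I" by measurable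
    qed
    also have "\<dots> = distr_fun \<alpha> x l"
      using distr_fun_rearrangement[OF in_L0[OF x]] unfolding distr_fun_def by metis
    also have "\<dots> = emeasure ?I {t \<in> space ?I. l < w t}" using dw[of l] by (simp add: emeasure_I)
    finally show "emeasure ?I {t \<in> space ?I. l < pull D \<sigma> (rr \<alpha> x) t} = emeasure ?I {t \<in> space ?I. l < w t}" .
  qed (fact wm)
  \<comment> \<open>The sign is 1 at zeros of x, so that |W n| is the transported x_n* everywhere.
    The value 0 there could lower the norm of W n.\<close>
  define sg :: "real \<Rightarrow> real" where "sg t = (if xr t < 0 then - 1 else 1)" for t
  have sgm[measurable]: "sg \<in> borel_measurable ?I" unfolding sg_def[abs_def] by measurable
  define W where "W n t = sg t * pull D \<sigma> (rr \<alpha> (X n)) t" for n t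
  have Wm[measurable]: "W n \<in> borel_measurable ?I" for n
    unfolding W_def[abs_def] by (intro borel_measurable_times sgm pm rr_borel)
  let ?d = "\<lambda>n t. rr \<alpha> (X n) t - rr \<alpha> x t"
  have dm: "?d n \<in> borel_measurable borel" for n by measurable
  have diff: "AE t in ?I. \<bar>W n t - xr t\<bar> = \<bar>pull D \<sigma> (?d n) t\<bar>" for n
    using P_eq
  proof eventually_elim
    case (elim t)
    have "xr t = sg t * pull D \<sigma> (rr \<alpha> x) t" unfolding elim by (auto simp: sg_def w_def)
    then have "W n t - xr t = sg t * (pull D \<sigma> (rr \<alpha> (X n)) t - pull D \<sigma> (rr \<alpha> x) t)"
      by (simp add: W_def algebra_simps)
    also have "pull D \<sigma> (rr \<alpha> (X n)) t - pull D \<sigma> (rr \<alpha> x) t = pull D \<sigma> (?d n) t"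
      by (simp add: pull_def)
    finally show ?case by (simp add: sg_def abs_mult)
  qed
  have eld: "elem (?d n)" for n by (intro elem_diff elem_rr X x)
  have W: "(\<lambda>t. ereal (W n t)) \<in> E" "nrm (\<lambda>t. ereal (W n t)) = nrm (X n)" for n
  proof -
    have P: "elem (pull D \<sigma> (rr \<alpha> (X n)))" "N (pull D \<sigma> (rr \<alpha> (X n))) = nrm (X n)"
      using elem_pull[OF elem_rr(1)[OF X] rr_borel mp] elem_rr(2)[OF X] by auto
    have L: "(\<lambda>t. ereal (W n t)) \<in> L0 \<alpha>" unfolding L0_def by measurable
    have A: "AE t in ?I. \<bar>ereal (W n t)\<bar> = \<bar>ereal (pull D \<sigma> (rr \<alpha> (X n)) t)\<bar>"
      by (intro AE_I2) (simp add: W_def sg_def abs_mult)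
    show "(\<lambda>t. ereal (W n t)) \<in> E" "nrm (\<lambda>t. ereal (W n t)) = nrm (X n)"
      using nrm_cong_AE[OF P(1)[unfolded elem_def] L A] P(2) by (auto simp: N_def)
  qed
  have "tendsto_in_measure \<alpha> (\<lambda>n t. ereal (W n t)) x \<longleftrightarrow>
     (\<forall>e>0. (\<lambda>n. emeasure ?I {t \<in> ival \<alpha>. e < \<bar>W n t - xr t\<bar>}) \<longlonglongrightarrow> 0)"
  proof (rule tendsto_in_measure_real_iff)
    show "(\<lambda>t. ereal (W n t)) \<in> borel_measurable ?I" for n by measurable
  qed (use xAE in \<open>simp_all add: Wm xrm xm\<close>)
  moreover have "emeasure ?I {t \<in> ival \<alpha>. e < \<bar>W n t - xr t\<bar>} = emeasure ?I {t \<in> ival \<alpha>. e < \<bar>?d n t\<bar>}"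
    if e: "0 < e" for e n
  proof -
    have [measurable]: "pull D \<sigma> (?d n) \<in> borel_measurable ?I" by (intro pm dm)
    have "emeasure ?I {t \<in> space ?I. e < \<bar>W n t - xr t\<bar>} = emeasure ?I {t \<in> space ?I. e < \<bar>pull D \<sigma> (?d n) t\<bar>}"
    proof (rule emeasure_eq_AE)
      show "AE t in ?I. (t \<in> {t \<in> space ?I. e < \<bar>W n t - xr t\<bar>}) = (t \<in> {t \<in> space ?I. e < \<bar>pull D \<sigma> (?d n) t\<bar>})"
        using diff[of n] by eventually_elim simp
    qed measurable
    also have "\<dots> = emeasure lebesgue {t \<in> ival \<alpha>. e < \<bar>pull D \<sigma> (?d n) t\<bar>}" by (simp add: emeasure_I)
    also have "\<dots> = emeasure lebesgue {t \<in> ival \<alpha>. e < \<bar>?d n t\<bar>}"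
      using e by (intro distr_pull_pos[OF alpha mp dm]) simp
    finally show ?thesis by (simp add: emeasure_I)
  qed
  ultimately have "tendsto_in_measure \<alpha> (\<lambda>n t. ereal (W n t)) x" using meas by simp
  then have "(\<lambda>n. nrm (\<lambda>t. ereal (W n t) - x t)) \<longlonglongrightarrow> 0"
    using Hg lim W unfolding Hg_point_def by auto
  moreover have "nrm (\<lambda>t. ereal (W n t) - x t) = N (?d n)" for n
  proof -
    have P: "elem (pull D \<sigma> (?d n))" "N (pull D \<sigma> (?d n)) = N (?d n)"
      using elem_pull[OF eld dm mp] by auto
    have L: "(\<lambda>t. ereal (W n t) - x t) \<in> L0 \<alpha>" unfolding L0_def by measurable
    have A: "AE t in ?I. \<bar>ereal (W n t) - x t\<bar> = \<bar>ereal (pull D \<sigma> (?d n) t)\<bar>"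
      using diff[of n] xAE by eventually_elim simp
    show ?thesis using nrm_cong_AE(2)[OF P(1)[unfolded elem_def] L A] P(2) by (simp add: N_def)
  qed
  ultimately show ?thesis by simp
qed

text \<open>If y is submajorized by x and has the same norm, the constant sequence y is admissible,
  and the norm of x* - y*, being constant, is 0. A norm larger than that of x is excluded by
  \<open>submajorized_norm\<close>.\<close>

lemma LKM_point_of_LLUKM_point:
  assumes fatou: "fatou_property \<alpha> E nrm" and x: "LLUKM_point \<alpha> E nrm x"
  shows "LKM_point \<alpha> E nrm x"
  unfolding LKM_point_def
proof (intro conjI ballI impI)
  show xE: "x \<in> E" using x by (simp add: LLUKM_point_def)
  fix y assume y: "y \<in> E" and ne: "rearrangement \<alpha> x \<noteq> rearrangement \<alpha> y" and maj: "submajorized \<alpha> y x"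
  have "nrm y \<noteq> nrm x"
  proof
    assume "nrm y = nrm x"
    then have "(\<lambda>n::nat. nrm (\<lambda>t. rearrangement \<alpha> x t - rearrangement \<alpha> y t)) \<longlonglongrightarrow> 0"
      using x y maj unfolding LLUKM_point_def by (elim conjE allE[of _ "\<lambda>n. y"]) simp
    then have "N (\<lambda>t. rr \<alpha> y t - rr \<alpha> x t) = 0"
      unfolding nrm_rearrangement_diff(2)[OF xE y] by (simp add: LIMSEQ_const_iff)
    then show False using rearrangement_eq_of_N[OF xE y] ne by simp
  qed
  then show "nrm y < nrm x" using submajorized_norm[OF fatou y xE maj] by simp
qed

end

theorem theorem3p11:
  fixes \<alpha> :: ereal
    and E :: "(real \<Rightarrow> ereal) set"
    and nrm :: "(real \<Rightarrow> ereal) \<Rightarrow> real"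
    and x :: "real \<Rightarrow> ereal"
  assumes "symmetric_space \<alpha> E nrm"
    and "fatou_property \<alpha> E nrm"
    and "x \<in> E"
    and "rearrangement_at_infinity \<alpha> x = 0"
  defines "cond_i \<equiv> LKM_point \<alpha> E nrm x \<and> Hg_point \<alpha> E nrm x"
    and "cond_ii \<equiv> LKM_point \<alpha> E nrm x \<and>
           (\<forall>X :: nat \<Rightarrow> real \<Rightarrow> ereal. (\<forall>n. X n \<in> E) \<longrightarrow>
              tendsto_in_measure \<alpha> (\<lambda>n. maximal_fun \<alpha> (X n)) (maximal_fun \<alpha> x) \<longrightarrow>
              (\<lambda>n. nrm (X n)) \<longlonglongrightarrow> nrm x \<longrightarrow>
              (\<lambda>n. nrm (\<lambda>t. rearrangement \<alpha> (X n) t - rearrangement \<alpha> x t)) \<longlonglongrightarrow> 0)"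
    and "cond_iii \<equiv> LLUKM_point \<alpha> E nrm x"
  shows "(cond_i \<longrightarrow> cond_ii) \<and> (cond_ii \<longrightarrow> cond_iii) \<and>
         (Hg_point \<alpha> E nrm x \<longrightarrow> cond_iii \<longrightarrow> cond_i)"
proof -
  interpret symmetric_space \<alpha> E nrm by fact
  note fatou = assms(2) and x = assms(3)
  have v: "vanishing x" using assms(3,4) by (rule vanishing_of_limit)
  show ?thesis
  proof (intro conjI impI)
    assume i: cond_i
    have "(\<lambda>n. nrm (\<lambda>t. rearrangement \<alpha> (X n) t - rearrangement \<alpha> x t)) \<longlonglongrightarrow> 0"
      if X: "\<forall>n. X n \<in> E" and conv: "tendsto_in_measure \<alpha> (\<lambda>n. maximal_fun \<alpha> (X n)) (maximal_fun \<alpha> x)"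
        and lim: "(\<lambda>n. nrm (X n)) \<longlonglongrightarrow> nrm x" for X :: "nat \<Rightarrow> real \<Rightarrow> ereal"
    proof -
      have X': "X n \<in> E" for n using X by simp
      have "(\<lambda>n. N (\<lambda>t. rr \<alpha> (X n) t - rr \<alpha> x t)) \<longlonglongrightarrow> 0"
      proof (rule Hg_transport[OF x v _ X' _ lim])
        show "Hg_point \<alpha> E nrm x" using i by (simp add: cond_i_def)
        show "(\<lambda>n. emeasure (I_measure \<alpha>) {t \<in> ival \<alpha>. e < \<bar>rr \<alpha> (X n) t - rr \<alpha> x t\<bar>}) \<longlonglongrightarrow> 0"
          if "0 < e" for e
          by (rule rr_in_measure[OF x v X' _ that]) (rule Phi_pointwise_of_maximal[OF x X' conv])
      qed
      then show ?thesis by (simp only: nrm_rearrangement_diff(1)[OF x X'])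
    qed
    then show cond_ii using i unfolding cond_i_def cond_ii_def by blast
  next
    assume ii: cond_ii
    have "(\<lambda>n. nrm (\<lambda>t. rearrangement \<alpha> x t - rearrangement \<alpha> (X n) t)) \<longlonglongrightarrow> 0"
      if X: "\<forall>n. X n \<in> E \<and> submajorized \<alpha> (X n) x" and lim: "(\<lambda>n. nrm (X n)) \<longlonglongrightarrow> nrm x"
      for X :: "nat \<Rightarrow> real \<Rightarrow> ereal"
    proof -
      have X': "X n \<in> E" "submajorized \<alpha> (X n) x" for n using X by auto
      have "tendsto_in_measure \<alpha> (\<lambda>n. maximal_fun \<alpha> (X n)) (maximal_fun \<alpha> x)"
        using maximal_in_measure_of_norm[OF fatou x v _ X' lim] ii by (simp add: cond_ii_def)
      then have "(\<lambda>n. nrm (\<lambda>t. rearrangement \<alpha> (X n) t - rearrangement \<alpha> x t)) \<longlonglongrightarrow> 0"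
        using ii X'(1) lim unfolding cond_ii_def by blast
      then show ?thesis
        by (simp only: nrm_rearrangement_diff(1)[OF x X'(1)] nrm_rearrangement_diff(2)[OF x X'(1)])
    qed
    then show cond_iii using x unfolding cond_iii_def LLUKM_point_def by blast
  next
    assume "Hg_point \<alpha> E nrm x" cond_iii
    then show cond_i
      using LKM_point_of_LLUKM_point[OF fatou] by (simp add: cond_i_def cond_iii_def)
  qed
qed

end
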